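(* Let $M\in\mathcal U$. Then $\operatorname{Ext}_{\mathcal U}^*(\mathbb F_2,M)$ can be computed as the homology of the complex $$K^*(M^\vee,\mathcal U,\mathbb F_2):=\prod_{d\ge 0}\operatorname{Ann}_{B(d+1)}M\otimes L(0)_d\ \subseteq\ M\,\widehat\otimes\,\bar K^*(\mathcal R)$$ with differential determined by $$d(x\otimes 1)=\sum_{r\ge 0}Q^r x\otimes \operatorname{Sq}^{r+1},$$ that is, $d(x\otimes w)=\sum_r Q^rx\otimes \operatorname{Sq}^{r+1}w$ for $w\in L(0)$.
   Context: $\mathcal R$ is the mod 2 Dyer-Lashof algebra: the graded $\mathbb F_2$-algebra with generators $Q^i$, $i\ge 0$, $\deg Q^i=i$, and relations $Q^iQ^j=\sum_k\binom{k-j-1}{2k-i}Q^{i+j-k}Q^k$ for $i>2j$. For $I=(i_1,\dots,i_s)$ put $Q^I=Q^{i_1}\cdots Q^{i_s}$; $I$ is allowable if $i_j\le 2i_{j+1}$ for all $j$, and the excess is $e(I)=i_1-i_2-\cdots-i_s$. $B(d+1)\subset\mathcal R$ is the two-sided ideal spanned by the $Q^I$ with $I$ allowable of excess $\le d$; $\operatorname{Ann}_{B(d+1)}M$ is the set of elements of $M$ annihilated by $B(d+1)$. $\mathcal U$ is the category of non-negatively graded 1-allowable $\mathcal R$-modules (those with $Q^ix=0$ for $i\le\deg x$). The forgetful functor from $\mathcal U$ to graded $\mathbb F_2$-vector spaces has left adjoint $U(V)=\mathcal R\otimes V/\{Q^ix\mid i\le\deg x\}$. $\mathbb F_2$ is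 placed in degree $0$. $\operatorname{Ext}_{\mathcal U}^*(\mathbb F_2,M)$ is defined as the homology of the standard complex $\operatorname{Hom}_{\mathcal R}(U^{\bullet+1}\mathbb F_2,M)$ coming from the comonadic simplicial resolution $U^{\bullet+1}\mathbb F_2\to\mathbb F_2$, where $\operatorname{Hom}_{\mathcal R}$ denotes $\mathcal R$-linear maps, not necessarily degree preserving (so $\operatorname{Hom}_{\mathcal R}(\mathcal R/B(d+1),M)\cong\operatorname{Ann}_{B(d+1)}M$). $\bar K^*(\mathcal R)\cong\operatorname{Ext}^*_{\mathcal R}(\mathbb F_2,\mathbb F_2)$ is the algebra with generators $\beta_i=\operatorname{Sq}^{i+1}$, $i\ge0$, each of cohomological (length) degree 1, and relations $\operatorname{Sq}^a\operatorname{Sq}^b=\sum_k\binom{b-k-1}{a-2k}\operatorname{Sq}^{a+b-k}\operatorname{Sq}^k$ for $a<2b$, with $\operatorname{Sq}^0=0$. $L(0)\subset\bar K^*(\mathcal R)$ is the subspace spanned by the words $\beta_{i_1}\cdots\beta_{i_s}$, $s\ge 0$, with $i_j>i_{j+1}+\cdots+i_s$ for $1\le j\le s$ (empty sums being $0$); $L(0)_d$ is the part spanned by words with $i_1+\cdots+i_s=d$. The tensor product $\widehat\otimes$ is completed (infinite linear combinations of basic tensors are allowed), and the cohomological degree is the word length $s$. *)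

theory Defs
  imports
    Complex_Main
    "HOL-Library.Poly_Mapping"
    "HOL-Library.Z2"
    "HOL-Library.Function_Algebras"
    "HOL-Algebra.Coset"
begin

section \<open>Linear algebra over the field with two elements\<close>

text \<open>
  An \<open>F\<^sub>2\<close>-vector space is an abelian group in which \<open>x + x = 0\<close>; \<open>scale2\<close> is then the
  scalar multiplication, linear maps are the additive maps, and isomorphisms of vector spaces are
  the isomorphisms of groups.
\<close>

definition scale2 :: "bit \<Rightarrow> 'a::ab_group_add \<Rightarrow> 'a" where
  "scale2 c x = (if c = 0 then 0 else x)"

abbreviation span2 :: "'a::ab_group_add set \<Rightarrow> 'a set" where
  "span2 \<equiv> module.span scale2"

lemma scale2_simps [simp]: "scale2 0 x = 0" "scale2 1 x = x"
  by (simp_all add: scale2_def)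

lemma vector_space_scale2:
  assumes "\<And>x::'a::ab_group_add. x + x = 0"
  shows "vector_space (scale2 :: bit \<Rightarrow> 'a \<Rightarrow> 'a)"
proof
  fix a b :: bit and x y :: 'a
  show "scale2 a (x + y) = scale2 a x + scale2 a y" by (simp add: scale2_def)
  show "scale2 (a + b) x = scale2 a x + scale2 b x"
    using assms[of x] by (cases a; cases b) (simp_all add: scale2_def)
  show "scale2 a (scale2 b x) = scale2 (a * b) x" by (simp add: scale2_def)
  show "scale2 1 x = x" by (simp add: scale2_def)
qed

text \<open>\<open>'x \<Rightarrow>\<^sub>0 bit\<close> is the \<open>F\<^sub>2\<close>-vector space with basis \<open>'x\<close>; \<open>lin f\<close> is the linear extension of
  the map \<open>f\<close> on basis vectors.\<close>

abbreviation bas :: "'x \<Rightarrow> ('x \<Rightarrow>\<^sub>0 bit)" where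
  "bas x \<equiv> Poly_Mapping.single x 1"

definition lin :: "('x \<Rightarrow> 'b::ab_group_add) \<Rightarrow> ('x \<Rightarrow>\<^sub>0 bit) \<Rightarrow> 'b" where
  "lin f z = (\<Sum>x\<in>Poly_Mapping.keys z. f x)"

lemma pm2_double [simp]: "(z :: 'x \<Rightarrow>\<^sub>0 bit) + z = 0"
  by (rule poly_mapping_eqI) (simp add: lookup_add)

interpretation pm2: vector_space "scale2 :: bit \<Rightarrow> ('x \<Rightarrow>\<^sub>0 bit) \<Rightarrow> ('x \<Rightarrow>\<^sub>0 bit)"
  by (rule vector_space_scale2) (rule pm2_double)

lemma lin_bas [simp]: "lin f (bas x) = f x"
  by (simp add: lin_def)

lemma lin_0 [simp]: "lin f 0 = 0"
  by (simp add: lin_def)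

lemma lin_add:
  assumes "\<And>x::'b::ab_group_add. x + x = 0"
  shows "lin f (y + z) = lin f y + (lin f z :: 'b)"
proof -
  interpret v: vector_space "scale2 :: bit \<Rightarrow> 'b \<Rightarrow> 'b" by (rule vector_space_scale2[OF assms])
  let ?K = "Poly_Mapping.keys y \<union> Poly_Mapping.keys z"
  have *: "lin f u = (\<Sum>x\<in>?K. scale2 (Poly_Mapping.lookup u x) (f x))"
    if "Poly_Mapping.keys u \<subseteq> ?K" for u
    unfolding lin_def
    by (rule sum.mono_neutral_cong_left)
       (use that in \<open>auto simp: scale2_def in_keys_iff\<close>)
  show ?thesis
    using keys_add[of y z]
    by (simp only: *[OF keys_add] *[OF Un_upper1] *[OF Un_upper2]
        lookup_add v.scale_left_distrib sum.distrib)
qed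

lemma additive_span2_zero:
  assumes h: "\<And>x y. h (x + y) = h x + (h y :: 'c::ab_group_add)"
    and S: "\<And>x. x \<in> S \<Longrightarrow> h x = 0" and z: "z \<in> span2 (S :: ('x \<Rightarrow>\<^sub>0 bit) set)"
  shows "h z = 0"
proof -
  have h0: "h 0 = 0" using h[of 0 0] by simp
  from z show ?thesis
  proof (induction rule: pm2.span_induct_alt)
    case base then show ?case by (rule h0)
  next
    case (step c x y)
    then show ?case using h0 S by (cases c) (simp_all add: h)
  qed
qed


section \<open>Quadratic algebras given by generators and relations\<close>

datatype word = Word (letters: "nat list")

instantiation word :: monoid_add
begin
definition "0 = Word []"
definition "u + v = Word (letters u @ letters v)"
instance by standard (simp_all add: zero_word_def plus_word_def)
end

text \<open>The free associative \<open>F\<^sub>2\<close>-algebra on generators indexed by the natural numbers; the product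
  of \<^typ>\<open>word \<Rightarrow>\<^sub>0 bit\<close> is induced by concatenation of words.\<close>

type_synonym free_alg = "word \<Rightarrow>\<^sub>0 bit"

definition gen :: "nat \<Rightarrow> free_alg" where
  "gen i = bas (Word [i])"

definition two_sided_ideal :: "free_alg set \<Rightarrow> free_alg set" where
  "two_sided_ideal S = span2 {u * r * v | u r v. r \<in> S}"

definition const_coeff :: "free_alg \<Rightarrow> bit" where
  "const_coeff a = Poly_Mapping.lookup a 0"

lemma word_sum_zero: "(u::word) + v = 0 \<longleftrightarrow> u = 0 \<and> v = 0"
  by (cases u; cases v) (auto simp: zero_word_def plus_word_def)

lemma const_coeff_add: "const_coeff (a + b) = const_coeff a + const_coeff b"
  by (simp add: const_coeff_def lookup_add)

lemma const_coeff_0 [simp]: "const_coeff 0 = 0"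
  by (simp add: const_coeff_def)

lemma const_coeff_1 [simp]: "const_coeff 1 = 1"
  by (simp add: const_coeff_def lookup_one)

lemma const_coeff_gen [simp]: "const_coeff (gen i) = 0"
  by (simp add: const_coeff_def gen_def lookup_single zero_word_def)

lemma const_coeff_mult: "const_coeff (a * b) = const_coeff a * const_coeff b"
proof -
  have 1: "(\<Sum>q. Poly_Mapping.lookup b q when 0 = l + q)
      = (Poly_Mapping.lookup b 0 when l = 0)" for l
  proof (cases "l = 0")
    case True
    then show ?thesis by (simp add: when_def)
  next
    case False
    then have "0 \<noteq> l + q" for q using word_sum_zero[of l q] by metis
    then show ?thesis using False by (simp add: when_def)
  qed
  show ?thesis
    unfolding const_coeff_def times_poly_mapping.rep_eq prod_fun_def 1
    by (simp only: mult_when Sum_any_when_equal)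
qed

lemma const_coeff_diff: "const_coeff (a - b) = const_coeff a - const_coeff b"
  by (simp add: const_coeff_def lookup_minus)

lemma const_coeff_sum: "const_coeff (sum f A) = (\<Sum>x\<in>A. const_coeff (f x))"
  by (induction A rule: infinite_finite_induct) (simp_all add: const_coeff_add)

lemma two_sided_ideal_const_coeff:
  assumes "\<And>r. r \<in> S \<Longrightarrow> const_coeff r = 0" "z \<in> two_sided_ideal S"
  shows "const_coeff z = 0"
proof (rule additive_span2_zero[of const_coeff])
  show "z \<in> span2 {u * r * v | u r v. r \<in> S}" using assms(2) by (simp add: two_sided_ideal_def)
qed (use assms(1) in \<open>auto simp: const_coeff_add const_coeff_mult\<close>)

lemma two_sided_ideal_mult:
  assumes "z \<in> two_sided_ideal S"
  shows "a * z \<in> two_sided_ideal S" "z * a \<in> two_sided_ideal S"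
proof -
  have "a * z \<in> two_sided_ideal S \<and> z * a \<in> two_sided_ideal S"
    using assms unfolding two_sided_ideal_def
  proof (induction rule: pm2.span_induct_alt)
    case base
    then show ?case by (simp add: pm2.span_zero)
  next
    case (step c x y)
    from step(1) obtain u r v where x: "x = u * r * v" "r \<in> S" by blast
    have "a * x \<in> {u * r * v | u r v. r \<in> S}" "x * a \<in> {u * r * v | u r v. r \<in> S}"
      unfolding x using x(2) by (auto simp: mult.assoc) (metis mult.assoc)+
    then show ?case using step(2)
      by (cases c) (simp_all add: distrib_left distrib_right pm2.span_add pm2.span_base del: mem_Collect_eq)
  qed
  then show "a * z \<in> two_sided_ideal S" "z * a \<in> two_sided_ideal S" by auto
qed

definition cong_mod :: "('x \<Rightarrow>\<^sub>0 bit) set \<Rightarrow> ('x \<Rightarrow>\<^sub>0 bit) \<Rightarrow> ('x \<Rightarrow>\<^sub>0 bit) \<Rightarrow> bool" where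
  "cong_mod N a b \<longleftrightarrow> a - b \<in> N"

lemma equivp_cong_mod: "equivp (cong_mod (span2 S))"
proof (rule equivpI)
  show "reflp (cong_mod (span2 S))" by (simp add: reflp_def cong_mod_def pm2.span_zero)
  show "symp (cong_mod (span2 S))"
    unfolding symp_def cong_mod_def by (metis minus_diff_eq pm2.span_neg)
  show "transp (cong_mod (span2 S))"
    unfolding transp_def cong_mod_def
  proof (intro allI impI)
    fix x y z assume "x - y \<in> span2 S" "y - z \<in> span2 S"
    from pm2.span_add[OF this] show "x - z \<in> span2 S" by simp
  qed
qed

lemma cong_mod_add:
  "cong_mod (span2 S) a a' \<Longrightarrow> cong_mod (span2 S) b b' \<Longrightarrow> cong_mod (span2 S) (a + b) (a' + b')"
  unfolding cong_mod_def add_diff_add by (rule pm2.span_add)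

lemma cong_mod_minus:
  "cong_mod (span2 S) a a' \<Longrightarrow> cong_mod (span2 S) (- a) (- a')"
  unfolding cong_mod_def minus_diff_minus by (rule pm2.span_neg)

lemma cong_mod_mult:
  assumes "cong_mod (two_sided_ideal S) a a'" "cong_mod (two_sided_ideal S) b b'"
  shows "cong_mod (two_sided_ideal S) (a * b) (a' * b')"
proof -
  have "a * b - a' * b' = (a - a') * b + a' * (b - b')" by (simp add: algebra_simps)
  moreover have "\<dots> \<in> two_sided_ideal S"
    using assms two_sided_ideal_mult[of "a - a'" S b] two_sided_ideal_mult[of "b - b'" S a']
    by (simp add: cong_mod_def two_sided_ideal_def pm2.span_add)
  ultimately show ?thesis by (simp add: cong_mod_def)
qed


section \<open>The Dyer-Lashof algebra\<close>

text \<open>In \<open>dl_rels\<close> and \<open>kd_rels\<close> the index \<open>k\<close> is restricted to the range where both entries of the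
  binomial coefficient and both indices are non-negative; in particular the natural-number
  subtractions below never truncate.\<close>

definition dl_rels :: "free_alg set" where
  "dl_rels = {gen i * gen j
      - (\<Sum>k\<in>{k. i \<le> 2 * k \<and> k \<le> i + j}.
           of_nat ((k - j - 1) choose (2 * k - i)) * gen (i + j - k) * gen k) | i j. i > 2 * j}"

lemma const_coeff_dl_rels: "r \<in> dl_rels \<Longrightarrow> const_coeff r = 0"
  by (auto simp: dl_rels_def const_coeff_diff const_coeff_sum const_coeff_mult)

lemma dl_ideal_const_coeff: "z \<in> two_sided_ideal dl_rels \<Longrightarrow> const_coeff z = 0"
  using two_sided_ideal_const_coeff const_coeff_dl_rels by blast

quotient_type dl = free_alg / "cong_mod (two_sided_ideal dl_rels)"
  unfolding two_sided_ideal_def by (rule equivp_cong_mod)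

instantiation dl :: ring_1
begin
lift_definition zero_dl :: dl is 0 .
lift_definition one_dl :: dl is 1 .
lift_definition plus_dl :: "dl \<Rightarrow> dl \<Rightarrow> dl" is "(+)"
  unfolding two_sided_ideal_def by (rule cong_mod_add)
lift_definition uminus_dl :: "dl \<Rightarrow> dl" is uminus
  unfolding two_sided_ideal_def by (rule cong_mod_minus)
lift_definition times_dl :: "dl \<Rightarrow> dl \<Rightarrow> dl" is "(*)" by (rule cong_mod_mult)
definition minus_dl :: "dl \<Rightarrow> dl \<Rightarrow> dl" where "minus_dl a b = a + - b"
instance
proof
  have refl: "cong_mod (two_sided_ideal dl_rels) x x" for x
    by (simp add: cong_mod_def two_sided_ideal_def pm2.span_zero)
  fix a b c :: dl
  show "a * b * c = a * (b * c)" by transfer (simp add: mult.assoc refl)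
  show "1 * a = a" by transfer (simp add: refl)
  show "a * 1 = a" by transfer (simp add: refl)
  show "a + b + c = a + (b + c)" by transfer (simp add: add.assoc refl)
  show "a + b = b + a" by transfer (simp add: add.commute refl)
  show "0 + a = a" by transfer (simp add: refl)
  show "- a + a = 0" by transfer (simp add: refl)
  show "a - b = a + - b" by (rule minus_dl_def)
  show "(a + b) * c = a * c + b * c" by transfer (simp add: distrib_right refl)
  show "a * (b + c) = a * b + a * c" by transfer (simp add: distrib_left refl)
  have "\<not> cong_mod (two_sided_ideal dl_rels) 0 1"
  proof
    assume "cong_mod (two_sided_ideal dl_rels) 0 1"
    then have "const_coeff (0 - 1) = 0"
      unfolding cong_mod_def by (rule dl_ideal_const_coeff)
    then show False by (simp only: const_coeff_diff const_coeff_0 const_coeff_1) simp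
  qed
  then show "(0::dl) \<noteq> 1" by (simp add: zero_dl_def one_dl_def dl.abs_eq_iff)
qed
end

lift_definition Q :: "nat \<Rightarrow> dl" is gen .

lift_definition aug :: "dl \<Rightarrow> bit" is const_coeff
  using dl_ideal_const_coeff
  by (fastforce simp: cong_mod_def const_coeff_diff)

definition Qs :: "nat list \<Rightarrow> dl" where
  "Qs I = prod_list (map Q I)"

definition allowable :: "nat list \<Rightarrow> bool" where
  "allowable I \<longleftrightarrow> (\<forall>j. Suc j < length I \<longrightarrow> I ! j \<le> 2 * I ! Suc j)"

definition excess :: "nat list \<Rightarrow> int" where
  "excess I = int (hd I) - int (sum_list (tl I))"

definition dl_deg :: "nat \<Rightarrow> dl set" where
  "dl_deg q = span2 {Qs I | I. sum_list I = q}"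

text \<open>\<open>ideal_B (d + 1)\<close> is spanned by the allowable monomials of excess at most \<open>d\<close>. The empty
  sequence, i.e. the unit of the algebra, has infinite excess and does not belong to it.\<close>

definition ideal_B :: "nat \<Rightarrow> dl set" where
  "ideal_B n = span2 {Qs I | I. I \<noteq> [] \<and> allowable I \<and> excess I < int n}"

definition Ann_B :: "(dl \<Rightarrow> 'm \<Rightarrow> 'm::ab_group_add) \<Rightarrow> nat \<Rightarrow> 'm set" where
  "Ann_B act n = {x. \<forall>b\<in>ideal_B n. act b x = 0}"


section \<open>The category of 1-allowable modules\<close>

text \<open>A graded module is an ungraded module that is the internal direct sum of the subgroups
  \<open>M p\<close>. That the underlying abelian group is an \<open>F\<^sub>2\<close>-vector space follows from \<open>1 + 1 = 0\<close> in
  the ring \<^typ>\<open>dl\<close>.\<close>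

locale dl_module =
  fixes act :: "dl \<Rightarrow> 'm::ab_group_add \<Rightarrow> 'm"
  assumes act_add_right: "act a (x + y) = act a x + act a y"
    and act_add_left: "act (a + b) x = act a x + act b x"
    and act_mult: "act (a * b) x = act a (act b x)"
    and act_one: "act 1 x = x"

locale graded_dl_module = dl_module act
  for act :: "dl \<Rightarrow> 'm::ab_group_add \<Rightarrow> 'm" +
  fixes M :: "nat \<Rightarrow> 'm set"
  assumes grade_zero: "0 \<in> M p"
    and grade_add: "x \<in> M p \<Longrightarrow> y \<in> M p \<Longrightarrow> x + y \<in> M p"
    and grade_uminus: "x \<in> M p \<Longrightarrow> - x \<in> M p"
    and grade_decomp: "\<exists>!c. finite {p. c p \<noteq> 0} \<and> (\<forall>p. c p \<in> M p) \<and> x = (\<Sum>p | c p \<noteq> 0. c p)"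
    and act_grade: "a \<in> dl_deg q \<Longrightarrow> x \<in> M p \<Longrightarrow> act a x \<in> M (q + p)"

locale U_module = graded_dl_module act M
  for act :: "dl \<Rightarrow> 'm::ab_group_add \<Rightarrow> 'm" and M :: "nat \<Rightarrow> 'm set" +
  assumes one_allowable: "x \<in> M p \<Longrightarrow> i \<le> p \<Longrightarrow> act (Q i) x = 0"


section \<open>The comonadic resolution of \<open>F\<^sub>2\<close>\<close>

text \<open>
  All objects \<open>U\<^sup>n F\<^sub>2\<close> are realised as quotients \<open>T/N\<close> of one vector space \<open>T\<close>, with basis the
  lists of elements of the algebra; the list \<open>[a\<^sub>1, \<dots>, a\<^sub>n]\<close> stands for the class of
  \<open>a\<^sub>1 \<otimes> \<dots> \<otimes> a\<^sub>n \<otimes> 1\<close>. For \<open>V = T/N\<close>, the space \<open>U(V) = R \<otimes> V / {Q\<^sup>i x | i \<le> deg x}\<close>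
  is \<open>T / U_rel N\<close>, where the list \<open>a # v\<close> represents \<open>a \<otimes> v\<close>. Thus \<open>U_rel N\<close> is
  spanned by the empty list (which represents nothing in \<open>U(V)\<close>), the relations defining a tensor
  product over \<open>F\<^sub>2\<close> with \<open>V = T/N\<close>, and the submodule generated by the \<open>Q\<^sup>i y\<close> with \<open>i \<le> deg y\<close>.
  Linear maps out of \<open>T/N\<close> are the linear maps on \<open>T\<close> that vanish on \<open>N\<close>.
\<close>

type_synonym T = "dl list \<Rightarrow>\<^sub>0 bit"

definition tens :: "dl \<Rightarrow> T \<Rightarrow> T" where
  "tens a = lin (\<lambda>v. bas (a # v))"

text \<open>The module structure: on \<open>F\<^sub>2\<close>, spanned by the empty list, all \<open>Q\<^sup>i\<close> act as zero, and on
  \<open>U(V)\<close> the algebra acts on the left tensor factor.\<close>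

definition T_act :: "dl \<Rightarrow> T \<Rightarrow> T" where
  "T_act a = lin (\<lambda>v. case v of [] \<Rightarrow> scale2 (aug a) (bas []) | b # w \<Rightarrow> bas ((a * b) # w))"

definition T_deg :: "nat \<Rightarrow> T set" where
  "T_deg p = span2 {bas v | v ps. list_all2 (\<lambda>a q. a \<in> dl_deg q) v ps \<and> sum_list ps = p}"

definition F2_rel :: "T set" where
  "F2_rel = span2 {bas v | v. v \<noteq> []}"

definition U_rel :: "T set \<Rightarrow> T set" where
  "U_rel N = span2
     ({bas []}
      \<union> {bas ((a + b) # v) - bas (a # v) - bas (b # v) | a b v. True}
      \<union> {tens a z | a z. z \<in> N}
      \<union> {T_act a (T_act (Q i) y) | a i y p. y \<in> T_deg p \<and> i \<le> p})"

definition U_map :: "(T \<Rightarrow> T) \<Rightarrow> T \<Rightarrow> T" where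
  "U_map f = lin (\<lambda>v. case v of [] \<Rightarrow> 0 | a # w \<Rightarrow> tens a (f (bas w)))"

definition counit :: "T \<Rightarrow> T" where
  "counit = lin (\<lambda>v. case v of [] \<Rightarrow> 0 | a # w \<Rightarrow> T_act a (bas w))"

text \<open>The face \<open>U\<^sup>i \<epsilon> U\<^sup>n\<^sup>-\<^sup>i : U\<^sup>n\<^sup>+\<^sup>1 F\<^sub>2 \<rightarrow> U\<^sup>n F\<^sub>2\<close> for \<open>i \<le> n\<close>.\<close>

definition face :: "nat \<Rightarrow> T \<Rightarrow> T" where
  "face i = (U_map ^^ i) counit"

definition Hom_res :: "(dl \<Rightarrow> 'm \<Rightarrow> 'm::ab_group_add) \<Rightarrow> nat \<Rightarrow> (T \<Rightarrow> 'm) set" where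
  "Hom_res act n = {f. additive f
      \<and> (\<forall>z \<in> (U_rel ^^ Suc n) F2_rel. f z = 0)
      \<and> (\<forall>a z. f (T_act a z) = act a (f z))}"

definition Hom_res_d :: "nat \<Rightarrow> (T \<Rightarrow> 'm::ab_group_add) \<Rightarrow> T \<Rightarrow> 'm" where
  "Hom_res_d n f = (\<lambda>z. \<Sum>i\<le>Suc n. f (face i z))"


section \<open>Cohomology of a cochain complex\<close>

definition additive_group :: "'a::ab_group_add set \<Rightarrow> 'a monoid" where
  "additive_group S = \<lparr>carrier = S, monoid.mult = (+), one = 0\<rparr>"

definition cohomology ::
    "(nat \<Rightarrow> 'a::ab_group_add set) \<Rightarrow> (nat \<Rightarrow> 'a \<Rightarrow> 'a) \<Rightarrow> nat \<Rightarrow> 'a set monoid" where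
  "cohomology C D n =
     additive_group {x \<in> C n. D n x = 0} Mod (case n of 0 \<Rightarrow> {0} | Suc m \<Rightarrow> D m ` C m)"

definition Ext_U :: "(dl \<Rightarrow> 'm \<Rightarrow> 'm::ab_group_add) \<Rightarrow> nat \<Rightarrow> (T \<Rightarrow> 'm) set monoid" where
  "Ext_U act = cohomology (Hom_res act) Hom_res_d"


section \<open>The Koszul dual algebra\<close>

definition sq_gen :: "nat \<Rightarrow> free_alg" where
  "sq_gen a = (case a of 0 \<Rightarrow> 0 | Suc i \<Rightarrow> gen i)"

definition kd_rels :: "free_alg set" where
  "kd_rels = {sq_gen a * sq_gen b
      - (\<Sum>k\<in>{k. 2 * k \<le> a}.
           of_nat ((b - k - 1) choose (a - 2 * k)) * sq_gen (a + b - k) * sq_gen k)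
      | a b. a < 2 * b}"

lemma const_coeff_kd_rels: "r \<in> kd_rels \<Longrightarrow> const_coeff r = 0"
proof -
  have "const_coeff (sq_gen a) = 0" for a by (simp add: sq_gen_def split: nat.split)
  then show "r \<in> kd_rels \<Longrightarrow> const_coeff r = 0"
    by (auto simp: kd_rels_def const_coeff_diff const_coeff_sum const_coeff_mult)
qed

lemma kd_ideal_const_coeff: "z \<in> two_sided_ideal kd_rels \<Longrightarrow> const_coeff z = 0"
  using two_sided_ideal_const_coeff const_coeff_kd_rels by blast

quotient_type kd = free_alg / "cong_mod (two_sided_ideal kd_rels)"
  unfolding two_sided_ideal_def by (rule equivp_cong_mod)

instantiation kd :: ring_1
begin
lift_definition zero_kd :: kd is 0 .
lift_definition one_kd :: kd is 1 .
lift_definition plus_kd :: "kd \<Rightarrow> kd \<Rightarrow> kd" is "(+)"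
  unfolding two_sided_ideal_def by (rule cong_mod_add)
lift_definition uminus_kd :: "kd \<Rightarrow> kd" is uminus
  unfolding two_sided_ideal_def by (rule cong_mod_minus)
lift_definition times_kd :: "kd \<Rightarrow> kd \<Rightarrow> kd" is "(*)" by (rule cong_mod_mult)
definition minus_kd :: "kd \<Rightarrow> kd \<Rightarrow> kd" where "minus_kd a b = a + - b"
instance
proof
  have refl: "cong_mod (two_sided_ideal kd_rels) x x" for x
    by (simp add: cong_mod_def two_sided_ideal_def pm2.span_zero)
  fix a b c :: kd
  show "a * b * c = a * (b * c)" by transfer (simp add: mult.assoc refl)
  show "1 * a = a" by transfer (simp add: refl)
  show "a * 1 = a" by transfer (simp add: refl)
  show "a + b + c = a + (b + c)" by transfer (simp add: add.assoc refl)
  show "a + b = b + a" by transfer (simp add: add.commute refl)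
  show "0 + a = a" by transfer (simp add: refl)
  show "- a + a = 0" by transfer (simp add: refl)
  show "a - b = a + - b" by (rule minus_kd_def)
  show "(a + b) * c = a * c + b * c" by transfer (simp add: distrib_right refl)
  show "a * (b + c) = a * b + a * c" by transfer (simp add: distrib_left refl)
  have "\<not> cong_mod (two_sided_ideal kd_rels) 0 1"
  proof
    assume "cong_mod (two_sided_ideal kd_rels) 0 1"
    then have "const_coeff (0 - 1) = 0"
      unfolding cong_mod_def by (rule kd_ideal_const_coeff)
    then show False by (simp only: const_coeff_diff const_coeff_0 const_coeff_1) simp
  qed
  then show "(0::kd) \<noteq> 1" by (simp add: zero_kd_def one_kd_def kd.abs_eq_iff)
qed
end

lift_definition Sq :: "nat \<Rightarrow> kd" is sq_gen .

definition betas :: "nat list \<Rightarrow> kd" where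
  "betas I = prod_list (map (\<lambda>i. Sq (i + 1)) I)"

text \<open>\<open>L0 s d\<close> is the part of \<open>L(0)\<close> spanned by the words of length \<open>s\<close> with index sum \<open>d\<close>, and
  \<open>kd_part s d\<close> the corresponding part of the whole algebra.\<close>

definition L0 :: "nat \<Rightarrow> nat \<Rightarrow> kd set" where
  "L0 s d = span2 {betas I | I. length I = s \<and> sum_list I = d
      \<and> (\<forall>j<length I. I ! j > sum_list (drop (Suc j) I))}"

definition kd_part :: "nat \<Rightarrow> nat \<Rightarrow> kd set" where
  "kd_part s d = span2 {betas I | I. length I = s \<and> sum_list I = d}"


section \<open>Tensor products over the field with two elements\<close>

definition bilin_rels :: "('a::ab_group_add \<times> 'b::ab_group_add \<Rightarrow>\<^sub>0 bit) set" where
  "bilin_rels = {bas (x + x', y) - bas (x, y) - bas (x', y) | x x' y. True}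
     \<union> {bas (x, y + y') - bas (x, y) - bas (x, y') | x y y'. True}"

quotient_type (overloaded) ('a, 'b) tensor =
    "('a::ab_group_add \<times> 'b::ab_group_add) \<Rightarrow>\<^sub>0 bit" / "cong_mod (span2 bilin_rels)"
  by (rule equivp_cong_mod)

instantiation tensor :: (ab_group_add, ab_group_add) ab_group_add
begin
lift_definition zero_tensor :: "('a, 'b) tensor" is 0 .
lift_definition plus_tensor :: "('a, 'b) tensor \<Rightarrow> ('a, 'b) tensor \<Rightarrow> ('a, 'b) tensor" is "(+)"
  by (rule cong_mod_add)
lift_definition uminus_tensor :: "('a, 'b) tensor \<Rightarrow> ('a, 'b) tensor" is uminus
  by (rule cong_mod_minus)
definition minus_tensor :: "('a, 'b) tensor \<Rightarrow> ('a, 'b) tensor \<Rightarrow> ('a, 'b) tensor" where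
  "minus_tensor a b = a + - b"
instance
proof
  have refl: "cong_mod (span2 bilin_rels) x x" for x :: "'a \<times> 'b \<Rightarrow>\<^sub>0 bit"
    by (simp add: cong_mod_def pm2.span_zero)
  fix a b c :: "('a, 'b) tensor"
  show "a + b + c = a + (b + c)" by transfer (simp add: add.assoc refl)
  show "a + b = b + a" by transfer (simp add: add.commute refl)
  show "0 + a = a" by transfer (simp add: refl)
  show "- a + a = 0" by transfer (simp add: refl)
  show "a - b = a + - b" by (rule minus_tensor_def)
qed
end

lift_definition ten :: "'a::ab_group_add \<Rightarrow> 'b::ab_group_add \<Rightarrow> ('a, 'b) tensor" is
  "\<lambda>x y. bas (x, y)" .

text \<open>The map \<open>f \<otimes> g\<close> induced by linear maps \<open>f\<close> and \<open>g\<close>; see \<open>tensor_map_ten\<close> below.\<close>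

definition tensor_map ::
    "('a::ab_group_add \<Rightarrow> 'c::ab_group_add) \<Rightarrow> ('b::ab_group_add \<Rightarrow> 'd::ab_group_add)
      \<Rightarrow> ('a, 'b) tensor \<Rightarrow> ('c, 'd) tensor" where
  "tensor_map f g t = lin (\<lambda>(x, y). ten (f x) (g y)) (rep_tensor t)"

lemma tensor_double: "(t :: ('a::ab_group_add, 'b::ab_group_add) tensor) + t = 0"
  by transfer (simp add: cong_mod_def pm2.span_zero)

lemma ten_add_left: "ten (x + x') y = ten x y + ten x' y"
proof (transfer, unfold cong_mod_def diff_diff_eq[symmetric], rule pm2.span_base)
  fix x x' :: 'a and y :: 'b
  show "bas (x + x', y) - bas (x, y) - bas (x', y) \<in> bilin_rels"
    unfolding bilin_rels_def by blast
qed

lemma ten_add_right: "ten x (y + y') = ten x y + ten x y'"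
proof (transfer, unfold cong_mod_def diff_diff_eq[symmetric], rule pm2.span_base)
  fix x :: 'a and y y' :: 'b
  show "bas (x, y + y') - bas (x, y) - bas (x, y') \<in> bilin_rels"
    unfolding bilin_rels_def by blast
qed

context
  fixes f :: "'a::ab_group_add \<Rightarrow> 'c::ab_group_add" and g :: "'b::ab_group_add \<Rightarrow> 'd::ab_group_add"
  assumes f: "additive f" and g: "additive g"
begin

lemma lin_ten_cong:
  assumes "cong_mod (span2 bilin_rels) u v"
  shows "lin (\<lambda>(x, y). ten (f x) (g y)) u = lin (\<lambda>(x, y). ten (f x) (g y)) v"
proof -
  let ?h = "lin (\<lambda>(x, y). ten (f x) (g y)) :: ('a \<times> 'b \<Rightarrow>\<^sub>0 bit) \<Rightarrow> ('c, 'd) tensor"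
  note h = lin_add[OF tensor_double, of "\<lambda>(x, y). ten (f x) (g y)"]
  have hd: "?h (a - b) = ?h a - ?h b" for a b
    using h[of "a - b" b] by simp
  have "?h (u - v) = 0"
  proof (rule additive_span2_zero[of ?h])
    show "u - v \<in> span2 bilin_rels" using assms by (simp add: cong_mod_def)
    fix z :: "'a \<times> 'b \<Rightarrow>\<^sub>0 bit" assume "z \<in> bilin_rels"
    then show "?h z = 0"
      by (auto simp: bilin_rels_def hd additive.add[OF f] additive.add[OF g]
          ten_add_left ten_add_right)
  qed (rule h)
  then show ?thesis by (simp add: hd)
qed

lemma tensor_map_ten: "tensor_map f g (ten x y) = ten (f x) (g y)"
proof -
  have "cong_mod (span2 bilin_rels) (rep_tensor (ten x y)) (bas (x, y))"
    using Quotient3_rep_abs[OF Quotient3_tensor, of "bas (x, y)"] 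
    by (simp add: ten.abs_eq cong_mod_def pm2.span_zero)
  from lin_ten_cong[OF this] show ?thesis by (simp add: tensor_map_def)
qed

lemma tensor_map_add: "tensor_map f g (t + u) = tensor_map f g t + tensor_map f g u"
proof -
  have "cong_mod (span2 bilin_rels) (rep_tensor (t + u)) (rep_tensor t + rep_tensor u)"
    by (metis Quotient3_abs_rep[OF Quotient3_tensor] tensor.abs_eq_iff plus_tensor.abs_eq)
  from lin_ten_cong[OF this] show ?thesis
    by (simp add: tensor_map_def lin_add[OF tensor_double])
qed

end


section \<open>The Koszul complex\<close>

text \<open>
  The algebra is finite-dimensional in each bidegree \<open>(s, d)\<close>, so the length \<open>s\<close> part of the
  completed tensor product \<open>M \<otimes> K\<close> is the product over \<open>d\<close> of the ordinary tensor products with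
  \<open>kd_part s d\<close>: a family \<open>t\<close> stands for the infinite sum of the \<open>t d\<close>.
\<close>

definition completed_tensor :: "nat \<Rightarrow> (nat \<Rightarrow> ('m::ab_group_add, kd) tensor) set" where
  "completed_tensor s = {t. \<forall>d. t d \<in> span2 {ten x w | x w. w \<in> kd_part s d}}"

definition koszul ::
    "(dl \<Rightarrow> 'm \<Rightarrow> 'm::ab_group_add) \<Rightarrow> nat \<Rightarrow> (nat \<Rightarrow> ('m, kd) tensor) set" where
  "koszul act s = {t. \<forall>d. t d \<in> span2 {ten x w | x w. x \<in> Ann_B act (d + 1) \<and> w \<in> L0 s d}}"

text \<open>The component in index sum \<open>e\<close> of \<open>d(x \<otimes> w) = (\<Sum>r. Q\<^sup>r x \<otimes> Sq\<^sup>r\<^sup>+\<^sup>1 w)\<close>, extended to infinite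
  sums; only \<open>r \<le> e\<close> contributes, since multiplication by \<open>Sq\<^sup>r\<^sup>+\<^sup>1\<close> raises the index sum by \<open>r\<close>.\<close>

definition koszul_d ::
    "(dl \<Rightarrow> 'm \<Rightarrow> 'm::ab_group_add) \<Rightarrow> (nat \<Rightarrow> ('m, kd) tensor) \<Rightarrow> nat \<Rightarrow> ('m, kd) tensor" where
  "koszul_d act t = (\<lambda>e. \<Sum>r\<le>e. tensor_map (act (Q r)) (\<lambda>w. Sq (r + 1) * w) (t (e - r)))"

end

theory Submission
  imports Defs
begin

text \<open>
  Let \<open>K\<close> be the Koszul dual algebra. A homomorphism \<open>f\<close> from \<open>U\<^sup>s\<^sup>+\<^sup>1 F\<^sub>2\<close> to \<open>M\<close> can be restricted
  to the elements \<open>1 | Q\<^sup>i | \<dots> | Q\<^sup>j\<close> all of whose entries are single generators, and the sum of the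
  \<open>f (1 | Q\<^sup>i | \<dots> | Q\<^sup>j) \<otimes> \<beta>\<^sub>i \<dots> \<beta>\<^sub>j\<close> over all words of length \<open>s\<close> is an element of the completed tensor product.
  The relations defining \<open>U\<close> kill the words outside \<open>L(0)\<close> and force the values on words of index sum
  \<open>d\<close> to be annihilated by \<open>B(d+1)\<close>, so this restriction takes values in the Koszul complex. It is a
  chain map: the first face gives the Koszul differential, the last one vanishes because the
  augmentation kills every \<open>Q\<^sup>i\<close>, and the inner faces multiply two neighbouring letters, so that they
  cancel by the identity \<open>\<Sum> Q\<^sup>a Q\<^sup>b \<otimes> \<beta>\<^sub>a \<beta>\<^sub>b = 0\<close> (\<open>canonical_element_zero\<close>). The theorem holds because
  the restriction is surjective (\<open>restrict_surjective\<close>) with acyclic kernel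
  (\<open>restrict_kernel_exact_Suc\<close>); the stability of the Koszul complex under its differential and
  \<open>d\<^sup>2 = 0\<close> are inherited from the resolution along this surjection.

  Both properties rest on bases. The allowable monomials are a basis of the Dyer-Lashof algebra, and
  the words with \<open>i\<^sub>j > 2 i\<^sub>j\<^sub>+\<^sub>1\<close> for all \<open>j\<close>, here called critical, are linearly independent in \<open>K\<close>. Both facts
  are read off from one family of polynomials. Writing \<open>x\<^sup>p y\<^sup>q\<close> for the word \<open>Q\<^sup>p Q\<^sup>q\<close>, the space of
  quadratic relations contains \<open>x\<close> and is stable under multiplication by \<open>x + y\<close> and by \<open>x\<^sup>2 y\<close>; this
  is Pascal's rule for the Adem coefficients (\<open>adem_recursion\<close>). In \<open>s\<close> variables the polynomials
  \<open>e\<^sub>k = \<Sum> x\<^sub>a\<^bsup>2^(k-1)\<^esup> \<dots> x\<^sub>b\<^sup>2 x\<^sub>c\<close>, summed over increasing \<open>k\<close>-tuples \<open>a < \<dots> < b < c\<close>, are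
  polynomials in \<open>x\<^sub>i + x\<^sub>i\<^sub>+\<^sub>1\<close>, \<open>x\<^sub>i\<^sup>2 x\<^sub>i\<^sub>+\<^sub>1\<close> and the other variables, for every \<open>i\<close> at once. Hence their
  products, multiplied by a suitable monomial, are relations in every pair of adjacent variables, and
  their leading monomials are exactly the critical words. As functionals on \<open>K\<close> they separate the
  critical words; in three variables they resolve the overlaps of the rewriting of \<open>Q\<^sup>I\<close> into
  allowable monomials, which gives the basis by the diamond lemma (\<open>normal_form_reduct\<close>).

  The kernel of the restriction is contracted by a matching on the resulting basis of the
  resolution, whose elements are lists of allowable sequences, here called cells. A cell is read from
  the left as long as it consists of single letters forming a critical word; at the first failure it
  is either possible to merge two neighbouring entries into one allowable sequence, or to split the
  first letter off an entry. (Runs of empty sequences, which come from the degeneracies, are matched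
  according to the parity of their length.) Cells without failure are the critical words. The boundary of a
  mergeable cell is the merged cell plus mergeable cells plus cells whose underlying word is smaller
  (\<open>coboundary_upper\<close>), so cochain equations can be solved by recursion along that order.
\<close>

section \<open>Linear algebra over the field with two elements\<close>

text \<open>The default simplification rules rewrite addition and multiplication of bits to bitwise
  operations, after which no rule about rings applies.\<close>

declare add_bit_eq_xor [simp del] mult_bit_eq_and [simp del] bit_not_zero_iff [simp del] bit_not_one_iff [simp del]

abbreviation "coef \<equiv> Poly_Mapping.lookup"
abbreviation "supp \<equiv> Poly_Mapping.keys"
abbreviation "expo \<equiv> Poly_Mapping.single"

lemma scale2_zero [simp]: "scale2 c 0 = 0"
  by (simp add: scale2_def)

lemma scale2_additive:
  assumes "h (0::'a::ab_group_add) = (0::'b::ab_group_add)"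
  shows "h (scale2 c x) = scale2 c (h x)"
  using assms by (simp add: scale2_def)

lemma scale2_scale2: "scale2 a (scale2 b x) = scale2 (a * b) x"
  by (simp add: scale2_def)

lemma scale2_add_right: "scale2 c (x + y) = scale2 c x + scale2 c y"
  by (simp add: scale2_def)

lemma scale2_sum_right: "scale2 c (sum f A) = (\<Sum>x\<in>A. scale2 c (f x))"
  by (simp add: scale2_def)

lemma scale2_add_left:
  assumes "\<And>x::'a::ab_group_add. x + x = 0"
  shows "scale2 (a + b) (x::'a) = scale2 a x + scale2 b x"
  using assms[of x] by (cases a; cases b) (simp_all add: scale2_def)

lemma scale2_sum_left:
  assumes "\<And>x::'a::ab_group_add. x + x = 0"
  shows "scale2 (sum c A) (x::'a) = (\<Sum>i\<in>A. scale2 (c i) x)"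
proof (induction A rule: infinite_finite_induct)
  case (insert i A)
  then have "scale2 (sum c (insert i A)) x = scale2 (c i + sum c A) x" by simp
  also have "\<dots> = scale2 (c i) x + (\<Sum>i\<in>A. scale2 (c i) x)"
    using insert by (simp only: scale2_add_left[OF assms])
  finally show ?case using insert by simp
qed simp_all

lemma additive_zero:
  assumes "\<And>x y. h (x + y) = h x + (h y :: 'b::ab_group_add)"
  shows "h (0::'a::ab_group_add) = 0"
  using assms[of 0 0] by simp

lemma additive_sum:
  assumes "\<And>x y. h (x + y) = h x + (h y :: 'b::ab_group_add)"
  shows "h (sum f A :: 'a::ab_group_add) = (\<Sum>i\<in>A. h (f i))"
  by (induction A rule: infinite_finite_induct) (simp_all add: assms additive_zero[of h, OF assms])

lemma double_minus:
  assumes "\<And>x::'a::ab_group_add. x + x = 0"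
  shows "- x = (x::'a)" "x - y = (x::'a) + y"
proof -
  show *: "- x = x" for x :: 'a using assms[of x] by (simp add: minus_unique)
  show "x - y = x + y" using *[of y] by (metis diff_conv_add_uminus)
qed

lemma double_eqI:
  assumes "\<And>x::'a::ab_group_add. x + x = 0" "x + y = 0"
  shows "x = (y::'a)"
  using assms by (metis add_left_cancel)

lemma span2_induct [consumes 2, case_names zero step]:
  assumes d: "\<And>x::'a::ab_group_add. x + x = 0" and z: "(z::'a) \<in> span2 S"
    and 0: "P 0" and step: "\<And>x y. x \<in> S \<Longrightarrow> P y \<Longrightarrow> P (x + y)"
  shows "P z"
proof -
  interpret v: vector_space "scale2 :: bit \<Rightarrow> 'a \<Rightarrow> 'a" by (rule vector_space_scale2[OF d])
  from z show ?thesis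
  proof (induction rule: v.span_induct_alt)
    case base show ?case by (rule 0)
  next
    case (step c x y)
    then show ?case using assms(4)[of x y] by (cases c) auto
  qed
qed

lemma span2_closed:
  assumes d: "\<And>x::'a::ab_group_add. x + x = 0"
  shows span2_zero: "0 \<in> span2 (S :: 'a set)"
    and span2_base: "x \<in> S \<Longrightarrow> x \<in> span2 S"
    and span2_add: "x \<in> span2 S \<Longrightarrow> y \<in> span2 S \<Longrightarrow> x + y \<in> span2 S"
proof -
  interpret v: vector_space "scale2 :: bit \<Rightarrow> 'a \<Rightarrow> 'a" by (rule vector_space_scale2[OF d])
  show "0 \<in> span2 S" by (rule v.span_zero)
  show "x \<in> S \<Longrightarrow> x \<in> span2 S" by (rule v.span_base)
  show "x \<in> span2 S \<Longrightarrow> y \<in> span2 S \<Longrightarrow> x + y \<in> span2 S" by (rule v.span_add)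
qed

lemma span2_sum:
  assumes d: "\<And>x::'a::ab_group_add. x + x = 0" and "\<And>i. i \<in> A \<Longrightarrow> f i \<in> span2 S"
  shows "sum f A \<in> span2 (S :: 'a set)"
  using assms(2) by (induction A rule: infinite_finite_induct) (simp_all add: span2_zero[OF d] span2_add[OF d])

lemma span2_scale2:
  assumes d: "\<And>x::'a::ab_group_add. x + x = 0" and "x \<in> span2 S"
  shows "scale2 c x \<in> span2 (S :: 'a set)"
  using assms(2) by (simp add: scale2_def span2_zero[OF d])

lemma span2_mono:
  assumes d: "\<And>x::'a::ab_group_add. x + x = 0" and "\<And>x. x \<in> S \<Longrightarrow> x \<in> span2 S'" "z \<in> span2 S"
  shows "z \<in> span2 (S' :: 'a set)"
  using d assms(3) by (induction rule: span2_induct) (auto intro: span2_zero[OF d] span2_add[OF d] assms(2))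

lemma pm2_induct [case_names zero step]:
  fixes z :: "'x \<Rightarrow>\<^sub>0 bit"
  assumes "P 0" "\<And>x y. P y \<Longrightarrow> P (bas x + y)"
  shows "P z"
proof (induction z rule: update_induct)
  case const show ?case by (rule assms(1))
next
  case (update f a b)
  have "Poly_Mapping.update a b f = bas a + f"
    using update by (intro poly_mapping_eqI) (auto simp: lookup_update lookup_add lookup_single in_keys_iff when_def bit_not_zero_iff bit_not_one_iff)
  then show ?case using assms(2)[OF update(3)] by simp
qed

lemma lin_add_fun: "lin (\<lambda>x. f x + g x) z = lin f z + lin g z"
  by (simp add: lin_def sum.distrib)

lemma additive_lin:
  assumes "\<And>x y. h (x + y) = h x + (h y :: 'b::ab_group_add)"
  shows "h (lin f z) = lin (\<lambda>x. h (f x)) (z :: 'x \<Rightarrow>\<^sub>0 bit)"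
  unfolding lin_def by (rule additive_sum[of h, OF assms])

lemma lin_cong: "(\<And>x. x \<in> supp z \<Longrightarrow> f x = g x) \<Longrightarrow> lin f z = lin g z"
  by (simp add: lin_def)

lemma lin_bas_id: "lin bas z = z"
proof (induction z rule: pm2_induct)
  case (step x y)
  then show ?case by (simp add: lin_add)
qed simp

lemma additive_eq_lin:
  assumes "\<And>x y. h (x + y) = h x + (h y :: 'b::ab_group_add)"
  shows "h z = lin (\<lambda>x. h (bas x)) (z :: 'x \<Rightarrow>\<^sub>0 bit)"
  using additive_lin[of h, OF assms, of bas z] by (simp add: lin_bas_id)



section \<open>The Adem coefficients\<close>

text \<open>A two-letter word of index sum \<open>n\<close> is determined by its last letter; \<open>adem n b q\<close> is the
  coefficient of \<open>Q\<^sup>n\<^sup>-\<^sup>q Q\<^sup>q\<close> in the relation for \<open>Q\<^sup>n\<^sup>-\<^sup>b Q\<^sup>b\<close> and, by the symmetry of binomial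
  coefficients, also that of \<open>\<beta>\<^bsub>n-b\<^esub> \<beta>\<^sub>b\<close> in the relation for \<open>\<beta>\<^bsub>n-q\<^esub> \<beta>\<^sub>q\<close>. In the former
  relation \<open>3 * b < n\<close>, in the latter \<open>q \<in> allow_snd n\<close>.\<close>

definition adem :: "nat \<Rightarrow> nat \<Rightarrow> nat \<Rightarrow> bit" where
  "adem n b q = (if n \<le> 2 * q + b then of_nat ((q - b - 1) choose (2 * q + b - n)) else 0)"

text \<open>For a two-letter word of index sum \<open>n\<close> with last letter in \<open>allow_snd n\<close> the monomial
  \<open>Q\<^sup>n\<^sup>-\<^sup>q Q\<^sup>q\<close> is allowable; last letters in \<open>bad_snd n\<close> give the left-hand sides of the relations.\<close>

definition allow_snd :: "nat \<Rightarrow> nat set" where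
  "allow_snd n = {q. q \<le> n \<and> n \<le> 3 * q}"

definition bad_snd :: "nat \<Rightarrow> nat set" where
  "bad_snd n = {b. 3 * b < n}"

lemma finite_allow_snd [simp]: "finite (allow_snd n)"
  by (rule finite_subset[of _ "{..n}"]) (auto simp: allow_snd_def)

lemma finite_bad_snd [simp]: "finite (bad_snd n)"
  by (rule finite_subset[of _ "{..n}"]) (auto simp: bad_snd_def)

lemma atMost_snd: "{..n} = bad_snd n \<union> allow_snd n" "bad_snd n \<inter> allow_snd n = {}"
  by (auto simp: allow_snd_def bad_snd_def)

lemma bad_less_allow: "b \<in> bad_snd n \<Longrightarrow> q \<in> allow_snd n \<Longrightarrow> b < q"
  by (auto simp: allow_snd_def bad_snd_def)

lemma adem_nonzero:
  assumes "adem n b q \<noteq> 0" "b < q"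
  shows "n \<le> 2 * q + b" "2 * b + q < n"
proof -
  show 1: "n \<le> 2 * q + b" using assms(1) by (auto simp: adem_def split: if_splits)
  have "\<not> q - b - 1 < 2 * q + b - n"
  proof
    assume "q - b - 1 < 2 * q + b - n"
    then have "of_nat ((q - b - 1) choose (2 * q + b - n)) = (0::bit)" by (simp only: binomial_eq_0 of_nat_0)
    then show False using assms(1) 1 unfolding adem_def by presburger
  qed
  then show "2 * b + q < n" using assms(2) 1 by linarith
qed

lemma choose_Suc_bit:
  "of_nat (Suc r choose Suc k) = (of_nat (r choose k) + of_nat (r choose Suc k) :: bit)"
  by simp

text \<open>Two applications of Pascal's rule show that the coefficients of total \<open>n + 1\<close> are determined by those
  of total \<open>n\<close> in the way required by multiplication with \<open>x + y\<close> in \<open>relator_shift_sum\<close>. The last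
  summand on the right stands for a word that is not allowable and therefore is not rewritten.\<close>

lemma adem_recursion:
  assumes "b \<in> bad_snd m" "q \<in> allow_snd (Suc m)" "q = Suc q'"
  shows "adem (Suc m) b q + (if Suc b \<in> bad_snd (Suc m) then adem (Suc m) (Suc b) q else 0)
     = adem m b q + (if m \<le> 3 * q' then adem m b q' else of_bool (b = q'))"
proof -
  have bq: "b < q" using assms by (auto simp: bad_snd_def allow_snd_def)
  have *: "3 * b < m" "q \<le> Suc m" "Suc m \<le> 3 * q" using assms by (auto simp: bad_snd_def allow_snd_def)
  show ?thesis
  proof (cases "b = q'")
    case True
    have m: "m = 3 * q' + 1 \<or> m = 3 * q' + 2" using * assms(3) True by linarith
    have n: "Suc b \<notin> bad_snd (Suc m)" using * assms(3) True by (auto simp: bad_snd_def)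
    show ?thesis
      using m
    proof
      assume "m = 3 * q' + 1"
      then show ?thesis using n True assms(3) by (simp add: adem_def)
    next
      assume "m = 3 * q' + 2"
      then show ?thesis using n True assms(3) by (simp add: adem_def)
    qed
  next
    case False
    then obtain r where r: "q' = b + 1 + r" using bq assms(3)
      by (metis add.commute less_Suc_eq less_iff_Suc_add plus_1_eq_Suc add.assoc)
    have q: "q = b + 2 + r" using r assms(3) by simp
    define X where "X = 2 * q + b"
    have 1: "adem (Suc m) b q = (if Suc m \<le> X then of_nat (Suc r choose (X - Suc m)) else 0)"
      by (simp add: adem_def X_def q)
    have 2: "(if Suc b \<in> bad_snd (Suc m) then adem (Suc m) (Suc b) q else 0)
       = (if m \<le> X then of_nat (r choose (X - m)) else 0)"
    proof (cases "Suc b \<in> bad_snd (Suc m)")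
      case True
      then show ?thesis by (auto simp: adem_def X_def q)
    next
      case False
      then have "r < X - m" using * by (auto simp: bad_snd_def X_def q)
      then have "of_nat (r choose (X - m)) = (0::bit)" by (simp only: binomial_eq_0 of_nat_0)
      then show ?thesis using False by presburger
    qed
    have 3: "adem m b q = (if m \<le> X then of_nat (Suc r choose (X - m)) else 0)"
      by (simp add: adem_def X_def q)
    have 4: "(if m \<le> 3 * q' then adem m b q' else of_bool (b = q'))
       = (if m + 2 \<le> X then of_nat (r choose (X - m - 2)) else 0)"
    proof (cases "m \<le> 3 * q'")
      case True
      then show ?thesis by (auto simp: adem_def X_def q r algebra_simps)
    next
      case False
      have "\<not> m + 2 \<le> X" using False by (auto simp: X_def q r)
      then show ?thesis using False \<open>b \<noteq> q'\<close> by simp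
    qed
    consider "X < m" | "X = m" | "X = Suc m" | k where "X = m + 2 + k"
      by (metis add.commute add_2_eq_Suc' less_Suc_eq less_iff_Suc_add linorder_neqE_nat add_Suc_right plus_nat.add_0 Suc_lessI)
    then show ?thesis
      unfolding 1 2 3 4
    proof cases
      case (4 k)
      then have "X - Suc m = Suc k" "X - m = Suc (Suc k)" "X - m - 2 = k" "Suc m \<le> X" "m \<le> X" "m + 2 \<le> X" by auto
      then show "(if Suc m \<le> X then of_nat (Suc r choose (X - Suc m)) else 0) + (if m \<le> X then of_nat (r choose (X - m)) else 0)
        = (if m \<le> X then of_nat (Suc r choose (X - m)) else 0) + (if m + 2 \<le> X then of_nat (r choose (X - m - 2)) else (0::bit))"
        by (simp add: choose_Suc_bit)
    qed simp_all
  qed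
qed

text \<open>\<open>relator \<phi>\<close> says that the function \<open>\<phi>\<close> on two-letter words, regarded as the vector with
  these coordinates, lies in the space of quadratic relations between the \<open>Q\<^sup>i\<close>; equivalently, as a
  functional on two-letter words in the \<open>\<beta>\<^sub>i\<close>, it vanishes on the Koszul dual relations.\<close>

definition relator :: "(nat \<Rightarrow> nat \<Rightarrow> bit) \<Rightarrow> bool" where
  "relator \<phi> \<longleftrightarrow> (\<forall>n. \<forall>q\<in>allow_snd n. \<phi> (n - q) q = (\<Sum>b\<in>bad_snd n. adem n b q * \<phi> (n - b) b))"

lemma relatorD: "relator \<phi> \<Longrightarrow> q \<in> allow_snd n \<Longrightarrow> \<phi> (n - q) q = (\<Sum>b\<in>bad_snd n. adem n b q * \<phi> (n - b) b)"
  by (auto simp: relator_def)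

lemma relator_zero: "relator (\<lambda>p q. 0)"
  by (simp add: relator_def)

lemma relator_add: "relator \<phi> \<Longrightarrow> relator \<psi> \<Longrightarrow> relator (\<lambda>p q. \<phi> p q + \<psi> p q)"
  by (simp add: relator_def algebra_simps sum.distrib)

text \<open>In terms of the generating function \<open>\<Sum> \<phi>(p,q) x\<^sup>p y\<^sup>q\<close>, this is multiplication by \<open>x + y\<close>.\<close>

lemma relator_shift_sum:
  assumes "relator \<phi>"
  shows "relator (\<lambda>p q. (if 0 < p then \<phi> (p - 1) q else 0) + (if 0 < q then \<phi> p (q - 1) else 0))"
    (is "relator ?\<psi>")
  unfolding relator_def
proof (intro allI ballI)
  fix n q assume q: "q \<in> allow_snd n"
  show "?\<psi> (n - q) q = (\<Sum>b\<in>bad_snd n. adem n b q * ?\<psi> (n - b) b)"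
  proof (cases n)
    case 0
    then show ?thesis using q by (auto simp: allow_snd_def bad_snd_def)
  next
    case (Suc m)
    obtain q' where q': "q = Suc q'" using q Suc by (cases q) (auto simp: allow_snd_def)
    let ?F = "\<lambda>b. \<phi> (m - b) b"
    have bsub: "bad_snd m \<subseteq> bad_snd n" by (auto simp: bad_snd_def Suc)
    have z: "adem n b q = 0" if "b \<in> bad_snd n - bad_snd m" for b
    proof (rule ccontr)
      assume "adem n b q \<noteq> 0"
      then show False using adem_nonzero[of n b q] that q bad_less_allow[of b n q] by (auto simp: bad_snd_def Suc)
    qed
    have A: "(\<Sum>b\<in>bad_snd n. adem n b q * (if 0 < n - b then \<phi> (n - b - 1) b else 0)) = (\<Sum>b\<in>bad_snd m. adem n b q * ?F b)"
    proof (rule sum.mono_neutral_cong_right[OF finite_bad_snd bsub])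
      show "\<forall>i\<in>bad_snd n - bad_snd m. adem n i q * (if 0 < n - i then \<phi> (n - i - 1) i else 0) = 0"
        using z by auto
      fix b assume "b \<in> bad_snd m"
      then have "n - b = Suc (m - b)" by (auto simp: Suc bad_snd_def)
      then show "adem n b q * (if 0 < n - b then \<phi> (n - b - 1) b else 0) = adem n b q * ?F b" by simp
    qed
    have B: "(\<Sum>b\<in>bad_snd n. adem n b q * (if 0 < b then \<phi> (n - b) (b - 1) else 0))
        = (\<Sum>b\<in>bad_snd m. (if Suc b \<in> bad_snd n then adem n (Suc b) q else 0) * ?F b)"
    proof -
      have "(\<Sum>b\<in>bad_snd n. adem n b q * (if 0 < b then \<phi> (n - b) (b - 1) else 0))
        = (\<Sum>b\<in>Suc ` {b. Suc b \<in> bad_snd n}. adem n b q * (if 0 < b then \<phi> (n - b) (b - 1) else 0))"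
      proof (rule sum.mono_neutral_right[OF finite_bad_snd])
        show "\<forall>i\<in>bad_snd n - Suc ` {b. Suc b \<in> bad_snd n}. adem n i q * (if 0 < i then \<phi> (n - i) (i - 1) else 0) = 0"
        proof
          fix i assume "i \<in> bad_snd n - Suc ` {b. Suc b \<in> bad_snd n}"
          then show "adem n i q * (if 0 < i then \<phi> (n - i) (i - 1) else 0) = 0" by (cases i) auto
        qed
      qed auto
      also have "\<dots> = (\<Sum>b\<in>{b. Suc b \<in> bad_snd n}. adem n (Suc b) q * ?F b)"
        by (subst sum.reindex) (auto simp: Suc)
      also have "\<dots> = (\<Sum>b\<in>bad_snd m. (if Suc b \<in> bad_snd n then adem n (Suc b) q else 0) * ?F b)"
        by (rule sum.mono_neutral_cong_left) (auto simp: Suc finite_bad_snd[unfolded bad_snd_def] bad_snd_def)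
      finally show ?thesis .
    qed
    have C: "(if 0 < n - q then \<phi> (n - q - 1) q else 0) = (\<Sum>b\<in>bad_snd m. adem m b q * ?F b)"
    proof (cases "q \<le> m")
      case True
      then have "q \<in> allow_snd m" using q Suc by (auto simp: allow_snd_def)
      from relatorD[OF assms this] show ?thesis using True Suc by (simp add: Suc_diff_le)
    next
      case False
      have "adem m b q = 0" if "b \<in> bad_snd m" for b
        using adem_nonzero[of m b q] that False by (auto simp: bad_snd_def)
      then show ?thesis using False Suc by simp
    qed
    have D: "(if 0 < q then \<phi> (n - q) (q - 1) else 0)
        = (\<Sum>b\<in>bad_snd m. (if m \<le> 3 * q' then adem m b q' else of_bool (b = q')) * ?F b)"
    proof (cases "m \<le> 3 * q'")
      case True
      then have "q' \<in> allow_snd m" using q Suc q' by (auto simp: allow_snd_def)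
      from relatorD[OF assms this] show ?thesis using True Suc q' by simp
    next
      case False
      then have "q' \<in> bad_snd m" by (auto simp: bad_snd_def)
      moreover have "of_bool (b = q') * \<phi> (m - b) b = (if b = q' then \<phi> (m - q') q' else 0)" for b
        by simp
      ultimately show ?thesis using False Suc q' by simp
    qed
    have "(\<Sum>b\<in>bad_snd n. adem n b q * ?\<psi> (n - b) b) =
        (\<Sum>b\<in>bad_snd m. (adem n b q + (if Suc b \<in> bad_snd n then adem n (Suc b) q else 0)) * ?F b)"
      by (simp only: distrib_left distrib_right sum.distrib A B)
    also have "\<dots> = (\<Sum>b\<in>bad_snd m. (adem m b q + (if m \<le> 3 * q' then adem m b q' else of_bool (b = q'))) * ?F b)"
      using adem_recursion[of _ m q q'] q q' by (intro sum.cong refl) (simp only: Suc)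
    also have "\<dots> = ?\<psi> (n - q) q"
      by (simp only: distrib_left distrib_right sum.distrib C D)
    finally show ?thesis by simp
  qed
qed

text \<open>Multiplication of the generating function by \<open>x\<^sup>2 y\<close>, which works because
  \<open>adem (n + 3) (b + 1) (q + 1) = adem n b q\<close>.\<close>

lemma relator_shift_double:
  assumes "relator \<phi>"
  shows "relator (\<lambda>p q. if 2 \<le> p \<and> 1 \<le> q then \<phi> (p - 2) (q - 1) else 0)" (is "relator ?\<psi>")
  unfolding relator_def
proof (intro allI ballI)
  fix n q assume q: "q \<in> allow_snd n"
  have 0: "(\<Sum>b\<in>bad_snd n. adem n b q * ?\<psi> (n - b) b) = (\<Sum>b\<in>{b. Suc b \<in> bad_snd n}. adem n (Suc b) q * \<phi> (n - Suc b - 2) b)"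
  proof -
    have "(\<Sum>b\<in>bad_snd n. adem n b q * ?\<psi> (n - b) b) = (\<Sum>b\<in>Suc ` {b. Suc b \<in> bad_snd n}. adem n b q * ?\<psi> (n - b) b)"
    proof (rule sum.mono_neutral_right[OF finite_bad_snd])
      show "\<forall>i\<in>bad_snd n - Suc ` {b. Suc b \<in> bad_snd n}. adem n i q * ?\<psi> (n - i) i = 0"
      proof
        fix i assume "i \<in> bad_snd n - Suc ` {b. Suc b \<in> bad_snd n}"
        then show "adem n i q * ?\<psi> (n - i) i = 0" by (cases i) auto
      qed
    qed auto
    also have "\<dots> = (\<Sum>b\<in>{b. Suc b \<in> bad_snd n}. adem n (Suc b) q * \<phi> (n - Suc b - 2) b)"
      by (subst sum.reindex) (auto simp: bad_snd_def intro!: sum.cong)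
    finally show ?thesis .
  qed
  show "?\<psi> (n - q) q = (\<Sum>b\<in>bad_snd n. adem n b q * ?\<psi> (n - b) b)"
  proof (cases "2 \<le> n - q \<and> 1 \<le> q")
    case True
    then obtain q' where q': "q = Suc q'" by (cases q) auto
    have e: "{b. Suc b \<in> bad_snd n} = bad_snd (n - 3)" by (auto simp: bad_snd_def)
    have "q' \<in> allow_snd (n - 3)" using q True q' by (auto simp: allow_snd_def)
    from relatorD[OF assms this]
    have "?\<psi> (n - q) q = (\<Sum>b\<in>bad_snd (n - 3). adem (n - 3) b q' * \<phi> (n - 3 - b) b)"
      using True q' by (simp add: numeral_eq_Suc)
    also have "\<dots> = (\<Sum>b\<in>bad_snd (n - 3). adem n (Suc b) q * \<phi> (n - Suc b - 2) b)"
    proof (rule sum.cong[OF refl])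
      fix b assume "b \<in> bad_snd (n - 3)"
      then have "(n - 3 \<le> 2 * q' + b) = (n \<le> 2 * q + Suc b)"
        "q' - b - 1 = q - Suc b - 1" "2 * q' + b - (n - 3) = 2 * q + Suc b - n"
        using True q' by (auto simp: bad_snd_def)
      then have "adem (n - 3) b q' = adem n (Suc b) q" by (simp only: adem_def)
      moreover have "n - 3 - b = n - Suc b - 2" by simp
      ultimately show "adem (n - 3) b q' * \<phi> (n - 3 - b) b = adem n (Suc b) q * \<phi> (n - Suc b - 2) b" by simp
    qed
    finally show ?thesis unfolding 0 e .
  next
    case False
    have "adem n (Suc b) q = 0" if "Suc b \<in> bad_snd n" for b
      by (rule ccontr) (use adem_nonzero[of n "Suc b" q] that q False bad_less_allow[of "Suc b" n q] in \<open>auto simp: bad_snd_def\<close>)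
    then show ?thesis using False unfolding 0 by auto
  qed
qed

text \<open>The relations \<open>Q\<^sup>2\<^sup>a\<^sup>+\<^sup>1 Q\<^sup>a = 0\<close>, where all Adem coefficients vanish.\<close>

lemma relator_delta: "relator (\<lambda>p q. of_bool (p = 2 * a + 1 \<and> q = a) * c)"
  unfolding relator_def
proof (intro allI ballI)
  fix n q assume q: "q \<in> allow_snd n"
  have "adem n b q * of_bool (n - b = 2 * a + 1 \<and> b = a) = 0" if "b \<in> bad_snd n" for b
  proof (rule ccontr)
    assume "adem n b q * of_bool (n - b = 2 * a + 1 \<and> b = a) \<noteq> 0"
    then show False using adem_nonzero[of n b q] bad_less_allow[OF that q] by (auto split: if_splits)
  qed
  then show "of_bool (n - q = 2 * a + 1 \<and> q = a) * c
      = (\<Sum>b\<in>bad_snd n. adem n b q * (of_bool (n - b = 2 * a + 1 \<and> b = a) * c))"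
    using q by (subst sum.neutral) (auto simp: allow_snd_def mult.assoc[symmetric])
qed

text \<open>A relator is determined by its values on the words that are not allowable, so its pairing with any
  function \<open>G\<close> on words only involves the combinations of values of \<open>G\<close> given by the relations.\<close>

lemma relator_pairing:
  assumes d: "\<And>x::'a::ab_group_add. x + x = 0"
    and \<kappa>: "\<And>q. q \<in> allow_snd n \<Longrightarrow> \<kappa> q = (\<Sum>b\<in>bad_snd n. adem n b q * \<kappa> b)"
  shows "(\<Sum>q\<le>n. scale2 (\<kappa> q) (G q :: 'a))
    = (\<Sum>b\<in>bad_snd n. scale2 (\<kappa> b) (G b + (\<Sum>q\<in>allow_snd n. scale2 (adem n b q) (G q))))"
proof -
  have "(\<Sum>q\<le>n. scale2 (\<kappa> q) (G q)) = (\<Sum>b\<in>bad_snd n. scale2 (\<kappa> b) (G b)) + (\<Sum>q\<in>allow_snd n. scale2 (\<kappa> q) (G q))"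
    by (simp only: atMost_snd(1) sum.union_disjoint[OF finite_bad_snd finite_allow_snd atMost_snd(2)])
  also have "(\<Sum>q\<in>allow_snd n. scale2 (\<kappa> q) (G q))
      = (\<Sum>q\<in>allow_snd n. \<Sum>b\<in>bad_snd n. scale2 (\<kappa> b) (scale2 (adem n b q) (G q)))"
    by (rule sum.cong[OF refl]) (simp add: \<kappa>[symmetric] scale2_scale2 mult.commute[of "\<kappa> _"] scale2_sum_left[OF d, symmetric])
  also have "\<dots> = (\<Sum>b\<in>bad_snd n. \<Sum>q\<in>allow_snd n. scale2 (\<kappa> b) (scale2 (adem n b q) (G q)))"
    by (rule sum.swap)
  finally show ?thesis by (simp add: scale2_add_right scale2_sum_right sum.distrib)
qed

text \<open>In the sum of the \<open>X\<^sub>q \<otimes> Y\<^sub>q\<close>, rewriting \<open>X\<close> in the terms that are not allowable and \<open>Y\<close> in the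
  allowable ones gives the same double sum twice, because both relations have the same coefficients.\<close>

lemma canonical_element_zero:
  fixes B :: "'a::ab_group_add \<Rightarrow> 'b::ab_group_add \<Rightarrow> 'c::ab_group_add"
  assumes d: "\<And>x::'c. x + x = 0"
    and B1: "\<And>x x' y. B (x + x') y = B x y + B x' y" and B2: "\<And>x y y'. B x (y + y') = B x y + B x y'"
    and X: "\<And>b. b \<in> bad_snd n \<Longrightarrow> X b = (\<Sum>q\<in>allow_snd n. scale2 (adem n b q) (X q))"
    and Y: "\<And>q. q \<in> allow_snd n \<Longrightarrow> Y q = (\<Sum>b\<in>bad_snd n. scale2 (adem n b q) (Y b))"
  shows "(\<Sum>q\<le>n. B (X q) (Y q)) = 0"
proof -
  have z1: "B 0 y = 0" for y by (rule additive_zero) (rule B1)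
  have z2: "B x 0 = 0" for x by (rule additive_zero) (rule B2)
  have s1: "B (scale2 c x) y = scale2 c (B x y)" for c x y by (simp add: scale2_def z1)
  have s2: "B x (scale2 c y) = scale2 c (B x y)" for c x y by (simp add: scale2_def z2)
  have "(\<Sum>b\<in>bad_snd n. B (X b) (Y b)) = (\<Sum>b\<in>bad_snd n. \<Sum>q\<in>allow_snd n. scale2 (adem n b q) (B (X q) (Y b)))"
  proof (rule sum.cong[OF refl])
    fix b assume "b \<in> bad_snd n"
    then have "B (X b) (Y b) = B (\<Sum>q\<in>allow_snd n. scale2 (adem n b q) (X q)) (Y b)" using X by simp
    also have "\<dots> = (\<Sum>q\<in>allow_snd n. B (scale2 (adem n b q) (X q)) (Y b))"
      by (rule additive_sum) (rule B1)
    finally show "B (X b) (Y b) = (\<Sum>q\<in>allow_snd n. scale2 (adem n b q) (B (X q) (Y b)))" by (simp add: s1)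
  qed
  moreover have "(\<Sum>q\<in>allow_snd n. B (X q) (Y q)) = (\<Sum>q\<in>allow_snd n. \<Sum>b\<in>bad_snd n. scale2 (adem n b q) (B (X q) (Y b)))"
  proof (rule sum.cong[OF refl])
    fix q assume "q \<in> allow_snd n"
    then have "B (X q) (Y q) = B (X q) (\<Sum>b\<in>bad_snd n. scale2 (adem n b q) (Y b))" using Y by simp
    also have "\<dots> = (\<Sum>b\<in>bad_snd n. B (X q) (scale2 (adem n b q) (Y b)))"
      by (rule additive_sum) (rule B2)
    finally show "B (X q) (Y q) = (\<Sum>b\<in>bad_snd n. scale2 (adem n b q) (B (X q) (Y b)))" by (simp add: s2)
  qed
  moreover have "(\<Sum>q\<le>n. B (X q) (Y q)) = (\<Sum>b\<in>bad_snd n. B (X b) (Y b)) + (\<Sum>q\<in>allow_snd n. B (X q) (Y q))"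
    by (simp only: atMost_snd(1) sum.union_disjoint[OF finite_bad_snd finite_allow_snd atMost_snd(2)])
  ultimately show ?thesis using sum.swap[of "\<lambda>b q. scale2 (adem n b q) (B (X q) (Y b))" "allow_snd n" "bad_snd n"] d by simp
qed

section \<open>Polynomials that are relators in every pair of adjacent variables\<close>

abbreviation var :: "nat \<Rightarrow> ((nat \<Rightarrow>\<^sub>0 nat) \<Rightarrow>\<^sub>0 bit)" where
  "var k \<equiv> bas (expo k (Suc 0))"

lemma bas_mult: "bas m * bas n = bas (m + n)"
  by (simp add: mult_single)

lemma bas_single_power: "bas (expo k a) ^ n = bas (expo k (n * a :: nat))"
  by (induction n) (simp_all add: bas_mult single_add[symmetric])

lemma lookup_bas_mult:
  fixes m :: "nat \<Rightarrow>\<^sub>0 nat"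
  shows "coef (bas m * P) (m + y) = coef P y"
proof (induction P rule: pm2_induct)
  case (step x P)
  then show ?case by (simp add: distrib_left lookup_add bas_mult lookup_single)
qed simp

lemma lookup_bas_mult_zero:
  fixes m :: "nat \<Rightarrow>\<^sub>0 nat"
  assumes "\<And>y. x \<noteq> m + y"
  shows "coef (bas m * P) x = 0"
proof (induction P rule: pm2_induct)
  case (step y P)
  then show ?case using assms[of y] by (simp add: distrib_left lookup_add bas_mult lookup_single)
qed simp

abbreviation pair_exp :: "(nat \<Rightarrow>\<^sub>0 nat) \<Rightarrow> nat \<Rightarrow> nat \<Rightarrow> nat \<Rightarrow> (nat \<Rightarrow>\<^sub>0 nat)" where
  "pair_exp m k p q \<equiv> m + expo k p + expo (Suc k) q"

text \<open>The exponents of the variables other than \<open>k\<close> and \<open>k + 1\<close> are prescribed by \<open>m\<close>; what is left is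
  a function on two-letter words.\<close>

definition pair_relator :: "nat \<Rightarrow> ((nat \<Rightarrow>\<^sub>0 nat) \<Rightarrow>\<^sub>0 bit) \<Rightarrow> bool" where
  "pair_relator k P \<longleftrightarrow> (\<forall>m. coef m k = 0 \<longrightarrow> coef m (Suc k) = 0 \<longrightarrow>
     relator (\<lambda>p q. coef P (pair_exp m k p q)))"

definition multiplier :: "nat \<Rightarrow> ((nat \<Rightarrow>\<^sub>0 nat) \<Rightarrow>\<^sub>0 bit) \<Rightarrow> bool" where
  "multiplier k g \<longleftrightarrow> (\<forall>P. pair_relator k P \<longrightarrow> pair_relator k (g * P))"

lemma multiplier_zero [simp]: "multiplier k 0"
  by (simp add: multiplier_def pair_relator_def relator_zero)

lemma multiplier_one [simp]: "multiplier k 1"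
  by (simp add: multiplier_def)

lemma multiplier_add: "multiplier k g \<Longrightarrow> multiplier k h \<Longrightarrow> multiplier k (g + h)"
  by (simp add: multiplier_def pair_relator_def distrib_right lookup_add relator_add)

lemma multiplier_mult: "multiplier k g \<Longrightarrow> multiplier k h \<Longrightarrow> multiplier k (g * h)"
  by (simp add: multiplier_def mult.assoc)

lemma multiplier_power: "multiplier k g \<Longrightarrow> multiplier k (g ^ n)"
  by (induction n) (simp_all add: multiplier_mult)

lemma multiplier_var:
  assumes "i \<noteq> k" "i \<noteq> Suc k"
  shows "multiplier k (var i)"
  unfolding multiplier_def pair_relator_def
proof (intro allI impI)
  fix P :: "(nat \<Rightarrow>\<^sub>0 nat) \<Rightarrow>\<^sub>0 bit" and m :: "nat \<Rightarrow>\<^sub>0 nat"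
  assume P: "\<forall>m. coef m k = 0 \<longrightarrow> coef m (Suc k) = 0 \<longrightarrow>
     relator (\<lambda>p q. coef P (pair_exp m k p q))"
    and m: "coef m k = 0" "coef m (Suc k) = 0"
  let ?x = "\<lambda>m p q. pair_exp m k p q"
  show "relator (\<lambda>p q. coef (var i * P) (?x m p q))"
  proof (cases "coef m i")
    case 0
    have "?x m p q \<noteq> expo i (Suc 0) + y" for p q y
    proof
      assume "?x m p q = expo i (Suc 0) + y"
      from arg_cong[OF this, of "\<lambda>z. coef z i"] show False
        using 0 assms by (simp add: lookup_add lookup_single)
    qed
    then show ?thesis by (simp add: lookup_bas_mult_zero relator_zero)
  next
    case (Suc a)
    define m' where "m' = m - expo i (Suc 0)"
    have m': "m = expo i (Suc 0) + m'"
      by (rule poly_mapping_eqI) (auto simp: m'_def lookup_add lookup_minus lookup_single when_def Suc)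
    have "coef (var i * P) (?x m p q) = coef P (?x m' p q)" for p q
      using lookup_bas_mult[of "expo i (Suc 0)" P "?x m' p q"] by (simp add: m' add.assoc)
    moreover have "coef m' k = 0" "coef m' (Suc k) = 0"
      using m by (simp_all add: m'_def lookup_minus)
    ultimately show ?thesis using P by simp
  qed
qed

lemma lookup_pair_mult:
  fixes a b p q :: nat
  assumes "coef m k = 0" "coef m (Suc k) = 0"
  shows "coef (bas (expo k a + expo (Suc k) b) * P)
        (pair_exp m k p q)
     = (if a \<le> p \<and> b \<le> q then coef P (pair_exp m k (p - a) (q - b)) else 0)"
proof (cases "a \<le> p \<and> b \<le> q")
  case True
  have "pair_exp m k p q = expo k a + expo (Suc k) b
      + (pair_exp m k (p - a) (q - b))"
    using True assms by (intro poly_mapping_eqI) (auto simp: lookup_add lookup_single when_def)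
  then show ?thesis using True by (simp only: lookup_bas_mult) simp
next
  case False
  have "pair_exp m k p q \<noteq> expo k a + expo (Suc k) b + y" for y
  proof
    assume *: "pair_exp m k p q = expo k a + expo (Suc k) b + y"
    have "p = a + coef y k" "q = b + coef y (Suc k)"
      using arg_cong[OF *, of "\<lambda>z. coef z k"] arg_cong[OF *, of "\<lambda>z. coef z (Suc k)"] assms
      by (simp_all add: lookup_add lookup_single)
    then show False using False by simp
  qed
  then show ?thesis using False by (auto simp: lookup_bas_mult_zero)
qed

lemma multiplier_sum: "multiplier k (var k + var (Suc k))"
  unfolding multiplier_def pair_relator_def
proof (intro allI impI)
  fix P :: "(nat \<Rightarrow>\<^sub>0 nat) \<Rightarrow>\<^sub>0 bit" and m :: "nat \<Rightarrow>\<^sub>0 nat"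
  assume P: "\<forall>m. coef m k = 0 \<longrightarrow> coef m (Suc k) = 0 \<longrightarrow>
     relator (\<lambda>p q. coef P (pair_exp m k p q))"
    and m: "coef m k = 0" "coef m (Suc k) = 0"
  have 1: "var k = bas (expo k 1 + expo (Suc k) 0)"
    "var (Suc k) = bas (expo k 0 + expo (Suc k) 1)" by simp_all
  from P m have "relator (\<lambda>p q. coef P (pair_exp m k p q))" by blast
  from relator_shift_sum[OF this]
  show "relator (\<lambda>p q. coef ((var k + var (Suc k)) * P) (pair_exp m k p q))"
    unfolding 1 distrib_right lookup_add lookup_pair_mult[OF m] diff_zero by (simp add: Suc_le_eq)
qed

lemma multiplier_double: "multiplier k (var k ^ 2 * var (Suc k))"
  unfolding multiplier_def pair_relator_def
proof (intro allI impI)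
  fix P :: "(nat \<Rightarrow>\<^sub>0 nat) \<Rightarrow>\<^sub>0 bit" and m :: "nat \<Rightarrow>\<^sub>0 nat"
  assume P: "\<forall>m. coef m k = 0 \<longrightarrow> coef m (Suc k) = 0 \<longrightarrow>
     relator (\<lambda>p q. coef P (pair_exp m k p q))"
    and m: "coef m k = 0" "coef m (Suc k) = 0"
  have 1: "var k ^ 2 * var (Suc k) = bas (expo k 2 + expo (Suc k) 1)"
    by (simp add: bas_mult bas_single_power)
  from P m have "relator (\<lambda>p q. coef P (pair_exp m k p q))" by blast
  from relator_shift_double[OF this]
  show "relator (\<lambda>p q. coef ((var k ^ 2 * var (Suc k)) * P) (pair_exp m k p q))"
    unfolding 1 lookup_pair_mult[OF m] .
qed

text \<open>The coefficient of \<open>\<tau>\<^sup>j\<close> in the product of the \<open>1 + x\<^sub>k \<tau>\<close>, taken with the first variable of the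
  list rightmost, in the twisted polynomial ring with \<open>\<tau> x = x\<^sup>2 \<tau>\<close>.\<close>

fun skew_esym :: "nat \<Rightarrow> nat list \<Rightarrow> ((nat \<Rightarrow>\<^sub>0 nat) \<Rightarrow>\<^sub>0 bit)" where
  "skew_esym 0 ks = 1"
| "skew_esym (Suc j) [] = 0"
| "skew_esym (Suc j) (k # ks) = skew_esym (Suc j) ks + var k ^ (2 ^ j) * skew_esym j ks"

lemma frobenius_bit: "(a + b) ^ (2 ^ j) = a ^ (2 ^ j) + (b :: (nat \<Rightarrow>\<^sub>0 nat) \<Rightarrow>\<^sub>0 bit) ^ (2 ^ j)"
proof (induction j)
  case (Suc j)
  have "(x + y) ^ 2 = x ^ 2 + y ^ 2" for x y :: "(nat \<Rightarrow>\<^sub>0 nat) \<Rightarrow>\<^sub>0 bit"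
    unfolding power2_sum by (simp only: mult.assoc mult_2 pm2_double add_0_right mult_zero_left)
  then show ?case using Suc by (simp add: power_mult mult.commute[of 2])
qed simp

lemma multiplier_skew_esym_other:
  "k \<notin> set ks \<Longrightarrow> Suc k \<notin> set ks \<Longrightarrow> multiplier k (skew_esym j ks)"
  by (induction j ks rule: skew_esym.induct)
    (auto intro!: multiplier_add multiplier_mult multiplier_power multiplier_var)

text \<open>The two factors for adjacent variables multiply to
  \<open>1 + (x\<^sub>k + x\<^sub>k\<^sub>+\<^sub>1) \<tau> + x\<^sub>k\<^sup>2 x\<^sub>k\<^sub>+\<^sub>1 \<tau>\<^sup>2\<close>, so these variables enter only through two combinations
  (and Frobenius powers of them) that preserve relators.\<close>

lemma multiplier_skew_esym:
  assumes "k \<notin> set u \<union> set v" "Suc k \<notin> set u \<union> set v"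
  shows "multiplier k (skew_esym j (u @ k # Suc k # v))"
  using assms
proof (induction u arbitrary: j)
  case Nil
  have v: "multiplier k (skew_esym j v)" for j by (rule multiplier_skew_esym_other) (use Nil in auto)
  consider "j = 0" | "j = 1" | i where "j = Suc (Suc i)" by (metis One_nat_def not0_implies_Suc)
  then show ?case
  proof cases
    case 2
    have "skew_esym j ([] @ k # Suc k # v) = skew_esym 1 v + (var k + var (Suc k))"
      using 2 by (simp add: algebra_simps)
    then show ?thesis using v multiplier_sum multiplier_add by metis
  next
    case (3 i)
    have "skew_esym j ([] @ k # Suc k # v) = skew_esym (Suc (Suc i)) v
       + (var k ^ (2 ^ Suc i) + var (Suc k) ^ (2 ^ Suc i)) * skew_esym (Suc i) v
       + (var k ^ (2 ^ Suc i) * var (Suc k) ^ (2 ^ i)) * skew_esym i v"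
      unfolding 3 by (simp only: append_Nil skew_esym.simps algebra_simps)
    also have "\<dots> = skew_esym (Suc (Suc i)) v + (var k + var (Suc k)) ^ (2 ^ Suc i) * skew_esym (Suc i) v
       + (var k ^ 2 * var (Suc k)) ^ (2 ^ i) * skew_esym i v"
      by (simp only: frobenius_bit power_mult_distrib) (simp add: power_mult[symmetric])
    finally show ?thesis
      by (simp only:) (intro multiplier_add multiplier_mult multiplier_power v multiplier_sum multiplier_double)
  qed simp
next
  case (Cons i u)
  then show ?case
    by (cases j) (auto intro!: multiplier_add multiplier_mult multiplier_power multiplier_var)
qed

text \<open>The weight by which leading monomials are compared: moving an exponent to a later variable
  lowers it.\<close>

definition weight :: "nat \<Rightarrow> (nat \<Rightarrow>\<^sub>0 nat) \<Rightarrow> nat" where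
  "weight s m = (\<Sum>k<s. (s - k) * coef m k)"

lemma weight_add: "weight s (m + n) = weight s m + weight s n"
  by (simp add: weight_def lookup_add sum.distrib distrib_left)

lemma weight_single: "k < s \<Longrightarrow> weight s (expo k a) = (s - k) * a"
  by (simp add: weight_def lookup_single when_def if_distrib sum.delta cong: if_cong)

text \<open>The other monomials are smaller in the weight, which is only a partial order; this suffices
  because weights add up in products.\<close>

definition leads :: "nat \<Rightarrow> ((nat \<Rightarrow>\<^sub>0 nat) \<Rightarrow>\<^sub>0 bit) \<Rightarrow> (nat \<Rightarrow>\<^sub>0 nat) \<Rightarrow> bool" where
  "leads s P m \<longleftrightarrow> (\<exists>P0. P = bas m + P0 \<and> (\<forall>m'\<in>supp P0. weight s m' < weight s m))"

lemma leads_bas: "leads s (bas m) m"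
  unfolding leads_def by (rule exI[of _ 0]) simp

lemma leads_add:
  assumes "leads s P m" "\<And>m'. m' \<in> supp R \<Longrightarrow> weight s m' < weight s m"
  shows "leads s (R + P) m"
proof -
  from assms(1) obtain P0 where P: "P = bas m + P0" "\<forall>m'\<in>supp P0. weight s m' < weight s m"
    by (auto simp: leads_def)
  then show ?thesis unfolding leads_def
    using keys_add[of R P0] assms(2) by (intro exI[of _ "R + P0"]) (auto simp: algebra_simps)
qed

lemma leads_keys:
  assumes "leads s P m" "m' \<in> supp P"
  shows "m' = m \<or> weight s m' < weight s m"
proof -
  from assms(1) obtain P0 where P: "P = bas m + P0" "\<forall>m'\<in>supp P0. weight s m' < weight s m"
    by (auto simp: leads_def)
  then show ?thesis using assms(2) keys_add[of "bas m" P0] by (auto split: if_splits)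
qed

lemma leads_lookup:
  assumes "leads s P m"
  shows "coef P m = 1"
proof -
  from assms(1) obtain P0 where P: "P = bas m + P0" "\<forall>m'\<in>supp P0. weight s m' < weight s m"
    by (auto simp: leads_def)
  then have "m \<notin> supp P0" by auto
  then show ?thesis by (simp add: P(1) lookup_add in_keys_iff)
qed

lemma leads_mult:
  assumes "leads s P m" "leads s R n"
  shows "leads s (P * R) (m + n)"
proof -
  from assms obtain P0 R0 where P: "P = bas m + P0" "\<And>m'. m' \<in> supp P0 \<Longrightarrow> weight s m' < weight s m"
    and R: "R = bas n + R0" "\<And>m'. m' \<in> supp R0 \<Longrightarrow> weight s m' < weight s n"
    by (auto simp: leads_def)
  have "P * R = (bas m * R0 + P0 * R) + bas (m + n)"
    by (simp add: P(1) R(1) algebra_simps bas_mult)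
  moreover have "weight s x < weight s (m + n)" if x: "x \<in> supp (bas m * R0 + P0 * R)" for x
  proof -
    from x keys_add[of "bas m * R0" "P0 * R"]
    have "x \<in> supp (bas m * R0) \<or> x \<in> supp (P0 * R)" by blast
    with keys_mult[of "bas m" R0] keys_mult[of P0 R]
    have "x \<in> {a + b |a b. a \<in> {m} \<and> b \<in> supp R0} \<or> x \<in> {a + b |a b. a \<in> supp P0 \<and> b \<in> supp R}"
      by auto
    then consider y where "x = m + y" "y \<in> supp R0"
      | y z where "x = y + z" "y \<in> supp P0" "z \<in> supp R" by blast
    then show ?thesis
    proof cases
      case (1 y)
      then show ?thesis using R(2)[of y] by (simp add: weight_add)
    next
      case (2 y z)
      have "weight s z \<le> weight s n" using leads_keys[OF assms(2) 2(3)] by auto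
      then show ?thesis using P(2)[OF 2(2)] 2 by (simp add: weight_add)
    qed
  qed
  ultimately show ?thesis using leads_add[OF leads_bas] by metis
qed

text \<open>The exponents of the leading monomial of \<open>skew_esym j [a..<s]\<close>, where each factor uses the
  earliest possible variable.\<close>

fun lead_exp :: "nat \<Rightarrow> nat \<Rightarrow> (nat \<Rightarrow>\<^sub>0 nat)" where
  "lead_exp a 0 = 0"
| "lead_exp a (Suc j) = expo a (2 ^ j) + lead_exp (Suc a) j"

lemma lookup_lead_exp:
  "coef (lead_exp a j) i = (if a \<le> i \<and> i < a + j then 2 ^ (a + j - 1 - i) else 0)"
  by (induction a j rule: lead_exp.induct) (auto simp: lookup_add lookup_single when_def)

lemma weight_lead_exp: "a + j < s \<Longrightarrow> weight s (lead_exp (Suc a) j) \<le> weight s (lead_exp a j)"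
proof (induction a j rule: lead_exp.induct)
  case (2 a j)
  then have "weight s (lead_exp (Suc (Suc a)) j) \<le> weight s (lead_exp (Suc a) j)" by simp
  moreover have "(s - Suc a) * 2 ^ j \<le> (s - a) * 2 ^ j" by (intro mult_le_mono1) simp
  moreover have "weight s (lead_exp (Suc a) (Suc j)) = (s - Suc a) * 2 ^ j + weight s (lead_exp (Suc (Suc a)) j)"
    "weight s (lead_exp a (Suc j)) = (s - a) * 2 ^ j + weight s (lead_exp (Suc a) j)"
    using 2(2) by (simp_all add: weight_add weight_single)
  ultimately show ?case by linarith
qed simp

lemma weight_lead_exp_less:
  assumes "a + Suc j < s"
  shows "weight s (lead_exp (Suc a) (Suc j)) < weight s (lead_exp a (Suc j))"
proof -
  have "weight s (lead_exp (Suc (Suc a)) j) \<le> weight s (lead_exp (Suc a) j)"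
    by (rule weight_lead_exp) (use assms in simp)
  moreover have "(s - Suc a) * 2 ^ j < (s - a) * 2 ^ j" using assms by simp
  moreover have "weight s (lead_exp (Suc a) (Suc j)) = (s - Suc a) * 2 ^ j + weight s (lead_exp (Suc (Suc a)) j)"
    "weight s (lead_exp a (Suc j)) = (s - a) * 2 ^ j + weight s (lead_exp (Suc a) j)"
    using assms by (simp_all add: weight_add weight_single)
  ultimately show ?thesis by linarith
qed

lemma skew_esym_zero: "length ks < j \<Longrightarrow> skew_esym j ks = 0"
  by (induction j ks rule: skew_esym.induct) auto

lemma leads_skew_esym: "a + j \<le> s \<Longrightarrow> leads s (skew_esym j [a..<s]) (lead_exp a j)"
proof (induction "s - a" arbitrary: a j)
  case 0
  then show ?case using leads_bas[of s 0] by (cases j) auto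
next
  case (Suc d)
  show ?case
  proof (cases j)
    case 0
    then show ?thesis using leads_bas[of s 0] by simp
  next
    case j: (Suc i)
    have as: "[a..<s] = a # [Suc a..<s]" using Suc by (simp add: upt_conv_Cons)
    have "leads s (var a ^ (2 ^ i) * skew_esym i [Suc a..<s]) (lead_exp a j)"
      using leads_mult[OF leads_bas Suc(1)[of "Suc a" i]] Suc(2,3) j by (simp add: bas_single_power)
    moreover have "weight s m' < weight s (lead_exp a j)" if "m' \<in> supp (skew_esym j [Suc a..<s])" for m'
    proof (cases "a + j < s")
      case True
      then have "leads s (skew_esym j [Suc a..<s]) (lead_exp (Suc a) j)" using Suc(1)[of "Suc a" j] Suc(2) by simp
      from leads_keys[OF this that] show ?thesis using weight_lead_exp_less[of a i s] True j by auto
    next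
      case False
      then have "skew_esym j [Suc a..<s] = 0" by (intro skew_esym_zero) (use Suc in simp)
      then show ?thesis using that by simp
    qed
    ultimately show ?thesis unfolding as j skew_esym.simps by (intro leads_add) (simp_all add: j)
  qed
qed

definition critical_exp :: "nat \<Rightarrow> (nat \<Rightarrow>\<^sub>0 nat) \<Rightarrow> bool" where
  "critical_exp s c \<longleftrightarrow> (\<forall>k\<ge>s. coef c k = 0) \<and>
     (\<forall>k. Suc k < s \<longrightarrow> 2 * coef c (Suc k) < coef c k)"

lemma critical_exp_ge_lead:
  assumes "critical_exp s c" "k < s" "0 < coef c k" "i \<le> k"
  shows "2 ^ (k - i) \<le> coef c i"
  using assms(4)
proof (induction "k - i" arbitrary: i)
  case 0
  then show ?case using assms(3) by simp
next
  case (Suc d)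
  then have "2 ^ (k - Suc i) \<le> coef c (Suc i)" by simp
  moreover have "2 * coef c (Suc i) < coef c i"
    using assms(1,2) Suc by (auto simp: critical_exp_def)
  moreover have "(2::nat) ^ (k - i) = 2 * 2 ^ (k - Suc i)" using Suc by (metis Suc_diff_Suc power_Suc zero_less_Suc zero_less_diff)
  ultimately show ?case by simp
qed

lemma pair_relator_bas:
  assumes "coef c k = 2 * coef c (Suc k) + 1"
  shows "pair_relator k (bas c)"
  unfolding pair_relator_def
proof (intro allI impI)
  fix m :: "nat \<Rightarrow>\<^sub>0 nat"
  assume m: "coef m k = 0" "coef m (Suc k) = 0"
  define a where "a = coef c (Suc k)"
  define e where "e = (of_bool (\<forall>i. i \<noteq> k \<longrightarrow> i \<noteq> Suc k \<longrightarrow> coef m i = coef c i) :: bit)"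
  have "(c = pair_exp m k p q)
     \<longleftrightarrow> (p = 2 * a + 1 \<and> q = a) \<and> (\<forall>i. i \<noteq> k \<longrightarrow> i \<noteq> Suc k \<longrightarrow> coef m i = coef c i)" for p q
    using assms m unfolding poly_mapping_eq_iff fun_eq_iff lookup_add lookup_single a_def
    by (auto simp: when_def)
  then have "(\<lambda>p q. coef (bas c) (pair_exp m k p q))
      = (\<lambda>p q. of_bool (p = 2 * a + 1 \<and> q = a) * e)"
    by (intro ext) (simp add: lookup_single when_def e_def)
  then show "relator (\<lambda>p q. coef (bas c) (pair_exp m k p q))"
    using relator_delta by metis
qed

text \<open>If all the inequalities \<open>2 c\<^sub>k\<^sub>+\<^sub>1 < c\<^sub>k\<close> are as tight as possible, the monomial itself works, being one
  of the relations \<open>Q\<^sup>2\<^sup>a\<^sup>+\<^sup>1 Q\<^sup>a = 0\<close> in every pair. Otherwise there is room at some position \<open>k\<close>, and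
  subtracting the leading exponents of the skew elementary polynomial of degree \<open>k + 1\<close> uses up one
  unit of it without affecting the other inequalities.\<close>

lemma relator_polynomial_exists:
  "critical_exp s c \<Longrightarrow> \<exists>P. leads s P c \<and> (\<forall>k. Suc k < s \<longrightarrow> pair_relator k P)"
proof (induction "\<Sum>k<s. coef c k" arbitrary: c rule: less_induct)
  case (less c)
  note crit = less.prems[unfolded critical_exp_def]
  show ?case
  proof (cases "\<exists>k<s. (if Suc k < s then 2 * coef c (Suc k) + 1 < coef c k else 0 < coef c k)")
    case False
    have "pair_relator k (bas c)" if "Suc k < s" for k
    proof (rule pair_relator_bas)
      have "\<not> 2 * coef c (Suc k) + 1 < coef c k" using False that Suc_lessD[OF that] by presburger
      moreover have "2 * coef c (Suc k) < coef c k" using crit that by auto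
      ultimately show "coef c k = 2 * coef c (Suc k) + 1" by linarith
    qed
    then show ?thesis using leads_bas by blast
  next
    case True
    then obtain k where k: "k < s" "if Suc k < s then 2 * coef c (Suc k) + 1 < coef c k else 0 < coef c k"
      by blast
    have pos: "0 < coef c k" using k by (auto split: if_splits)
    define l where "l = lead_exp 0 (Suc k)"
    have l: "coef l i = (if i \<le> k then 2 ^ (k - i) else 0)" for i
      unfolding l_def lookup_lead_exp by auto
    have le: "coef l i \<le> coef c i" for i
      using critical_exp_ge_lead[OF less.prems k(1) pos] by (auto simp: l)
    define c' where "c' = c - l"
    have c': "c = c' + l" by (rule poly_mapping_eqI) (simp add: c'_def lookup_add lookup_minus le)
    have lc: "coef c i = coef c' i + coef l i" for i
      by (simp add: c' lookup_add)
    have crit': "critical_exp s c'"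
      unfolding critical_exp_def
    proof (intro conjI allI impI)
      fix i assume "s \<le> i"
      then show "coef c' i = 0" using crit lc[of i] by auto
    next
      fix i assume i: "Suc i < s"
      have 1: "2 * coef c (Suc i) < coef c i" using crit i by auto
      consider "i < k" | "i = k" | "k < i" by linarith
      then show "2 * coef c' (Suc i) < coef c' i"
      proof cases
        case 1
        then have "(2::nat) ^ (k - i) = 2 * 2 ^ (k - Suc i)" by (metis Suc_diff_Suc power_Suc)
        then show ?thesis using 1 \<open>2 * coef c (Suc i) < coef c i\<close> lc[of i] lc[of "Suc i"] by (simp add: l)
      next
        case 2
        then show ?thesis using k(2) i lc[of i] lc[of "Suc i"] by (simp add: l)
      next
        case 3
        then show ?thesis using 1 lc[of i] lc[of "Suc i"] by (simp add: l)
      qed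
    qed
    have "(\<Sum>i<s. coef c' i) < (\<Sum>i<s. coef c i)"
    proof (rule sum_strict_mono_ex1)
      show "\<forall>i\<in>{..<s}. coef c' i \<le> coef c i" by (simp add: lc)
      show "\<exists>i\<in>{..<s}. coef c' i < coef c i" using k(1) by (intro bexI[of _ k]) (simp_all add: lc l)
    qed simp
    from less.hyps[OF this crit'] obtain P where P: "leads s P c'" "\<And>k. Suc k < s \<Longrightarrow> pair_relator k P" by blast
    have "leads s (skew_esym (Suc k) [0..<s] * P) c"
      using leads_mult[OF leads_skew_esym[of 0 "Suc k" s] P(1)] k(1) by (simp add: c' l_def add.commute)
    moreover have "pair_relator i (skew_esym (Suc k) [0..<s] * P)" if i: "Suc i < s" for i
    proof -
      have "[0..<s] = [0..<i] @ i # Suc i # [Suc (Suc i)..<s]"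
        using i using upt_add_eq_append[of 0 i "s - i"] by (simp add: upt_conv_Cons)
      then have "multiplier i (skew_esym (Suc k) [0..<s])"
        using multiplier_skew_esym[of i "[0..<i]" "[Suc (Suc i)..<s]"] by simp
      then show ?thesis using P(2)[OF i] by (simp add: multiplier_def)
    qed
    ultimately show ?thesis by blast
  qed
qed


section \<open>Critical words and the functionals dual to them\<close>

fun critical :: "nat list \<Rightarrow> bool" where
  "critical (i # j # I) \<longleftrightarrow> 2 * j < i \<and> critical (j # I)"
| "critical _ \<longleftrightarrow> True"

text \<open>The weight of a word. It drops when index sum is moved to a later letter, and, since each letter is
  counted with one added, also when the first letter is removed.\<close>

fun wl :: "nat list \<Rightarrow> nat" where
  "wl [] = 0"
| "wl (i # I) = Suc (length I) * Suc i + wl I"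

lemma critical_nth: "critical I \<Longrightarrow> Suc k < length I \<Longrightarrow> 2 * I ! Suc k < I ! k"
proof (induction I arbitrary: k rule: critical.induct)
  case (1 i j I)
  then show ?case by (cases k) auto
qed auto

lemma wl_eq_sum: "wl I = (\<Sum>k<length I. (length I - k) * Suc (I ! k))"
proof (induction I)
  case (Cons i I)
  show ?case by (simp add: Cons sum.lessThan_Suc_shift del: sum.lessThan_Suc mult_Suc_right)
qed simp

lemma wl_eq_weight: "wl I = weight (length I) (Poly_Mapping.nth I) + (\<Sum>k<length I. length I - k)"
  unfolding wl_eq_sum weight_def sum.distrib[symmetric]
  by (rule sum.cong) (simp_all add: nth_default_def)

lemma nth_pair:
  fixes u v :: "nat list"
  shows "Poly_Mapping.nth (u @ p # q # v) = Poly_Mapping.nth (u @ 0 # 0 # v) + expo (length u) p + expo (Suc (length u)) q"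
proof (rule poly_mapping_eqI)
      fix i
        consider "i < length u" | "i = length u" | "i = Suc (length u)" | j where "i = length u + Suc (Suc j)"
          by (metis less_iff_Suc_add add_Suc_right add.right_neutral linorder_neqE_nat not0_implies_Suc)
        then show "coef (Poly_Mapping.nth (u @ p # q # v)) i
         = coef (Poly_Mapping.nth (u @ 0 # 0 # v) + expo (length u) p + expo (Suc (length u)) q) i"
          unfolding lookup_add lookup_single lookup_nth nth_default_append
          by cases simp_all
qed
text \<open>The functional is the coefficient function of the polynomial found above.\<close>

theorem dual_functional_exists:
  assumes "critical c"
  obtains \<kappa> :: "nat list \<Rightarrow> bit" where "\<kappa> c = 1"
    "\<And>I. length I = length c \<Longrightarrow> \<kappa> I \<noteq> 0 \<Longrightarrow> I = c \<or> wl I < wl c"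
    "\<And>u v. length u + length v + 2 = length c \<Longrightarrow> relator (\<lambda>p q. \<kappa> (u @ p # q # v))"
proof -
  have "critical_exp (length c) (Poly_Mapping.nth c)"
    using critical_nth[OF assms] by (auto simp: critical_exp_def nth_default_def)
  from relator_polynomial_exists[OF this] obtain P where P: "leads (length c) P (Poly_Mapping.nth c)"
    "\<And>k. Suc k < length c \<Longrightarrow> pair_relator k P" by blast
  define \<kappa> where "\<kappa> I = coef P (Poly_Mapping.nth I)" for I
  show thesis
  proof (rule that[of \<kappa>])
    show "\<kappa> c = 1" unfolding \<kappa>_def by (rule leads_lookup[OF P(1)])
  next
    fix I assume I: "length I = length c" "\<kappa> I \<noteq> 0"
    then have "Poly_Mapping.nth I \<in> supp P" by (simp add: \<kappa>_def in_keys_iff)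
    from leads_keys[OF P(1) this] show "I = c \<or> wl I < wl c"
    proof
      assume "Poly_Mapping.nth I = Poly_Mapping.nth c"
      then have "nth_default 0 I = nth_default 0 c" by (metis lookup_nth)
      then have "I ! i = c ! i" if "i < length c" for i
        using that I(1) by (metis nth_default_nth)
      then have "I = c" using I(1) by (simp add: nth_equalityI)
      then show ?thesis ..
    qed (use I(1) in \<open>simp add: wl_eq_weight\<close>)
  next
    fix u v :: "nat list" assume l: "length u + length v + 2 = length c"
    let ?m = "Poly_Mapping.nth (u @ 0 # 0 # v) :: nat \<Rightarrow>\<^sub>0 nat"
    have "(\<lambda>p q. \<kappa> (u @ p # q # v)) = (\<lambda>p q. coef P (pair_exp ?m (length u) p q))"
      unfolding \<kappa>_def by (intro ext, subst nth_pair) (rule refl)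
    moreover have "coef ?m (length u) = 0" "coef ?m (Suc (length u)) = 0"
      by (simp_all add: nth_default_def nth_append)
    moreover have "pair_relator (length u) P" by (rule P(2)) (use l in simp)
    ultimately show "relator (\<lambda>p q. \<kappa> (u @ p # q # v))"
      unfolding pair_relator_def by simp
  qed
qed

section \<open>A basis of the Dyer-Lashof algebra\<close>

lemma wl_append_less: "length w = length w' \<Longrightarrow> wl w < wl w' \<Longrightarrow> wl (u @ w) < wl (u @ w')"
  by (induction u) auto

lemma wl_append: "wl (w @ v) = wl w + length v * (sum_list w + length w) + wl v"
  by (induction w) (auto simp: algebra_simps)

lemma wl_append_right_less:
  "length w = length w' \<Longrightarrow> sum_list w = sum_list w' \<Longrightarrow> wl w < wl w' \<Longrightarrow> wl (w @ v) < wl (w' @ v)"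
  by (simp add: wl_append)

lemma wl_rewrite:
  assumes "b \<in> bad_snd n" "q \<in> allow_snd n"
  shows "wl (u @ (n - q) # q # v) < wl (u @ (n - b) # b # v)"
proof (rule wl_append_less)
  define x where "x = n - q"
  define y where "y = q - b"
  have "n - q = x" "q = b + y" "n - b = x + y" "0 < y"
    using assms bad_less_allow[OF assms] by (auto simp: x_def y_def allow_snd_def)
  then show "wl ((n - q) # q # v) < wl ((n - b) # b # v)" by (simp add: algebra_simps)
qed simp

lemma allowable_simps [simp]:
  "allowable []" "allowable [i]" "allowable (i # j # I) \<longleftrightarrow> i \<le> 2 * j \<and> allowable (j # I)"
proof -
  show "allowable (i # j # I) \<longleftrightarrow> i \<le> 2 * j \<and> allowable (j # I)"
    unfolding allowable_def
    by (auto simp: nth_Cons split: nat.splits)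
qed (simp_all add: allowable_def)

lemma not_allowable_obtain:
  assumes "\<not> allowable I"
  obtains u n b v where "I = u @ (n - b) # b # v" "b \<in> bad_snd n"
  using assms
proof (induction I arbitrary: thesis rule: critical.induct)
  case (1 i j I)
  show ?case
  proof (cases "i \<le> 2 * j")
    case True
    then have "\<not> allowable (j # I)" using 1 by simp
    then obtain u n b v where "j # I = u @ (n - b) # b # v" "b \<in> bad_snd n" using 1(1) by blast
    then show ?thesis using 1(2)[of "i # u"] by simp
  next
    case False
    then show ?thesis using 1(2)[of "[]" "i + j" j I] by (simp add: bad_snd_def)
  qed
qed simp_all

lemma not_allowable_bad: "b \<in> bad_snd n \<Longrightarrow> \<not> allowable (u @ (n - b) # b # v)"
  by (induction u rule: critical.induct) (auto simp: bad_snd_def)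

text \<open>Rewriting requires a choice of position; by \<open>normal_form_reduct\<close> the result does not depend on it.\<close>

definition bad_position :: "nat list \<Rightarrow> nat list \<times> nat \<times> nat \<times> nat list" where
  "bad_position w = (SOME (u, n, b, v). w = u @ (n - b) # b # v \<and> b \<in> bad_snd n)"

lemma bad_position:
  assumes "\<not> allowable w" "bad_position w = (u, n, b, v)"
  shows "w = u @ (n - b) # b # v" "b \<in> bad_snd n"
proof -
  obtain u' n' b' v' where "w = u' @ (n' - b') # b' # v'" "b' \<in> bad_snd n'" by (rule not_allowable_obtain[OF assms(1)])
  then have "\<exists>x. case x of (u, n, b, v) \<Rightarrow> w = u @ (n - b) # b # v \<and> b \<in> bad_snd n"
    by (intro exI[of _ "(u', n', b', v')"]) simp
  from someI_ex[OF this] show "w = u @ (n - b) # b # v" "b \<in> bad_snd n"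
    using assms(2) unfolding bad_position_def by auto
qed

lemma bad_position_rewrite:
  assumes "\<not> allowable w" "(u, n, b, v) = bad_position w" "q \<in> allow_snd n"
  shows "wl (u @ (n - q) # q # v) < wl w"
proof -
  note w = bad_position[OF assms(1) assms(2)[symmetric]]
  show ?thesis unfolding w(1) by (rule wl_rewrite[OF w(2) assms(3)])
qed

function normal_form :: "nat list \<Rightarrow> (nat list \<Rightarrow>\<^sub>0 bit)" where
  "normal_form w = (if allowable w then bas w else
     (case bad_position w of (u, n, b, v) \<Rightarrow>
       \<Sum>q\<in>allow_snd n. scale2 (adem n b q) (normal_form (u @ (n - q) # q # v))))"
  by pat_completeness auto
termination by (relation "measure wl") (auto intro!: bad_position_rewrite)

declare normal_form.simps [simp del]

definition reduct :: "nat list \<Rightarrow> nat \<Rightarrow> nat \<Rightarrow> nat list \<Rightarrow> (nat list \<Rightarrow>\<^sub>0 bit)" where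
  "reduct u n b v = (\<Sum>q\<in>allow_snd n. scale2 (adem n b q) (normal_form (u @ (n - q) # q # v)))"

lemma normal_form_allowable: "allowable w \<Longrightarrow> normal_form w = bas w"
  by (subst normal_form.simps) simp

lemma normal_form_reduct_some:
  assumes "\<not> allowable w"
  obtains u n b v where "w = u @ (n - b) # b # v" "b \<in> bad_snd n" "normal_form w = reduct u n b v"
proof -
  obtain u n b v where x: "bad_position w = (u, n, b, v)" by (metis prod_cases4)
  moreover have "normal_form w = reduct u n b v"
    using assms by (subst normal_form.simps) (simp add: x reduct_def)
  ultimately show thesis using bad_position[OF assms x] that by blast
qed

definition words :: "nat \<Rightarrow> nat \<Rightarrow> nat list set" where
  "words s d = {I. length I = s \<and> sum_list I = d}"

definition frames :: "nat \<Rightarrow> nat \<Rightarrow> nat \<Rightarrow> (nat list \<times> nat list) set" where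
  "frames s d k = {(x, y). length x = k \<and> k + 2 + length y = s \<and> sum_list x + sum_list y \<le> d}"

lemma finite_words [simp]: "finite (words s d)"
proof (rule finite_subset)
  show "words s d \<subseteq> {I. set I \<subseteq> {..d} \<and> length I = s}"
    by (auto simp: words_def member_le_sum_list)
qed (simp add: finite_lists_length_eq)

lemma finite_frames [simp]: "finite (frames s d k)"
proof (rule finite_subset)
  show "frames s d k \<subseteq> {x. set x \<subseteq> {..d} \<and> length x = k} \<times> {y. set y \<subseteq> {..d} \<and> length y = s - k - 2}"
    using member_le_sum_list by (fastforce simp: frames_def)
qed (simp add: finite_lists_length_eq)

text \<open>A relation affects two adjacent letters and keeps their sum, so sums over words are grouped by the
  other letters.\<close>

lemma sum_words_frames:
  assumes "k + 2 \<le> s"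
  shows "(\<Sum>I\<in>words s d. H I) = (\<Sum>(x, y)\<in>frames s d k. \<Sum>q\<le>d - sum_list x - sum_list y.
     H (x @ (d - sum_list x - sum_list y - q) # q # y))"
proof -
  have "(\<Sum>(x, y)\<in>frames s d k. \<Sum>q\<le>d - sum_list x - sum_list y. H (x @ (d - sum_list x - sum_list y - q) # q # y))
     = (\<Sum>(xy, q)\<in>Sigma (frames s d k) (\<lambda>(x, y). {..d - sum_list x - sum_list y}).
         (case xy of (x, y) \<Rightarrow> H (x @ (d - sum_list x - sum_list y - q) # q # y)))"
    by (subst sum.Sigma[symmetric]) (auto intro!: sum.cong)
  also have "\<dots> = (\<Sum>I\<in>words s d. H I)"
  proof -
    define j where "j = (\<lambda>((x, y), q). x @ (d - sum_list x - sum_list y - q) # q # y)"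
    define i where "i = (\<lambda>I. ((take k I, drop (k + 2) I), I ! Suc k) :: (nat list \<times> nat list) \<times> nat)"
    let ?S = "Sigma (frames s d k) (\<lambda>(x, y). {..d - sum_list x - sum_list y})"
    have 1: "i I \<in> ?S \<and> j (i I) = I" if I: "I \<in> words s d" for I
    proof -
      from I have l: "length I = s" "sum_list I = d" by (auto simp: words_def)
      have split: "I = take k I @ I ! k # I ! Suc k # drop (k + 2) I"
        using l assms by (simp add: Cons_nth_drop_Suc id_take_nth_drop[symmetric])
      have s: "sum_list (take k I) + (I ! k + (I ! Suc k + sum_list (drop (k + 2) I))) = d"
        using arg_cong[OF split, of sum_list] l by simp
      have "d - sum_list (take k I) - sum_list (drop (k + 2) I) - I ! Suc k = I ! k" using s by simp
      moreover have "k + 2 + length (drop (k + 2) I) = s" "I ! Suc k \<le> d - sum_list (take k I) - sum_list (drop (k + 2) I)"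
        using s l assms by auto
      ultimately show ?thesis using split l s assms by (simp add: i_def j_def frames_def)
    qed
    have 2: "j p \<in> words s d \<and> i (j p) = p" if "p \<in> ?S" for p
    proof -
      from that obtain x y q where p: "p = ((x, y), q)" "length x = k" "k + 2 + length y = s" "sum_list x + sum_list y \<le> d" "q \<le> d - sum_list x - sum_list y"
        by (auto simp: frames_def)
      then show ?thesis by (auto simp: words_def i_def j_def nth_append)
    qed
    show ?thesis
      by (rule sum.reindex_bij_witness[where i = i and j = j]) (use 1 2 in \<open>auto simp: j_def\<close>)
  qed
  finally show ?thesis by simp
qed

text \<open>Pairing a functional dual to the critical word \<open>c\<close> with the normal forms shows that all ways
  of rewriting \<open>c\<close> agree, once this is known for smaller words.\<close>

lemma overlap_reduct:
  assumes \<kappa>: "\<kappa> c = 1" "\<And>I. length I = length c \<Longrightarrow> \<kappa> I \<noteq> 0 \<Longrightarrow> I = c \<or> wl I < wl c"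
      "\<And>u v. length u + length v + 2 = length c \<Longrightarrow> relator (\<lambda>p q. \<kappa> (u @ p # q # v))"
    and c: "c = x0 @ (n0 - b0) # b0 # y0" "b0 \<in> bad_snd n0"
    and IH: "\<And>x n b y. b \<in> bad_snd n \<Longrightarrow> wl (x @ (n - b) # b # y) < wl (u @ c @ v) \<Longrightarrow> normal_form (x @ (n - b) # b # y) = reduct x n b y"
  shows "(\<Sum>I\<in>words (length c) (sum_list c). scale2 (\<kappa> I) (normal_form (u @ I @ v)))
    = normal_form (u @ c @ v) + reduct (u @ x0) n0 b0 (y0 @ v)"
proof -
  let ?d = "sum_list c" and ?k = "length x0" and ?s = "length c"
  let ?n = "\<lambda>x y. ?d - sum_list x - sum_list y"
  let ?V = "normal_form (u @ c @ v) + reduct (u @ x0) n0 b0 (y0 @ v)"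
  have b0: "b0 \<le> n0" using c(2) by (auto simp: bad_snd_def)
  have n0: "?n x0 y0 = n0" using b0 by (simp add: c(1))
  have "(\<Sum>I\<in>words ?s ?d. scale2 (\<kappa> I) (normal_form (u @ I @ v)))
     = (\<Sum>(x, y)\<in>frames ?s ?d ?k. \<Sum>q\<le>?n x y. scale2 (\<kappa> (x @ (?n x y - q) # q # y)) (normal_form (u @ (x @ (?n x y - q) # q # y) @ v)))"
    by (rule sum_words_frames) (simp add: c)
  also have "\<dots> = (\<Sum>p\<in>frames ?s ?d ?k. if p = (x0, y0) then ?V else 0)"
  proof (rule sum.cong[OF refl], clarify)
    fix x y assume "(x, y) \<in> frames ?s ?d ?k"
    then have xy: "length x = ?k" "?k + 2 + length y = ?s" "sum_list x + sum_list y \<le> ?d" by (auto simp: frames_def)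
    let ?m = "?n x y"
    have rel: "relator (\<lambda>p q. \<kappa> (x @ p # q # y))" by (rule \<kappa>(3)) (use xy in simp)
    have relD: "\<kappa> (x @ (m - q) # q # y) = (\<Sum>b\<in>bad_snd m. adem m b q * \<kappa> (x @ (m - b) # b # y))" if "q \<in> allow_snd m" for q m
      by (rule relatorD[OF rel that])
    have "(\<Sum>q\<le>?m. scale2 (\<kappa> (x @ (?m - q) # q # y)) (normal_form (u @ (x @ (?m - q) # q # y) @ v)))
       = (\<Sum>b\<in>bad_snd ?m. scale2 (\<kappa> (x @ (?m - b) # b # y)) (normal_form (u @ (x @ (?m - b) # b # y) @ v)
           + (\<Sum>q\<in>allow_snd ?m. scale2 (adem ?m b q) (normal_form (u @ (x @ (?m - q) # q # y) @ v)))))"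
      by (rule relator_pairing, rule pm2_double, rule relD)
    also have "\<dots> = (\<Sum>b\<in>bad_snd ?m. if b = b0 then (if (x, y) = (x0, y0) then ?V else 0) else 0)"
    proof (rule sum.cong[OF refl])
      fix b assume b: "b \<in> bad_snd ?m"
      let ?I = "x @ (?m - b) # b # y"
      have red: "(\<Sum>q\<in>allow_snd ?m. scale2 (adem ?m b q) (normal_form (u @ (x @ (?m - q) # q # y) @ v))) = reduct (u @ x) ?m b (y @ v)"
        by (simp add: reduct_def)
      have eq: "?I = c \<longleftrightarrow> b = b0 \<and> (x, y) = (x0, y0)"
        using xy n0 unfolding c(1) by auto
      show "scale2 (\<kappa> ?I) (normal_form (u @ ?I @ v) + (\<Sum>q\<in>allow_snd ?m. scale2 (adem ?m b q) (normal_form (u @ (x @ (?m - q) # q # y) @ v))))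
         = (if b = b0 then (if (x, y) = (x0, y0) then ?V else 0) else 0)"
      proof (cases "?I = c")
        case True
        then have "x = x0" "y = y0" "b = b0" using eq by auto
        then have "reduct (u @ x) ?m b (y @ v) = reduct (u @ x0) n0 b0 (y0 @ v)" using n0 by simp
        then show ?thesis unfolding red True using \<open>x = x0\<close> \<open>y = y0\<close> \<open>b = b0\<close> \<kappa>(1) by simp
      next
        case False
        have z: "(if b = b0 then (if (x, y) = (x0, y0) then ?V else 0) else 0) = 0" using eq False by auto
        show ?thesis
        proof (cases "\<kappa> ?I = 0")
          case False
          have "wl ?I < wl c" using \<kappa>(2)[OF _ False] \<open>?I \<noteq> c\<close> xy by simp
          then have "wl (u @ ?I @ v) < wl (u @ c @ v)"
            by (intro wl_append_less wl_append_right_less) (use xy b in \<open>simp_all add: bad_snd_def\<close>)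
          then have nf: "normal_form (u @ ?I @ v) = reduct (u @ x) ?m b (y @ v)" using IH[of b ?m "u @ x" "y @ v"] b by simp
          show ?thesis unfolding red nf z by (simp only: pm2_double scale2_zero)
        qed (simp add: z del: prod.inject)
      qed
    qed
    also have "\<dots> = (if (x, y) = (x0, y0) then ?V else 0)"
      using c(2) n0 by (auto simp: sum.delta)
    finally show "(\<Sum>q\<le>?m. scale2 (\<kappa> (x @ (?m - q) # q # y)) (normal_form (u @ (x @ (?m - q) # q # y) @ v)))
       = (if (x, y) = (x0, y0) then ?V else 0)" .
  qed
  also have "\<dots> = ?V"
  proof -
    have "(x0, y0) \<in> frames ?s ?d ?k" by (simp add: frames_def c)
    then show ?thesis by (simp add: sum.delta)
  qed
  finally show ?thesis .
qed

text \<open>The diamond lemma. Two positions in a word that can be rewritten coincide, are disjoint, or overlap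
  in one letter. In the last case the three letters form a critical word, and the functional dual to
  it expresses one and the same sum through either rewriting.\<close>

lemma reduct_unique:
  assumes IH: "\<And>x n b y. b \<in> bad_snd n \<Longrightarrow> wl (x @ (n - b) # b # y) < wl w \<Longrightarrow> normal_form (x @ (n - b) # b # y) = reduct x n b y"
    and w: "w = u @ (n - b) # b # v" "b \<in> bad_snd n" and w': "w = u' @ (n' - b') # b' # v'" "b' \<in> bad_snd n'"
    and le: "length u \<le> length u'"
  shows "reduct u n b v = reduct u' n' b' v'"
proof -
  have bn: "b \<le> n" "b' \<le> n'" using w(2) w'(2) by (auto simp: bad_snd_def)
  define t where "t = drop (length u) u'"
  have "u = take (length u) u'" using w(1) w'(1) le by (metis append_eq_append_conv_if)
  then have u': "u' = u @ t" by (metis append_take_drop_id t_def)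
  then have e: "(n - b) # b # v = t @ (n' - b') # b' # v'" using w(1) w'(1) by simp
  consider "t = []" | i where "t = [i]" | i j t' where "t = i # j # t'" by (metis list.exhaust)
  then show ?thesis
  proof cases
    case 1
    then have "n - b = n' - b'" "b = b'" "v = v'" "u = u'" using e u' by auto
    then show ?thesis using bn by (metis le_add_diff_inverse)
  next
    case (2 i)
    then have i: "i = n - b" "b = n' - b'" "v = b' # v'" using e by auto
    let ?c = "[n - b, b, b']"
    have "critical ?c" using w(2) w'(2) i by (auto simp: bad_snd_def)
    from dual_functional_exists[OF this] obtain \<kappa> where \<kappa>: "\<kappa> ?c = (1::bit)"
      "\<And>I. length I = length ?c \<Longrightarrow> \<kappa> I \<noteq> 0 \<Longrightarrow> I = ?c \<or> wl I < wl ?c"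
      "\<And>u v. length u + length v + 2 = length ?c \<Longrightarrow> relator (\<lambda>p q. \<kappa> (u @ p # q # v))" by blast
    have wc: "w = u @ ?c @ v'" using w(1) i by simp
    have "(\<Sum>I\<in>words (length ?c) (sum_list ?c). scale2 (\<kappa> I) (normal_form (u @ I @ v')))
        = normal_form (u @ ?c @ v') + reduct (u @ []) n b ([b'] @ v')"
      by (rule overlap_reduct[OF \<kappa>]) (use w(2) IH wc in simp_all)
    moreover have "(\<Sum>I\<in>words (length ?c) (sum_list ?c). scale2 (\<kappa> I) (normal_form (u @ I @ v')))
        = normal_form (u @ ?c @ v') + reduct (u @ [n - b]) n' b' ([] @ v')"
      by (rule overlap_reduct[OF \<kappa>]) (use w'(2) IH wc i in simp_all)
    ultimately show ?thesis using 2 i u' by simp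
  next
    case (3 i j t')
    then have i: "i = n - b" "j = b" "v = t' @ (n' - b') # b' # v'" using e by auto
    have 1: "normal_form (u @ (n - q) # q # v) = reduct (u @ (n - q) # q # t') n' b' v'" if "q \<in> allow_snd n" for q
    proof -
      have "wl (u @ (n - q) # q # v) < wl w" unfolding w(1) by (rule wl_rewrite[OF w(2) that])
      then show ?thesis using IH[OF w'(2), of "u @ (n - q) # q # t'" v'] i(3) by simp
    qed
    have 2: "normal_form (u' @ (n' - q) # q # v') = reduct u n b (t' @ (n' - q) # q # v')" if "q \<in> allow_snd n'" for q
    proof -
      have "wl (u' @ (n' - q) # q # v') < wl w" unfolding w'(1) by (rule wl_rewrite[OF w'(2) that])
      then show ?thesis using IH[OF w(2), of u "t' @ (n' - q) # q # v'"] i 3 u' by simp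
    qed
    have "reduct u n b v = (\<Sum>q\<in>allow_snd n. \<Sum>q'\<in>allow_snd n'. scale2 (adem n b q * adem n' b' q')
        (normal_form (u @ (n - q) # q # t' @ (n' - q') # q' # v')))"
      unfolding reduct_def[of u n b v]
      by (rule sum.cong[OF refl]) (simp add: 1 reduct_def scale2_sum_right scale2_scale2)
    moreover have "reduct u' n' b' v' = (\<Sum>q'\<in>allow_snd n'. \<Sum>q\<in>allow_snd n. scale2 (adem n b q * adem n' b' q')
        (normal_form (u @ (n - q) # q # t' @ (n' - q') # q' # v')))"
      unfolding reduct_def[of u' n' b' v']
      by (rule sum.cong[OF refl]) (simp add: 2 reduct_def scale2_sum_right scale2_scale2 mult.commute)
    ultimately show ?thesis by (simp only: sum.swap[of _ "allow_snd n" "allow_snd n'"])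
  qed
qed

theorem normal_form_reduct:
  "b \<in> bad_snd n \<Longrightarrow> normal_form (u @ (n - b) # b # v) = reduct u n b v"
proof (induction "wl (u @ (n - b) # b # v)" arbitrary: u n b v rule: less_induct)
  case less
  let ?w = "u @ (n - b) # b # v"
  obtain u' n' b' v' where w': "?w = u' @ (n' - b') # b' # v'" "b' \<in> bad_snd n'" "normal_form ?w = reduct u' n' b' v'"
    using normal_form_reduct_some[OF not_allowable_bad[OF less.prems]] by blast
  show ?case
  proof (cases "length u \<le> length u'")
    case True
    have "reduct u n b v = reduct u' n' b' v'"
      by (rule reduct_unique[where w = ?w, OF less.hyps refl less.prems w'(1,2) True])
    then show ?thesis using w'(3) by simp
  next
    case False
    then have "length u' \<le> length u" by simp
    have "reduct u' n' b' v' = reduct u n b v"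
      by (rule reduct_unique[where w = ?w, OF less.hyps w'(1,2) refl less.prems \<open>length u' \<le> length u\<close>])
    then show ?thesis using w'(3) by simp
  qed
qed

lemma keys_sum_obtain:
  assumes "J \<in> supp (sum f A)"
  obtains a where "a \<in> A" "J \<in> supp (f a)"
proof -
  have "(\<Sum>a\<in>A. coef (f a) J) \<noteq> 0" using assms by (simp add: in_keys_iff lookup_sum)
  then obtain a where "a \<in> A" "coef (f a) J \<noteq> 0" by (meson sum.not_neutral_contains_not_neutral)
  then show thesis using that by (simp add: in_keys_iff)
qed

text \<open>Properties of words that survive a single rewriting step hold for all monomials in the normal form.\<close>

lemma normal_form_invariant:
  assumes "P w"
    and step: "\<And>u n b v q. b \<in> bad_snd n \<Longrightarrow> q \<in> allow_snd n \<Longrightarrow> adem n b q \<noteq> 0 \<Longrightarrow>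
      P (u @ (n - b) # b # v) \<Longrightarrow> P (u @ (n - q) # q # v)"
    and "J \<in> supp (normal_form w)"
  shows "P J \<and> allowable J"
  using assms(1,3)
proof (induction "wl w" arbitrary: w rule: less_induct)
  case less
  show ?case
  proof (cases "allowable w")
    case True
    then show ?thesis using less by (simp add: normal_form_allowable)
  next
    case False
    then obtain u n b v where w: "w = u @ (n - b) # b # v" "b \<in> bad_snd n" by (rule not_allowable_obtain)
    from less.prems(2) have "J \<in> supp (reduct u n b v)" by (simp add: w normal_form_reduct)
    then obtain q where q: "q \<in> allow_snd n" "J \<in> supp (scale2 (adem n b q) (normal_form (u @ (n - q) # q # v)))"
      unfolding reduct_def by (rule keys_sum_obtain)
    then have q': "adem n b q \<noteq> 0" "J \<in> supp (normal_form (u @ (n - q) # q # v))"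
      by (auto simp: scale2_def split: if_splits)
    have "wl (u @ (n - q) # q # v) < wl w" unfolding w(1) by (rule wl_rewrite[OF w(2) q(1)])
    then show ?thesis by (rule less.hyps[OF _ _ q'(2)]) (use step[OF w(2) q(1) q'(1)] less.prems(1) w(1) in simp)
  qed
qed

lemma normal_form_keys:
  assumes "J \<in> supp (normal_form w)"
  shows "allowable J" "length J = length w" "sum_list J = sum_list w" "\<not> allowable w \<Longrightarrow> wl J < wl w"
proof -
  let ?P = "\<lambda>J. length J = length w \<and> sum_list J = sum_list w \<and> (J = w \<or> wl J < wl w)"
  have "?P J \<and> allowable J"
  proof (rule normal_form_invariant[where P = ?P, OF _ _ assms])
    fix u n b v q assume a: "b \<in> bad_snd n" "q \<in> allow_snd n" "?P (u @ (n - b) # b # v)"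
    have "wl (u @ (n - q) # q # v) < wl (u @ (n - b) # b # v)" by (rule wl_rewrite[OF a(1,2)])
    then show "?P (u @ (n - q) # q # v)" using a by (auto simp: allow_snd_def bad_snd_def)
  qed simp
  then show "allowable J" "length J = length w" "sum_list J = sum_list w" "\<not> allowable w \<Longrightarrow> wl J < wl w" by auto
qed

lemma dl_double [simp]: "(x::dl) + x = 0"
  by transfer (simp add: cong_mod_def two_sided_ideal_def pm2.span_zero)

lemma of_nat_mult_scale2: "of_nat c * (z :: free_alg) = scale2 (of_nat c) z"
proof (induction c)
  case (Suc c)
  have "of_nat (Suc c) * z = z + of_nat c * z" by (simp add: algebra_simps)
  also have "\<dots> = scale2 (1 + of_nat c) z" by (simp only: Suc scale2_add_left[OF pm2_double] scale2_simps)
  finally show ?case by simp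
qed simp

lemma scale2_mult_left: "scale2 c x * y = scale2 c (x * (y :: 'a::ring))"
  by (simp add: scale2_def)

lemma scale2_mult_right: "x * scale2 c y = scale2 c (x * (y :: 'a::ring))"
  by (simp add: scale2_def)

lemma gen_mult: "gen i * gen j = bas (Word [i, j])"
  by (simp add: gen_def mult_single plus_word_def)

text \<open>The defining relations in terms of the Adem coefficients.\<close>

definition dl_relation :: "nat \<Rightarrow> nat \<Rightarrow> free_alg" where
  "dl_relation n b = bas (Word [n - b, b]) + (\<Sum>q\<in>allow_snd n. scale2 (adem n b q) (bas (Word [n - q, q])))"

lemma dl_rels_eq: "dl_rels = {dl_relation n b | n b. b \<in> bad_snd n}"
proof -
  have *: "gen i * gen j - (\<Sum>k\<in>{k. i \<le> 2 * k \<and> k \<le> i + j}.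
           of_nat ((k - j - 1) choose (2 * k - i)) * gen (i + j - k) * gen k) = dl_relation (i + j) j"
    if "i > 2 * j" for i j
  proof -
    have "(\<Sum>k\<in>{k. i \<le> 2 * k \<and> k \<le> i + j}. of_nat ((k - j - 1) choose (2 * k - i)) * gen (i + j - k) * gen k)
      = (\<Sum>q\<in>allow_snd (i + j). scale2 (adem (i + j) j q) (bas (Word [i + j - q, q])))"
      by (rule sum.mono_neutral_cong_left)
        (use that in \<open>auto simp: allow_snd_def adem_def mult.assoc gen_mult of_nat_mult_scale2 scale2_mult_left\<close>)
    then show ?thesis by (simp add: dl_relation_def gen_mult double_minus(2)[OF pm2_double])
  qed
  show ?thesis
  proof
    show "dl_rels \<subseteq> {dl_relation n b | n b. b \<in> bad_snd n}"
      unfolding dl_rels_def using * by (force simp: bad_snd_def)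
    show "{dl_relation n b | n b. b \<in> bad_snd n} \<subseteq> dl_rels"
    proof clarify
      fix n b assume "b \<in> bad_snd n"
      then have "n - b > 2 * b" "n - b + b = n" by (auto simp: bad_snd_def)
      then show "dl_relation n b \<in> dl_rels" using *[of b "n - b"] unfolding dl_rels_def by force
    qed
  qed
qed

lemma Qs_append: "Qs (I @ J) = Qs I * Qs J"
  by (simp add: Qs_def)

lemma Qs_simps [simp]: "Qs [] = 1" "Qs (i # I) = Q i * Qs I"
  by (simp_all add: Qs_def)

lemma Qs_eq_abs: "Qs I = abs_dl (bas (Word I))"
proof (induction I)
  case Nil
  then show ?case by (simp add: one_dl_def zero_word_def[symmetric])
next
  case (Cons i I)
  have "bas (Word (i # I)) = gen i * bas (Word I)" by (simp add: gen_def mult_single plus_word_def)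
  then show ?case by (simp add: Cons Q.abs_eq times_dl.abs_eq)
qed

lemma abs_dl_zero_iff: "abs_dl z = 0 \<longleftrightarrow> z \<in> two_sided_ideal dl_rels"
  by (simp add: zero_dl_def dl.abs_eq_iff cong_mod_def)

lemma abs_dl_add: "abs_dl (x + y) = abs_dl x + abs_dl y"
  by (simp add: plus_dl.abs_eq)

lemma two_sided_ideal_base: "r \<in> S \<Longrightarrow> r \<in> two_sided_ideal S"
  unfolding two_sided_ideal_def by (rule pm2.span_base) (simp, metis mult_1_left mult_1_right)

lemma additive_ideal_zero:
  assumes add: "\<And>x y. \<phi> (x + y) = \<phi> x + (\<phi> y :: 'b::ab_group_add)"
    and S: "\<And>u r v. r \<in> S \<Longrightarrow> \<phi> (bas u * r * bas v) = 0" and "z \<in> two_sided_ideal S"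
  shows "\<phi> z = 0"
proof (rule additive_span2_zero[of \<phi>])
  show "z \<in> span2 {u * r * v | u r v. r \<in> S}" using assms(3) by (simp add: two_sided_ideal_def)
  have 0: "\<phi> 0 = 0" by (rule additive_zero) (rule add)
  fix x assume "x \<in> {u * r * v | u r v. r \<in> S}"
  then obtain U r V where x: "x = U * r * V" "r \<in> S" by blast
  have "\<phi> (U * r * bas v) = 0" for v
    by (induction U rule: pm2_induct) (simp_all add: 0 S[OF x(2)] add distrib_right)
  then show "\<phi> x = 0" unfolding x(1)
    by (induction V rule: pm2_induct) (simp_all add: 0 add distrib_left)
qed (rule add)

lemma bas_mult_pair: "bas u * bas (Word [i, j]) * bas v = bas (Word (letters u @ i # j # letters v))"
  by (simp add: mult_single plus_word_def)

lemma Q_adem: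
  assumes "b \<in> bad_snd n"
  shows "Q (n - b) * Q b = (\<Sum>q\<in>allow_snd n. scale2 (adem n b q) (Q (n - q) * Q q))"
proof -
  have "abs_dl (dl_relation n b) = 0"
    unfolding abs_dl_zero_iff by (rule two_sided_ideal_base) (use assms in \<open>auto simp: dl_rels_eq\<close>)
  moreover have "abs_dl (dl_relation n b) = Qs [n - b, b] + (\<Sum>q\<in>allow_snd n. scale2 (adem n b q) (Qs [n - q, q]))"
    unfolding dl_relation_def abs_dl_add additive_sum[of abs_dl, OF abs_dl_add] Qs_eq_abs
    by (simp add: scale2_additive[of abs_dl, OF additive_zero[of abs_dl, OF abs_dl_add]])
  ultimately show ?thesis using double_eqI[OF dl_double] by simp
qed

lemma dl_induct [case_names zero step]:
  assumes "P 0" "\<And>I y. P y \<Longrightarrow> P (Qs I + y)"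
  shows "P a"
proof -
  have "P (abs_dl z)" for z
  proof (induction z rule: pm2_induct)
    case zero then show ?case using assms(1) by (simp add: zero_dl_def)
  next
    case (step x y)
    then show ?case using assms(2)[of "abs_dl y" "letters x"] by (simp add: abs_dl_add Qs_eq_abs)
  qed
  then show ?thesis by (metis Quotient3_abs_rep[OF Quotient3_dl])
qed

definition free_nf :: "free_alg \<Rightarrow> (nat list \<Rightarrow>\<^sub>0 bit)" where
  "free_nf = lin (\<lambda>w. normal_form (letters w))"

lemma free_nf_add: "free_nf (x + y) = free_nf x + free_nf y"
  unfolding free_nf_def by (rule lin_add) (rule pm2_double)

lemma free_nf_bas: "free_nf (bas w) = normal_form (letters w)"
  by (simp add: free_nf_def)

lemma free_nf_ideal:
  assumes "z \<in> two_sided_ideal dl_rels"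
  shows "free_nf z = 0"
proof (rule additive_ideal_zero[OF free_nf_add _ assms])
  fix u r v assume "r \<in> dl_rels"
  then obtain n b where r: "r = dl_relation n b" "b \<in> bad_snd n" by (auto simp: dl_rels_eq)
  have "bas u * r * bas v = bas (Word (letters u @ (n - b) # b # letters v))
     + (\<Sum>q\<in>allow_snd n. scale2 (adem n b q) (bas (Word (letters u @ (n - q) # q # letters v))))"
    unfolding r(1) dl_relation_def distrib_left distrib_right sum_distrib_left sum_distrib_right
    by (simp only: scale2_mult_left scale2_mult_right bas_mult_pair)
  then have "free_nf (bas u * r * bas v) = normal_form (letters u @ (n - b) # b # letters v) + reduct (letters u) n b (letters v)"
    by (simp add: free_nf_add additive_sum[of free_nf, OF free_nf_add] free_nf_bas reduct_def
      scale2_additive[of free_nf, OF additive_zero[of free_nf, OF free_nf_add]])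
  then show "free_nf (bas u * r * bas v) = 0" by (simp add: normal_form_reduct[OF r(2)])
qed

lift_definition nf :: "dl \<Rightarrow> (nat list \<Rightarrow>\<^sub>0 bit)" is free_nf
proof -
  fix x y assume "cong_mod (two_sided_ideal dl_rels) x y"
  then have "free_nf (x - y) = 0" by (simp add: cong_mod_def free_nf_ideal)
  then show "free_nf x = free_nf y" using free_nf_add[of "x - y" y] by simp
qed

lemma nf_add: "nf (a + b) = nf a + nf b"
  by transfer (rule free_nf_add)

lemma nf_zero [simp]: "nf 0 = 0"
  by (rule additive_zero) (rule nf_add)

lemma nf_Qs: "nf (Qs I) = normal_form I"
  by (simp add: Qs_eq_abs nf.abs_eq free_nf_bas)

text \<open>Together with \<open>nf_Qs\<close> this identifies the Dyer-Lashof algebra with the space spanned by the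
  allowable sequences.\<close>

lemma lin_Qs_normal_form: "lin Qs (normal_form w) = Qs w"
proof (induction "wl w" arbitrary: w rule: less_induct)
  case less
  show ?case
  proof (cases "allowable w")
    case True
    then show ?thesis by (simp add: normal_form_allowable)
  next
    case False
    then obtain u n b v where w: "w = u @ (n - b) # b # v" "b \<in> bad_snd n" by (rule not_allowable_obtain)
    have 1: "lin Qs (normal_form (u @ (n - q) # q # v)) = Qs u * (Q (n - q) * Q q) * Qs v" if "q \<in> allow_snd n" for q
    proof -
      have "wl (u @ (n - q) # q # v) < wl w" unfolding w(1) by (rule wl_rewrite[OF w(2) that])
      from less[OF this] show ?thesis by (simp add: Qs_append mult.assoc)
    qed
    note la = lin_add[OF dl_double, of Qs]
    have "lin Qs (normal_form w) = (\<Sum>q\<in>allow_snd n. scale2 (adem n b q) (lin Qs (normal_form (u @ (n - q) # q # v))))"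
      unfolding w(1) normal_form_reduct[OF w(2)] reduct_def
      by (simp add: additive_sum[of "lin Qs", OF la] scale2_additive[of "lin Qs"])
    also have "\<dots> = Qs u * (\<Sum>q\<in>allow_snd n. scale2 (adem n b q) (Q (n - q) * Q q)) * Qs v"
      unfolding sum_distrib_left sum_distrib_right by (rule sum.cong) (auto simp: 1 scale2_def)
    also have "\<dots> = Qs w" by (simp add: Q_adem[OF w(2), symmetric] w(1) Qs_append mult.assoc)
    finally show ?thesis .
  qed
qed

lemma lin_Qs_nf: "lin Qs (nf a) = a"
proof (induction a rule: dl_induct)
  case (step I y)
  then show ?case by (simp add: nf_add lin_add[OF dl_double] nf_Qs lin_Qs_normal_form)
qed simp

lemma nf_keys_allowable: "J \<in> supp (nf a) \<Longrightarrow> allowable J"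
proof (induction a rule: dl_induct)
  case (step I y)
  then show ?case using keys_add[of "nf (Qs I)" "nf y"] normal_form_keys(1)[of J I]
    by (auto simp: nf_add nf_Qs)
qed simp

lemma dl_deg_induct [consumes 1, case_names zero step]:
  assumes "a \<in> dl_deg q" "P 0" "\<And>I y. sum_list I = q \<Longrightarrow> P y \<Longrightarrow> P (Qs I + y)"
  shows "P a"
  using dl_double assms(1)[unfolded dl_deg_def] by (induction rule: span2_induct) (use assms(2,3) in auto)

lemma dl_deg_zero: "0 \<in> dl_deg q"
  unfolding dl_deg_def by (rule span2_zero[OF dl_double])

lemma dl_deg_Qs: "Qs I \<in> dl_deg (sum_list I)"
  unfolding dl_deg_def by (rule span2_base[OF dl_double]) auto

lemma dl_deg_add: "a \<in> dl_deg q \<Longrightarrow> b \<in> dl_deg q \<Longrightarrow> a + b \<in> dl_deg q"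
  unfolding dl_deg_def by (rule span2_add[OF dl_double])

lemma dl_deg_mult: "a \<in> dl_deg q \<Longrightarrow> b \<in> dl_deg p \<Longrightarrow> a * b \<in> dl_deg (q + p)"
proof (induction rule: dl_deg_induct)
  case zero then show ?case by (simp add: dl_deg_zero)
next
  case (step I y)
  have "Qs I * b \<in> dl_deg (q + p)" using step(3)
  proof (induction rule: dl_deg_induct)
    case zero then show ?case by (simp add: dl_deg_zero)
  next
    case (step J y')
    then show ?case using dl_deg_Qs[of "I @ J"] \<open>sum_list I = q\<close> by (simp add: distrib_left dl_deg_add Qs_append)
  qed
  then show ?case using step by (simp add: distrib_right dl_deg_add)
qed

lemma dl_deg_keys: "a \<in> dl_deg q \<Longrightarrow> J \<in> supp (nf a) \<Longrightarrow> sum_list J = q"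
proof (induction rule: dl_deg_induct)
  case (step I y)
  then show ?case using keys_add[of "nf (Qs I)" "nf y"] normal_form_keys(3)[of J I]
    by (auto simp: nf_add nf_Qs)
qed simp


section \<open>Excess\<close>

text \<open>Some non-empty suffix has excess at most \<open>d\<close>. Unlike the excess of the whole sequence, this is
  stable under rewriting and under multiplication from the left, and for allowable sequences it
  amounts to the excess of the whole sequence.\<close>

fun low_excess :: "nat \<Rightarrow> nat list \<Rightarrow> bool" where
  "low_excess d [] \<longleftrightarrow> False"
| "low_excess d (i # I) \<longleftrightarrow> i \<le> d + sum_list I \<or> low_excess d I"

lemma low_excess_append: "low_excess d J \<Longrightarrow> low_excess d (I @ J)"
  by (induction I) auto

text \<open>A suffix that starts with the second letter of the rewritten pair may lose its low excess, but then
  the suffix starting one letter earlier has taken it over.\<close>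

lemma low_excess_rewrite:
  assumes "b \<in> bad_snd n" "q \<in> allow_snd n" "adem n b q \<noteq> 0" "low_excess d (u @ (n - b) # b # v)"
  shows "low_excess d (u @ (n - q) # q # v)"
proof -
  have bq: "b < q" "q \<le> n" "n \<le> 2 * q + b" "b \<le> n"
    using bad_less_allow[OF assms(1,2)] adem_nonzero[OF assms(3)] assms(2) by (auto simp: allow_snd_def)
  from assms(4) show ?thesis by (induction u) (use bq in auto)
qed

lemma allowable_low_excess: "allowable J \<Longrightarrow> low_excess d J \<Longrightarrow> J \<noteq> [] \<and> hd J \<le> d + sum_list (tl J)"
  by (induction J rule: critical.induct) auto

lemma normal_form_low_excess:
  assumes "low_excess d w" "J \<in> supp (normal_form w)"
  shows "J \<noteq> [] \<and> hd J \<le> d + sum_list (tl J)"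
proof -
  have "low_excess d J \<and> allowable J"
    by (rule normal_form_invariant[where P = "low_excess d", OF assms(1) _ assms(2)]) (rule low_excess_rewrite)
  then show ?thesis using allowable_low_excess by blast
qed

text \<open>Every monomial that kills classes of degree \<open>d\<close> for reasons of excess lies in \<open>B(d+1)\<close>, allowable or not;
  in particular \<open>B(d+1)\<close> is an ideal.\<close>

lemma Qs_low_excess:
  assumes "low_excess d w"
  shows "Qs w \<in> ideal_B (d + 1)"
proof -
  have "lin Qs (normal_form w) \<in> ideal_B (d + 1)"
    unfolding lin_def ideal_B_def
  proof (rule span2_sum[OF dl_double], rule span2_base[OF dl_double])
    fix J assume J: "J \<in> supp (normal_form w)"
    from normal_form_low_excess[OF assms J] normal_form_keys(1)[OF J]
    show "Qs J \<in> {Qs I |I. I \<noteq> [] \<and> allowable I \<and> excess I < int (d + 1)}"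
      by (auto simp: excess_def intro!: exI[of _ J])
  qed
  then show ?thesis by (simp add: lin_Qs_normal_form)
qed

lemma ideal_B_zero: "0 \<in> ideal_B n"
  unfolding ideal_B_def by (rule span2_zero[OF dl_double])

lemma ideal_B_add: "a \<in> ideal_B n \<Longrightarrow> b \<in> ideal_B n \<Longrightarrow> a + b \<in> ideal_B n"
  unfolding ideal_B_def by (rule span2_add[OF dl_double])

lemma Q_mult_ideal_B:
  assumes "b \<in> dl_deg q" "i \<le> d + q"
  shows "Q i * b \<in> ideal_B (d + 1)"
  using assms(1)
proof (induction rule: dl_deg_induct)
  case zero then show ?case by (simp add: ideal_B_zero)
next
  case (step I y)
  then show ?case using Qs_low_excess[of d "i # I"] assms(2) by (simp add: distrib_left ideal_B_add)
qed

lemma nf_low_excess: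
  assumes "b \<in> dl_deg q" "i \<le> d + q" "J \<in> supp (nf (a * (Q i * b)))"
  shows "J \<noteq> [] \<and> hd J \<le> d + sum_list (tl J)"
  using assms(3)
proof (induction a rule: dl_induct)
  case (step A y)
  have "J \<noteq> [] \<and> hd J \<le> d + sum_list (tl J)" if "J \<in> supp (nf (Qs A * (Q i * b)))"
    using assms(1) that
  proof (induction rule: dl_deg_induct)
    case (step I z)
    have "low_excess d (A @ i # I)" using step(1) assms(2) by (intro low_excess_append) simp
    then show ?case using step keys_add[of "nf (Qs (A @ i # I))" "nf (Qs A * (Q i * z))"] normal_form_low_excess[of d "A @ i # I" J]
      by (auto simp: distrib_left nf_add nf_Qs[symmetric] Qs_append)
  qed simp
  then show ?case using step keys_add[of "nf (Qs A * (Q i * b))" "nf (y * (Q i * b))"]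
    by (auto simp: distrib_right nf_add)
qed simp

section \<open>The Koszul dual algebra\<close>

lemma kd_double [simp]: "(x::kd) + x = 0"
  by transfer (simp add: cong_mod_def two_sided_ideal_def pm2.span_zero)

definition kd_relation :: "nat \<Rightarrow> nat \<Rightarrow> free_alg" where
  "kd_relation n q = bas (Word [n - q, q]) + (\<Sum>b\<in>bad_snd n. scale2 (adem n b q) (bas (Word [n - b, b])))"

lemma sq_gen_simps: "sq_gen 0 = 0" "sq_gen (Suc i) = gen i"
  by (simp_all add: sq_gen_def)

text \<open>Both ways of writing a relation agree by the symmetry of binomial coefficients, with the index
  \<open>k\<close> of \<open>Sq\<^sup>k\<close> shifted by one; the term with \<open>k = 0\<close> vanishes because \<open>Sq\<^sup>0 = 0\<close>.\<close>

lemma kd_relator_eq: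
  assumes "p \<le> 2 * q"
  shows "sq_gen (Suc p) * sq_gen (Suc q)
      - (\<Sum>k\<in>{k. 2 * k \<le> Suc p}.
           of_nat ((Suc q - k - 1) choose (Suc p - 2 * k)) * sq_gen (Suc p + Suc q - k) * sq_gen k)
    = kd_relation (p + q) q"
proof -
  let ?n = "p + q"
  let ?f = "\<lambda>k. of_nat ((Suc q - k - 1) choose (Suc p - 2 * k)) * sq_gen (Suc p + Suc q - k) * sq_gen k"
  have fin: "finite {k. 2 * k \<le> Suc p}" by (rule finite_subset[of _ "{..Suc p}"]) auto
  have "(\<Sum>k\<in>{k. 2 * k \<le> Suc p}. ?f k) = (\<Sum>k\<in>Suc ` {j. 2 * j < p}. ?f k)"
  proof (rule sum.mono_neutral_right[OF fin])
    show "\<forall>k\<in>{k. 2 * k \<le> Suc p} - Suc ` {j. 2 * j < p}. ?f k = 0"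
    proof
      fix k assume "k \<in> {k. 2 * k \<le> Suc p} - Suc ` {j. 2 * j < p}"
      then show "?f k = 0" by (cases k) (auto simp: sq_gen_simps)
    qed
  qed auto
  also have "\<dots> = (\<Sum>j\<in>{j. 2 * j < p}. scale2 (of_nat ((q - j - 1) choose (p - 2 * j - 1))) (bas (Word [?n - j, j])))"
  proof (subst sum.reindex, simp, rule sum.cong[OF refl])
    fix j assume j: "j \<in> {j. 2 * j < p}"
    then have *: "Suc p + Suc q - Suc j = Suc (?n - j)" "Suc q - Suc j - 1 = q - j - 1" "Suc p - 2 * Suc j = p - 2 * j - 1"
      by auto
    show "(?f \<circ> Suc) j = scale2 (of_nat ((q - j - 1) choose (p - 2 * j - 1))) (bas (Word [?n - j, j]))"
      unfolding o_def * sq_gen_simps mult.assoc gen_mult by (rule of_nat_mult_scale2)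
  qed
  also have "\<dots> = (\<Sum>b\<in>bad_snd ?n. scale2 (adem ?n b q) (bas (Word [?n - b, b])))"
  proof (rule sum.mono_neutral_cong_left)
    show "{j. 2 * j < p} \<subseteq> bad_snd ?n" using assms by (auto simp: bad_snd_def)
    show "\<forall>b\<in>bad_snd ?n - {j. 2 * j < p}. scale2 (adem ?n b q) (bas (Word [?n - b, b])) = 0"
    proof
      fix b assume b: "b \<in> bad_snd ?n - {j. 2 * j < p}"
      have "adem ?n b q = 0"
        by (rule ccontr) (use adem_nonzero[of ?n b q] b assms in \<open>auto simp: bad_snd_def\<close>)
      then show "scale2 (adem ?n b q) (bas (Word [?n - b, b])) = 0" by simp
    qed
    fix j assume j: "j \<in> {j. 2 * j < p}"
    have "adem ?n j q = of_nat ((q - j - 1) choose (p - 2 * j - 1))"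
    proof (cases "p \<le> q + j")
      case True
      then have "p - 2 * j - 1 \<le> q - j - 1" "q - j - 1 - (p - 2 * j - 1) = 2 * q + j - ?n" using j by auto
      then show ?thesis using True binomial_symmetric[of "p - 2 * j - 1" "q - j - 1"] by (simp add: adem_def)
    next
      case False
      then have "q - j - 1 < p - 2 * j - 1" using j assms by auto
      then have "of_nat ((q - j - 1) choose (p - 2 * j - 1)) = (0::bit)" by (simp only: binomial_eq_0 of_nat_0)
      then show ?thesis using False by (simp add: adem_def)
    qed
    then show "scale2 (of_nat ((q - j - 1) choose (p - 2 * j - 1))) (bas (Word [?n - j, j])) = scale2 (adem ?n j q) (bas (Word [?n - j, j]))"
      by simp
  qed simp
  finally show ?thesis
    by (simp add: kd_relation_def sq_gen_simps gen_mult double_minus(2)[OF pm2_double])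
qed

lemma kd_rels_cases:
  assumes "r \<in> kd_rels"
  obtains "r = 0" | n q where "r = kd_relation n q" "q \<in> allow_snd n"
proof -
  from assms obtain a b where ab: "a < 2 * b" and r: "r = sq_gen a * sq_gen b
      - (\<Sum>k\<in>{k. 2 * k \<le> a}. of_nat ((b - k - 1) choose (a - 2 * k)) * sq_gen (a + b - k) * sq_gen k)"
    by (auto simp: kd_rels_def)
  obtain q where q: "b = Suc q" using ab by (cases b) auto
  show thesis
  proof (cases a)
    case 0
    then show thesis using r that(1) by (simp add: sq_gen_simps)
  next
    case (Suc p)
    then have "r = kd_relation (p + q) q" using kd_relator_eq[of p q] ab r q by simp
    then show thesis using that(2) ab Suc q by (auto simp: allow_snd_def)
  qed
qed

lemma kd_relation_in_rels:
  assumes "q \<in> allow_snd n"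
  shows "kd_relation n q \<in> kd_rels"
proof -
  define p where "p = n - q"
  have p: "p \<le> 2 * q" "n = p + q" using assms by (auto simp: p_def allow_snd_def)
  then have "Suc p < 2 * Suc q" by simp
  then show ?thesis unfolding p(2) kd_relator_eq[OF p(1), symmetric] kd_rels_def by blast
qed

lemma betas_append: "betas (I @ J) = betas I * betas J"
  by (simp add: betas_def)

lemma betas_simps [simp]: "betas [] = 1" "betas (i # I) = Sq (Suc i) * betas I"
  by (simp_all add: betas_def)

lemma betas_eq_abs: "betas I = abs_kd (bas (Word I))"
proof (induction I)
  case Nil
  then show ?case by (simp add: one_kd_def zero_word_def[symmetric])
next
  case (Cons i I)
  have "bas (Word (i # I)) = sq_gen (Suc i) * bas (Word I)" by (simp add: sq_gen_simps gen_def mult_single plus_word_def)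
  then show ?case by (simp add: Cons Sq.abs_eq times_kd.abs_eq)
qed

lemma abs_kd_zero_iff: "abs_kd z = 0 \<longleftrightarrow> z \<in> two_sided_ideal kd_rels"
  by (simp add: zero_kd_def kd.abs_eq_iff cong_mod_def)

lemma abs_kd_add: "abs_kd (x + y) = abs_kd x + abs_kd y"
  by (simp add: plus_kd.abs_eq)

lemma Sq_adem:
  assumes "q \<in> allow_snd n"
  shows "Sq (Suc (n - q)) * Sq (Suc q) = (\<Sum>b\<in>bad_snd n. scale2 (adem n b q) (Sq (Suc (n - b)) * Sq (Suc b)))"
proof -
  have "abs_kd (kd_relation n q) = 0"
    unfolding abs_kd_zero_iff by (rule two_sided_ideal_base) (rule kd_relation_in_rels[OF assms])
  moreover have "abs_kd (kd_relation n q) = betas [n - q, q] + (\<Sum>b\<in>bad_snd n. scale2 (adem n b q) (betas [n - b, b]))"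
    unfolding kd_relation_def abs_kd_add additive_sum[of abs_kd, OF abs_kd_add] betas_eq_abs
    by (simp add: scale2_additive[of abs_kd, OF additive_zero[of abs_kd, OF abs_kd_add]])
  ultimately show ?thesis using double_eqI[OF kd_double] by simp
qed

text \<open>A function on words of length \<open>s\<close> that is a relator in every pair of adjacent letters is a
  functional on the Koszul dual algebra.\<close>

lemma kd_functional_exists:
  fixes \<kappa> :: "nat list \<Rightarrow> bit"
  assumes "\<And>u v. length u + length v + 2 = s \<Longrightarrow> relator (\<lambda>p q. \<kappa> (u @ p # q # v))"
  obtains h :: "kd \<Rightarrow> bit" where "\<And>x y. h (x + y) = h x + h y" "\<And>I. length I = s \<Longrightarrow> h (betas I) = \<kappa> I"
proof -
  have bit_double: "x + x = 0" for x :: bit by (cases x) simp_all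
  define \<phi> where "\<phi> = lin (\<lambda>w. if length (letters w) = s then \<kappa> (letters w) else 0)"
  have add: "\<phi> (x + y) = \<phi> x + \<phi> y" for x y unfolding \<phi>_def by (rule lin_add[OF bit_double])
  have 0: "\<phi> 0 = 0" by (simp add: \<phi>_def)
  have word: "\<phi> (bas u * r * bas v) = 0" if "r \<in> kd_rels" for u r v
    using that
  proof (cases rule: kd_rels_cases)
    case 1
    then show ?thesis by (simp add: 0)
  next
    case (2 n q)
    let ?w = "\<lambda>b. letters u @ (n - b) # b # letters v"
    have "bas u * r * bas v = bas (Word (?w q)) + (\<Sum>b\<in>bad_snd n. scale2 (adem n b q) (bas (Word (?w b))))"
      unfolding 2(1) kd_relation_def distrib_left distrib_right sum_distrib_left sum_distrib_right
      by (simp only: scale2_mult_left scale2_mult_right bas_mult_pair)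
    then have e: "\<phi> (bas u * r * bas v) = \<phi> (bas (Word (?w q))) + (\<Sum>b\<in>bad_snd n. scale2 (adem n b q) (\<phi> (bas (Word (?w b)))))"
      by (simp add: add additive_sum[of \<phi>, OF add] scale2_additive[of \<phi>, OF 0])
    show ?thesis
    proof (cases "length (letters u) + length (letters v) + 2 = s")
      case True
      have "\<kappa> (?w q) = (\<Sum>b\<in>bad_snd n. adem n b q * \<kappa> (?w b))"
        using relatorD[OF assms[OF True] 2(2)] .
      moreover have "\<phi> (bas (Word (?w b))) = \<kappa> (?w b)" for b using True by (simp add: \<phi>_def)
      moreover have "scale2 c x = c * x" for c x :: bit by (simp add: scale2_def bit_not_zero_iff)
      ultimately show ?thesis unfolding e by (simp only: bit_double)
    next
      case False
      then have "\<phi> (bas (Word (?w b))) = 0" for b by (simp add: \<phi>_def)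
      then show ?thesis unfolding e by simp
    qed
  qed
  have ideal: "\<phi> z = 0" if "z \<in> two_sided_ideal kd_rels" for z
    by (rule additive_ideal_zero[OF add word that])
  define h where "h y = \<phi> (rep_kd y)" for y
  have habs: "h (abs_kd z) = \<phi> z" for z
  proof -
    have "abs_kd (rep_kd (abs_kd z)) = abs_kd z" by (rule Quotient3_abs_rep[OF Quotient3_kd])
    then have "rep_kd (abs_kd z) - z \<in> two_sided_ideal kd_rels" by (simp add: kd.abs_eq_iff cong_mod_def)
    from ideal[OF this] have "\<phi> ((rep_kd (abs_kd z) - z) + z) = \<phi> z" unfolding add by simp
    then show ?thesis by (simp add: h_def)
  qed
  show thesis
  proof (rule that[of h])
    fix x y
    have "h (abs_kd a + abs_kd b) = h (abs_kd a) + h (abs_kd b)" for a b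
      by (simp only: abs_kd_add[symmetric] habs add)
    then show "h (x + y) = h x + h y" by (metis Quotient3_abs_rep[OF Quotient3_kd])
  next
    fix I :: "nat list" assume "length I = s"
    then show "h (betas I) = \<kappa> I" by (simp add: betas_eq_abs habs \<phi>_def)
  qed
qed

lemma dual_to_critical:
  assumes "critical c"
  obtains h :: "kd \<Rightarrow> bit" where "\<And>x y. h (x + y) = h x + h y" "h (betas c) = 1"
    "\<And>I. length I = length c \<Longrightarrow> h (betas I) \<noteq> 0 \<Longrightarrow> I = c \<or> wl I < wl c"
proof -
  from dual_functional_exists[OF assms] obtain \<kappa> where \<kappa>: "\<kappa> c = (1::bit)"
    "\<And>I. length I = length c \<Longrightarrow> \<kappa> I \<noteq> 0 \<Longrightarrow> I = c \<or> wl I < wl c"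
    "\<And>u v. length u + length v + 2 = length c \<Longrightarrow> relator (\<lambda>p q. \<kappa> (u @ p # q # v))" by blast
  obtain h :: "kd \<Rightarrow> bit" where h: "\<And>x y. h (x + y) = h x + h y" "\<And>I. length I = length c \<Longrightarrow> h (betas I) = \<kappa> I"
    using kd_functional_exists[OF \<kappa>(3)] by blast
  show thesis by (rule that[of h]) (use h \<kappa>(1,2) in simp_all)
qed

lemma tensor_eval_exists:
  fixes h :: "kd \<Rightarrow> bit"
  assumes d: "\<And>x::'m::ab_group_add. x + x = 0" and h: "\<And>x y. h (x + y) = h x + h y"
  obtains ev :: "('m::ab_group_add, kd) tensor \<Rightarrow> 'm" where "\<And>x y. ev (x + y) = ev x + ev y" "\<And>x w. ev (ten x w) = scale2 (h w) x"
proof -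
  define \<phi> :: "('m \<times> kd \<Rightarrow>\<^sub>0 bit) \<Rightarrow> 'm" where "\<phi> = lin (\<lambda>(x, w). scale2 (h w) x)"
  have add: "\<phi> (x + y) = \<phi> x + \<phi> y" for x y unfolding \<phi>_def by (rule lin_add[OF d])
  have sub: "\<phi> (x - y) = \<phi> x - \<phi> y" for x y using add[of "x - y" y] by simp
  have rel: "\<phi> z = 0" if "z \<in> span2 bilin_rels" for z
  proof (rule additive_span2_zero[of \<phi>])
    show "z \<in> span2 bilin_rels" by (rule that)
    fix r :: "'m \<times> kd \<Rightarrow>\<^sub>0 bit" assume "r \<in> bilin_rels"
    then show "\<phi> r = 0"
      unfolding bilin_rels_def
      by (auto simp: sub) (simp_all add: \<phi>_def scale2_add_right h scale2_add_left[OF d])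
  qed (rule add)
  define ev where "ev t = \<phi> (rep_tensor t)" for t
  have ev: "ev (abs_tensor z) = \<phi> z" for z
  proof -
    have "abs_tensor (rep_tensor (abs_tensor z)) = abs_tensor z" by (rule Quotient3_abs_rep[OF Quotient3_tensor])
    then have "rep_tensor (abs_tensor z) - z \<in> span2 bilin_rels" by (simp add: tensor.abs_eq_iff cong_mod_def)
    from rel[OF this] have "\<phi> (rep_tensor (abs_tensor z)) - \<phi> z = 0" by (simp add: sub)
    then show ?thesis by (simp add: ev_def)
  qed
  show thesis
  proof (rule that[of ev])
    fix x y :: "('m, kd) tensor"
    have "ev (abs_tensor a + abs_tensor b) = ev (abs_tensor a) + ev (abs_tensor b)" for a b
      by (simp only: plus_tensor.abs_eq ev add)
    then show "ev (x + y) = ev x + ev y" by (metis Quotient3_abs_rep[OF Quotient3_tensor])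
  next
    fix x :: 'm and w :: kd
    show "ev (ten x w) = scale2 (h w) x" by (simp add: ten.abs_eq ev \<phi>_def)
  qed
qed

lemma ten_zero [simp]: "ten 0 w = 0" "ten x 0 = 0"
  by (rule additive_zero, rule ten_add_left) (rule additive_zero, rule ten_add_right)

text \<open>The matrix of the functionals dual to the critical words is unitriangular with respect to the
  weight, so the coefficients vanish one after the other.\<close>

lemma critical_independent:
  fixes x :: "nat list \<Rightarrow> 'm::ab_group_add"
  assumes d: "\<And>x::'m. x + x = 0" and C: "finite C" "\<And>c. c \<in> C \<Longrightarrow> critical c \<and> length c = s"
    and 0: "(\<Sum>c\<in>C. ten (x c) (betas c)) = 0" and "c \<in> C"
  shows "x c = 0"
  using \<open>c \<in> C\<close>
proof (induction "wl c" arbitrary: c rule: less_induct)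
  case less
  have c: "critical c" "length c = s" using C(2)[OF less.prems] by auto
  from dual_to_critical[OF c(1)] obtain h :: "kd \<Rightarrow> bit" where h: "\<And>x y. h (x + y) = h x + h y" "h (betas c) = 1"
    "\<And>I. length I = length c \<Longrightarrow> h (betas I) \<noteq> 0 \<Longrightarrow> I = c \<or> wl I < wl c" by blast
  from tensor_eval_exists[OF d h(1)] obtain ev :: "('m, kd) tensor \<Rightarrow> 'm"
    where ev: "\<And>x y. ev (x + y) = ev x + ev y" "\<And>x w. ev (ten x w) = scale2 (h w) x" by blast
  have "0 = ev (\<Sum>c\<in>C. ten (x c) (betas c))" unfolding 0 by (rule additive_zero[of ev, OF ev(1), symmetric])
  also have "\<dots> = (\<Sum>c'\<in>C. scale2 (h (betas c')) (x c'))"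
    by (simp only: additive_sum[of ev, OF ev(1)] ev(2))
  also have "\<dots> = (\<Sum>c'\<in>C. if c' = c then x c else 0)"
  proof (rule sum.cong[OF refl])
    fix c' assume c': "c' \<in> C"
    show "scale2 (h (betas c')) (x c') = (if c' = c then x c else 0)"
    proof (cases "c' = c \<or> h (betas c') = 0")
      case False
      then have "wl c' < wl c" using h(3)[of c'] C(2)[OF c'] c by auto
      then show ?thesis using less.hyps[OF _ c'] False by simp
    qed (use h(2) in auto)
  qed
  also have "\<dots> = x c" using less.prems C(1) by simp
  finally show ?case by simp
qed


section \<open>Critical words span the domain of the Koszul complex\<close>

definition critical_words :: "nat \<Rightarrow> nat \<Rightarrow> nat list set" where
  "critical_words s d = {I \<in> words s d. critical I \<and> \<not> low_excess 0 I}"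

lemma finite_critical_words [simp]: "finite (critical_words s d)"
  by (simp add: critical_words_def)

lemma low_excess_iff_nth: "(\<forall>j<length I. I ! j > sum_list (drop (Suc j) I)) \<longleftrightarrow> \<not> low_excess 0 I"
proof (induction I)
  case (Cons i I)
  show ?case by (auto simp: Cons[symmetric] All_less_Suc2 not_le)
qed simp

lemma L0_eq: "L0 s d = span2 {betas I | I. I \<in> words s d \<and> \<not> low_excess 0 I}"
  unfolding L0_def low_excess_iff_nth by (simp add: words_def conj_assoc)

lemma not_critical_obtain:
  assumes "\<not> critical I"
  obtains u n q v where "I = u @ (n - q) # q # v" "q \<in> allow_snd n"
  using assms
proof (induction I arbitrary: thesis rule: critical.induct)
  case (1 i j I)
  show ?case
  proof (cases "2 * j < i")
    case True
    then have "\<not> critical (j # I)" using 1 by simp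
    then obtain u n b v where "j # I = u @ (n - b) # b # v" "b \<in> allow_snd n" using 1(1) by blast
    then show ?thesis using 1(2)[of "i # u"] by simp
  next
    case False
    then show ?thesis using 1(2)[of "[]" "i + j" j I] by (simp add: allow_snd_def)
  qed
qed simp_all

lemma wl_le: "wl I \<le> length I * (sum_list I + length I)"
  by (induction I) (auto simp: algebra_simps)

text \<open>The relations of the Koszul dual algebra rewrite in the direction opposite to those of the
  Dyer-Lashof algebra. Hence \<open>low_excess_rewrite\<close>, read backwards, shows that the condition defining
  \<open>L(0)\<close> is preserved, and the weight grows; it is bounded for given length and index sum.\<close>

lemma betas_in_critical_span:
  "I \<in> words s d \<Longrightarrow> \<not> low_excess 0 I \<Longrightarrow> betas I \<in> span2 (betas ` critical_words s d)"
proof (induction "s * (d + s) - wl I" arbitrary: I rule: less_induct)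
  case less
  show ?case
  proof (cases "critical I")
    case True
    then show ?thesis using less.prems by (intro span2_base[OF kd_double]) (auto simp: critical_words_def)
  next
    case False
    then obtain u n q v where I: "I = u @ (n - q) # q # v" "q \<in> allow_snd n" by (rule not_critical_obtain)
    have "betas I = betas u * (Sq (Suc (n - q)) * Sq (Suc q)) * betas v" by (simp add: I(1) betas_append mult.assoc)
    also have "\<dots> = (\<Sum>b\<in>bad_snd n. scale2 (adem n b q) (betas (u @ (n - b) # b # v)))"
      unfolding Sq_adem[OF I(2)]
      by (simp add: sum_distrib_left sum_distrib_right scale2_mult_left scale2_mult_right betas_append mult.assoc)
    finally have eq: "betas I = (\<Sum>b\<in>bad_snd n. scale2 (adem n b q) (betas (u @ (n - b) # b # v)))" .
    show ?thesis unfolding eq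
    proof (rule span2_sum[OF kd_double])
      fix b assume b: "b \<in> bad_snd n"
      let ?J = "u @ (n - b) # b # v"
      show "scale2 (adem n b q) (betas ?J) \<in> span2 (betas ` critical_words s d)"
      proof (cases "adem n b q = 0")
        case True
        then show ?thesis by (simp add: span2_zero[OF kd_double])
      next
        case False
        have J: "?J \<in> words s d" using less.prems(1) I b by (auto simp: words_def allow_snd_def bad_snd_def)
        have low: "\<not> low_excess 0 ?J" using low_excess_rewrite[OF b I(2) False] less.prems(2) I(1) by blast
        have "wl I < wl ?J" unfolding I(1) by (rule wl_rewrite[OF b I(2)])
        moreover have "length ?J = s" "sum_list ?J = d" using J unfolding words_def by blast+
        then have "wl ?J \<le> s * (d + s)" using wl_le[of ?J] by metis
        ultimately have "betas ?J \<in> span2 (betas ` critical_words s d)"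
          by (intro less.hyps J low) simp
        then show ?thesis by (rule span2_scale2[OF kd_double])
      qed
    qed
  qed
qed

lemma L0_critical: "w \<in> L0 s d \<Longrightarrow> w \<in> span2 (betas ` critical_words s d)"
  unfolding L0_eq by (rule span2_mono[OF kd_double]) (use betas_in_critical_span in auto)

lemma L0_tensor_decompose:
  assumes A: "0 \<in> A" "\<And>x y. x \<in> A \<Longrightarrow> y \<in> A \<Longrightarrow> x + y \<in> (A :: 'm::ab_group_add set)"
    and t: "t \<in> span2 {ten x w | x w. x \<in> A \<and> w \<in> L0 s d}"
  obtains x where "\<And>c. x c \<in> A" "t = (\<Sum>c\<in>critical_words s d. ten (x c) (betas c))"
proof -
  let ?C = "critical_words s d"
  let ?P = "\<lambda>t. \<exists>x. (\<forall>c. x c \<in> A) \<and> t = (\<Sum>c\<in>?C. ten (x c) (betas c))"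
  have P0: "?P 0" by (rule exI[of _ "\<lambda>_. 0"]) (simp add: A)
  have Padd: "?P (t + t')" if "?P t" "?P t'" for t t'
  proof -
    from that obtain x x' where "\<forall>c. x c \<in> A" "t = (\<Sum>c\<in>?C. ten (x c) (betas c))"
      "\<forall>c. x' c \<in> A" "t' = (\<Sum>c\<in>?C. ten (x' c) (betas c))" by blast
    then show ?thesis by (intro exI[of _ "\<lambda>c. x c + x' c"]) (simp add: A ten_add_left sum.distrib)
  qed
  have Pten: "?P (ten x w)" if x: "x \<in> A" and w: "w \<in> L0 s d" for x w
    using kd_double L0_critical[OF w]
  proof (induction rule: span2_induct)
    case zero then show ?case using P0 by simp
  next
    case (step y z)
    then obtain c where c: "c \<in> ?C" "y = betas c" by blast
    have "?P (ten x y)"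
      by (rule exI[of _ "\<lambda>c'. if c' = c then x else 0"])
        (use c x A in \<open>simp add: if_distrib[of "\<lambda>x. ten x _"] sum.delta cong: if_cong\<close>)
    then show ?case using Padd[OF _ step(2)] by (simp add: ten_add_right)
  qed
  have "?P t" using tensor_double t
  proof (induction rule: span2_induct)
    case zero then show ?case by (rule P0)
  next
    case (step y z)
    then obtain x w where y: "y = ten x w" "x \<in> A" "w \<in> L0 s d" by blast
    show ?case unfolding y(1) by (rule Padd[OF Pten[OF y(2,3)] step(2)])
  qed
  then show thesis using that by blast
qed

lemma L0_subset_kd_part: "L0 s d \<subseteq> kd_part s d"
proof
  fix z assume "z \<in> L0 s d"
  then show "z \<in> kd_part s d" unfolding L0_eq kd_part_def
    by (rule span2_mono[OF kd_double, rotated]) (rule span2_base[OF kd_double], auto simp: words_def)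
qed

section \<open>The comonadic resolution\<close>

lemma aug_add: "aug (a + b) = aug a + aug b"
  by transfer (rule const_coeff_add)

lemma aug_mult: "aug (a * b) = aug a * aug b"
  by transfer (rule const_coeff_mult)

lemma aug_one [simp]: "aug 1 = 1"
  by transfer simp

lemma aug_Q [simp]: "aug (Q i) = 0"
  by transfer simp

lemma aug_Qs: "aug (Qs I) = of_bool (I = [])"
  by (cases I) (simp_all add: aug_mult)

lemma tens_bas [simp]: "tens a (bas v) = bas (a # v)"
  by (simp add: tens_def)

lemma tens_add: "tens a (y + z) = tens a y + tens a z"
  unfolding tens_def by (rule lin_add[OF pm2_double])

lemma T_act_bas [simp]: "T_act a (bas []) = scale2 (aug a) (bas [])" "T_act a (bas (b # w)) = bas ((a * b) # w)"
  by (simp_all add: T_act_def)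

lemma T_act_add: "T_act a (y + z) = T_act a y + T_act a z"
  unfolding T_act_def by (rule lin_add[OF pm2_double])

lemma U_map_bas [simp]: "U_map f (bas []) = 0" "U_map f (bas (a # w)) = tens a (f (bas w))"
  by (simp_all add: U_map_def)

lemma U_map_add: "U_map f (y + z) = U_map f y + U_map f z"
  unfolding U_map_def by (rule lin_add[OF pm2_double])

lemma counit_bas [simp]: "counit (bas []) = 0" "counit (bas (a # w)) = T_act a (bas w)"
  by (simp_all add: counit_def)

lemma counit_add: "counit (y + z) = counit y + counit z"
  unfolding counit_def by (rule lin_add[OF pm2_double])

lemma face_0 [simp]: "face 0 = counit"
  by (simp add: face_def)

lemma face_Suc [simp]: "face (Suc i) = U_map (face i)"
  by (simp add: face_def)

lemma face_add: "face i (y + z) = face i y + face i z"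
  by (cases i) (simp_all add: counit_add U_map_add)

lemma T_zero [simp]: "tens a 0 = 0" "T_act a 0 = 0" "U_map f 0 = 0" "counit 0 = 0" "face i 0 = 0"
  by (rule additive_zero, rule tens_add) (rule additive_zero, rule T_act_add, rule additive_zero, rule U_map_add,
      rule additive_zero, rule counit_add, rule additive_zero, rule face_add)

lemma T_diff: "tens a (y - z) = tens a y - tens a z" "T_act a (y - z) = T_act a y - T_act a z"
  "U_map f (y - z) = U_map f y - U_map f z" "counit (y - z) = counit y - counit z"
  by (simp_all only: double_minus(2)[OF pm2_double] tens_add T_act_add U_map_add counit_add)

lemma T_induct [case_names zero nil step]:
  fixes z :: T
  assumes "P 0" "\<And>y. P y \<Longrightarrow> P (bas [] + y)" "\<And>a w y. P y \<Longrightarrow> P (bas (a # w) + y)"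
  shows "P z"
proof (induction z rule: pm2_induct)
  case (step v y)
  then show ?case using assms(2,3) by (cases v) auto
qed (rule assms(1))

lemma T_act_mult: "T_act (a * b) z = T_act a (T_act b z)"
  by (induction z rule: T_induct)
    (simp_all add: T_act_add aug_mult mult.assoc scale2_additive[of "T_act a"] scale2_scale2 mult.commute)

lemma T_act_one: "T_act 1 z = z"
  by (induction z rule: T_induct) (simp_all add: T_act_add)

lemma T_act_tens: "T_act a (tens b z) = tens (a * b) z"
  by (induction z rule: T_induct) (simp_all add: T_act_add tens_add)

lemma U_map_tens:
  assumes "\<And>y z. f (y + z) = f y + f z"
  shows "U_map f (tens a z) = tens a (f z)"
  by (induction z rule: T_induct) (simp_all add: U_map_add tens_add assms additive_zero[of f, OF assms])

lemma counit_tens: "counit (tens a z) = T_act a z"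
  by (induction z rule: T_induct) (simp_all add: counit_add tens_add T_act_add)

lemma counit_T_act: "counit (T_act a z) = T_act a (counit z)"
proof (induction z rule: T_induct)
  case (nil y)
  then show ?case by (simp add: counit_add T_act_add scale2_additive[of counit])
next
  case (step b w y)
  then show ?case by (simp add: counit_add T_act_add T_act_mult)
qed simp

lemma U_map_T_act: "U_map f (T_act a z) = T_act a (U_map f z)"
proof (induction z rule: T_induct)
  case (nil y)
  then show ?case by (simp add: U_map_add T_act_add scale2_additive[of "U_map f"])
next
  case (step b w y)
  then show ?case by (simp add: U_map_add T_act_add T_act_tens)
qed simp

lemma face_T_act: "face i (T_act a z) = T_act a (face i z)"
  by (cases i) (simp_all add: counit_T_act U_map_T_act)

text \<open>The simplicial identities hold on representatives, that is, in \<^typ>\<open>T\<close> itself.\<close>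

lemma face_face: "i \<le> j \<Longrightarrow> face i (face (Suc j) z) = face j (face i z)"
proof (induction i arbitrary: j z)
  case 0
  show ?case
  proof (induction z rule: T_induct)
    case (step a w y)
    then show ?case
      by (simp add: counit_add face_add U_map_add counit_tens face_T_act)
  qed (simp_all add: counit_add face_add U_map_add)
next
  case (Suc i)
  then obtain k where k: "j = Suc k" "i \<le> k" by (cases j) auto
  show ?case
  proof (induction z rule: T_induct)
    case (step a w y)
    then show ?case using Suc.IH[OF k(2)] face_add
      by (simp add: k U_map_add face_add U_map_tens) 
  qed (simp_all add: k U_map_add)
qed

abbreviation homogeneous :: "dl list \<Rightarrow> nat list \<Rightarrow> bool" where
  "homogeneous \<equiv> list_all2 (\<lambda>a q. a \<in> dl_deg q)"

lemma T_deg_zero: "0 \<in> T_deg p"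
  unfolding T_deg_def by (rule pm2.span_zero)

lemma T_deg_add: "y \<in> T_deg p \<Longrightarrow> z \<in> T_deg p \<Longrightarrow> y + z \<in> T_deg p"
  unfolding T_deg_def by (rule pm2.span_add)

lemma T_deg_bas: "homogeneous v ps \<Longrightarrow> bas v \<in> T_deg (sum_list ps)"
  unfolding T_deg_def by (rule pm2.span_base) auto

lemma T_deg_induct [consumes 1, case_names zero step]:
  assumes "z \<in> T_deg p" "P 0"
    "\<And>v ps y. homogeneous v ps \<Longrightarrow> sum_list ps = p \<Longrightarrow> P y \<Longrightarrow> P (bas v + y)"
  shows "P z"
  using pm2_double assms(1)[unfolded T_deg_def] by (induction rule: span2_induct) (use assms(2,3) in auto)

lemma T_deg_tens:
  assumes "a \<in> dl_deg q" "z \<in> T_deg p"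
  shows "tens a z \<in> T_deg (q + p)"
  using assms(2)
proof (induction rule: T_deg_induct)
  case zero then show ?case by (simp add: T_deg_zero)
next
  case (step v ps y)
  have "bas (a # v) \<in> T_deg (sum_list (q # ps))" by (rule T_deg_bas) (use step assms(1) in simp)
  then show ?case using step by (simp add: tens_add T_deg_add)
qed

text \<open>On \<open>U F\<^sub>2\<close> the counit is the augmentation, which is homogeneous because a monomial with non-zero
  augmentation is empty.\<close>

lemma T_deg_counit: "z \<in> T_deg p \<Longrightarrow> counit z \<in> T_deg p"
proof (induction rule: T_deg_induct)
  case zero then show ?case by (simp add: T_deg_zero)
next
  case (step v ps y)
  have "counit (bas v) \<in> T_deg p"
  proof (cases v)
    case Nil
    then show ?thesis by (simp add: T_deg_zero)
  next
    case (Cons a w)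
    then obtain q qs where ps: "ps = q # qs" "a \<in> dl_deg q" "homogeneous w qs"
      using step(1) by (auto simp: list_all2_Cons1)
    show ?thesis
    proof (cases w)
      case Nil
      have "scale2 (aug a) (bas []) \<in> T_deg q"
        using ps(2)
      proof (induction rule: dl_deg_induct)
        case zero
        then show ?case using additive_zero[of aug, OF aug_add] by (simp add: T_deg_zero)
      next
        case (step I y)
        have "scale2 (aug (Qs I)) (bas []) \<in> T_deg q"
          using step(1) T_deg_bas[of "[]" "[]"] by (auto simp: aug_Qs T_deg_zero)
        then show ?case using step(2) by (simp only: aug_add scale2_add_left[OF pm2_double] T_deg_add)
      qed
      then show ?thesis using Cons Nil ps step(2) by simp
    next
      case (Cons b u)
      then obtain r rs where qs: "qs = r # rs" "b \<in> dl_deg r" "homogeneous u rs"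
        using ps(3) by (auto simp: list_all2_Cons1)
      have "bas ((a * b) # u) \<in> T_deg (sum_list ((q + r) # rs))"
        by (rule T_deg_bas) (use ps qs dl_deg_mult in simp)
      then show ?thesis using \<open>v = a # w\<close> Cons ps qs step(2) by (simp add: add.assoc)
    qed
  qed
  then show ?case using step by (simp add: counit_add T_deg_add)
qed

lemma T_deg_face: "z \<in> T_deg p \<Longrightarrow> face i z \<in> T_deg p"
proof (induction i arbitrary: z p)
  case 0 then show ?case by (simp add: T_deg_counit)
next
  case (Suc i)
  from Suc.prems show ?case
  proof (induction rule: T_deg_induct)
    case zero then show ?case by (simp add: T_deg_zero)
  next
    case (step v ps y)
    have "U_map (face i) (bas v) \<in> T_deg p"
    proof (cases v)
      case Nil
      then show ?thesis by (simp add: T_deg_zero)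
    next
      case (Cons a w)
      then obtain q qs where ps: "ps = q # qs" "a \<in> dl_deg q" "homogeneous w qs"
        using step(1) by (auto simp: list_all2_Cons1)
      have "tens a (face i (bas w)) \<in> T_deg (q + sum_list qs)"
        by (rule T_deg_tens[OF ps(2)]) (rule Suc.IH[OF T_deg_bas[OF ps(3)]])
      then show ?thesis using Cons ps step(2) by simp
    qed
    then show ?case using step by (simp add: U_map_add T_deg_add)
  qed
qed

text \<open>The kernel of the projection of \<^typ>\<open>T\<close> onto the \<open>n\<close>-fold application of \<open>U\<close>.\<close>

abbreviation res_rel :: "nat \<Rightarrow> T set" where
  "res_rel n \<equiv> (U_rel ^^ n) F2_rel"

lemma U_rel_induct [consumes 1, case_names zero nil add tens low]:
  assumes "z \<in> U_rel N" "P 0" "\<And>y. P y \<Longrightarrow> P (bas [] + y)"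
    "\<And>a b v y. P y \<Longrightarrow> P ((bas ((a + b) # v) - bas (a # v) - bas (b # v)) + y)"
    "\<And>a z y. z \<in> N \<Longrightarrow> P y \<Longrightarrow> P (tens a z + y)"
    "\<And>a i z p y. z \<in> T_deg p \<Longrightarrow> i \<le> p \<Longrightarrow> P y \<Longrightarrow> P (T_act a (T_act (Q i) z) + y)"
  shows "P z"
  using pm2_double assms(1)[unfolded U_rel_def]
  by (induction rule: span2_induct) (use assms(2-) in blast)+

lemma U_rel_zero: "0 \<in> U_rel N"
  unfolding U_rel_def by (rule pm2.span_zero)

lemma U_rel_plus: "y \<in> U_rel N \<Longrightarrow> z \<in> U_rel N \<Longrightarrow> y + z \<in> U_rel N"
  unfolding U_rel_def by (rule pm2.span_add)

lemma U_rel_nil: "bas [] \<in> U_rel N"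
  unfolding U_rel_def by (rule pm2.span_base) auto

lemma U_rel_add: "bas ((a + b) # v) - bas (a # v) - bas (b # v) \<in> U_rel N"
  unfolding U_rel_def by (rule pm2.span_base) blast

lemma U_rel_tens: "z \<in> N \<Longrightarrow> tens a z \<in> U_rel N"
  unfolding U_rel_def by (rule pm2.span_base) blast

lemma U_rel_low: "z \<in> T_deg p \<Longrightarrow> i \<le> p \<Longrightarrow> T_act a (T_act (Q i) z) \<in> U_rel N"
  unfolding U_rel_def by (rule pm2.span_base) blast

lemma F2_rel_bas: "v \<noteq> [] \<Longrightarrow> bas v \<in> F2_rel"
  unfolding F2_rel_def by (rule pm2.span_base) auto

lemma F2_rel_zero: "0 \<in> F2_rel"
  unfolding F2_rel_def by (rule pm2.span_zero)

lemma F2_rel_add: "y \<in> F2_rel \<Longrightarrow> z \<in> F2_rel \<Longrightarrow> y + z \<in> F2_rel"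
  unfolding F2_rel_def by (rule pm2.span_add)

lemma res_rel_zero: "0 \<in> res_rel n"
  by (cases n) (simp_all add: F2_rel_zero U_rel_zero)

lemma res_rel_plus: "y \<in> res_rel n \<Longrightarrow> z \<in> res_rel n \<Longrightarrow> y + z \<in> res_rel n"
  by (cases n) (simp_all add: F2_rel_add U_rel_plus)

lemma res_rel_T_act: "z \<in> res_rel n \<Longrightarrow> T_act a z \<in> res_rel n"
proof (cases n)
  case 0
  assume "z \<in> res_rel n"
  then have "z \<in> span2 {bas v | v. v \<noteq> []}" by (simp add: 0 F2_rel_def)
  with pm2_double have "T_act a z \<in> F2_rel"
  proof (induction rule: span2_induct)
    case zero then show ?case by (simp add: F2_rel_zero)
  next
    case (step x y)
    then obtain b w where "x = bas (b # w)" by (auto simp: neq_Nil_conv)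
    then show ?case using step(2) by (simp add: T_act_add F2_rel_add F2_rel_bas)
  qed
  then show ?thesis by (simp add: 0)
next
  case (Suc m)
  assume "z \<in> res_rel n"
  then have "z \<in> U_rel (res_rel m)" by (simp add: Suc)
  then have "T_act a z \<in> U_rel (res_rel m)"
  proof (induction rule: U_rel_induct)
    case zero then show ?case by (simp add: U_rel_zero)
  next
    case (nil y)
    then show ?case by (simp add: T_act_add scale2_def U_rel_nil U_rel_plus)
  next
    case (add b c v y)
    have "T_act a (bas ((b + c) # v) - bas (b # v) - bas (c # v)) = bas ((a * b + a * c) # v) - bas ((a * b) # v) - bas ((a * c) # v)"
      by (simp add: T_diff distrib_left)
    then show ?case using add U_rel_add[of "a * b" "a * c" v] by (simp only: T_act_add U_rel_plus)
  next
    case (tens b z y)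
    then show ?case by (simp add: T_act_add T_act_tens U_rel_tens U_rel_plus)
  next
    case (low b i z p y)
    then show ?case using U_rel_low[of z p i "a * b"] by (simp add: T_act_add T_act_mult U_rel_plus)
  qed
  then show ?thesis by (simp add: Suc)
qed

lemma res_rel_add: "bas (u @ (a + b) # v) - bas (u @ a # v) - bas (u @ b # v) \<in> res_rel n"
proof (induction n arbitrary: u)
  case 0
  then show ?case by (simp add: double_minus(2)[OF pm2_double] F2_rel_add F2_rel_bas)
next
  case (Suc n)
  show ?case
  proof (cases u)
    case Nil
    then show ?thesis by (simp add: U_rel_add)
  next
    case (Cons c w)
    have "bas (u @ (a + b) # v) - bas (u @ a # v) - bas (u @ b # v)
       = tens c (bas (w @ (a + b) # v) - bas (w @ a # v) - bas (w @ b # v))"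
      by (simp add: Cons T_diff)
    then show ?thesis using U_rel_tens[OF Suc[of w], of c] by simp
  qed
qed

lemma res_rel_length: "length v \<noteq> n \<Longrightarrow> bas v \<in> res_rel n"
proof (induction n arbitrary: v)
  case 0
  then show ?case by (simp add: F2_rel_bas)
next
  case (Suc n)
  show ?case
  proof (cases v)
    case Nil then show ?thesis by (simp add: U_rel_nil)
  next
    case (Cons a w)
    then show ?thesis using Suc U_rel_tens[of "bas w" "res_rel n" a] by simp
  qed
qed

lemma tens_add_left: "tens (a + b) y - tens a y - tens b y \<in> U_rel N"
proof (induction y rule: pm2_induct)
  case zero then show ?case by (simp add: U_rel_zero)
next
  case (step v y)
  have "tens (a + b) (bas v + y) - tens a (bas v + y) - tens b (bas v + y)
     = (bas ((a + b) # v) - bas (a # v) - bas (b # v)) + (tens (a + b) y - tens a y - tens b y)"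
    by (simp add: tens_add algebra_simps)
  then show ?case using U_rel_plus[OF U_rel_add step] by metis
qed

lemma counit_res_rel: "z \<in> res_rel (Suc n) \<Longrightarrow> counit z \<in> res_rel n"
proof -
  assume "z \<in> res_rel (Suc n)"
  then have "z \<in> U_rel (res_rel n)" by simp
  then show ?thesis
  proof (induction rule: U_rel_induct)
    case zero then show ?case by (simp add: res_rel_zero)
  next
    case (nil y)
    then show ?case by (simp add: counit_add)
  next
    case (add a b v y)
    have "T_act (a + b) (bas v) - T_act a (bas v) - T_act b (bas v) \<in> res_rel n"
    proof (cases v)
      case Nil
      then have "T_act (a + b) (bas v) - T_act a (bas v) - T_act b (bas v) = 0"
        by (simp add: aug_add scale2_add_left[OF pm2_double])
      then show ?thesis by (simp only: res_rel_zero)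
    next
      case (Cons c w)
      then show ?thesis using res_rel_add[of "[]" "a * c" "b * c" w n] by (simp add: distrib_right)
    qed
    then show ?case using add by (simp add: counit_add T_diff res_rel_plus)
  next
    case (tens a z y)
    then show ?case by (simp add: counit_add counit_tens res_rel_plus res_rel_T_act)
  next
    case (low a i z p y)
    have "T_act a (T_act (Q i) (counit z)) \<in> res_rel n"
    proof (cases n)
      case 0
      have "T_act (Q i) z' \<in> F2_rel" for z'
        by (induction z' rule: T_induct) (simp_all add: T_act_add F2_rel_zero F2_rel_add F2_rel_bas)
      then show ?thesis using res_rel_T_act[of _ 0] 0 by simp
    next
      case (Suc m)
      then show ?thesis using U_rel_low[OF T_deg_counit[OF low(1)] low(2)] by simp
    qed
    then show ?case using low by (simp add: counit_add counit_T_act res_rel_plus)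
  qed
qed

text \<open>The faces are well defined on the quotients: the counit is compatible with the relations of \<open>U V\<close> because
  they hold in the module \<open>V\<close>, and the other faces follow by functoriality.\<close>

lemma face_res_rel: "i \<le> n \<Longrightarrow> z \<in> res_rel (Suc n) \<Longrightarrow> face i z \<in> res_rel n"
proof (induction i arbitrary: n z)
  case 0
  then show ?case using counit_res_rel by simp
next
  case (Suc i)
  then obtain m where n: "n = Suc m" "i \<le> m" by (cases n) auto
  have "z \<in> U_rel (res_rel (Suc m))" using Suc.prems n by simp
  then have "U_map (face i) z \<in> U_rel (res_rel m)"
  proof (induction rule: U_rel_induct)
    case zero then show ?case by (simp add: U_rel_zero)
  next
    case (nil y)
    then show ?case by (simp add: U_map_add)
  next
    case (add a b v y)
    then show ?case using tens_add_left[of a b "face i (bas v)"] by (simp add: U_map_add T_diff U_rel_plus)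
  next
    case (tens a z y)
    then show ?case using Suc.IH[OF n(2), of z] by (simp add: U_map_add U_map_tens face_add U_rel_plus U_rel_tens)
  next
    case (low a j z p y)
    have "U_map (face i) z \<in> T_deg p" using T_deg_face[OF low(1), of "Suc i"] by simp
    from U_rel_low[OF this low(2)] show ?case using low(3) by (simp add: U_map_add U_map_T_act U_rel_plus)
  qed
  then show ?case by (simp add: n)
qed


section \<open>The complex of homomorphisms out of the resolution\<close>

text \<open>The pairs \<open>(i, j)\<close> with \<open>i < j\<close> cancel against those with \<open>i \<ge> j\<close>.\<close>

lemma simplicial_square_zero:
  fixes a :: "nat \<Rightarrow> nat \<Rightarrow> 'a::ab_group_add"
  assumes d: "\<And>x::'a. x + x = 0" and a: "\<And>i j. i \<le> j \<Longrightarrow> a i (Suc j) = a j i"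
  shows "(\<Sum>j\<le>Suc N. \<Sum>i\<le>N. a i j) = 0"
proof -
  have 1: "(\<Sum>j\<le>Suc N. a i j) = (\<Sum>j\<le>i. a i j) + (\<Sum>j\<in>{i..N}. a j i)" if "i \<le> N" for i
  proof -
    have "{..Suc N} = {..i} \<union> Suc ` {i..N}" using that by (auto simp: image_Suc_atLeastAtMost)
    then have "(\<Sum>j\<le>Suc N. a i j) = (\<Sum>j\<le>i. a i j) + (\<Sum>j\<in>Suc ` {i..N}. a i j)"
      by (simp only:) (rule sum.union_disjoint, auto)
    also have "(\<Sum>j\<in>Suc ` {i..N}. a i j) = (\<Sum>j\<in>{i..N}. a j i)"
      by (subst sum.reindex) (auto intro!: sum.cong a)
    finally show ?thesis .
  qed
  have "(\<Sum>j\<le>Suc N. \<Sum>i\<le>N. a i j) = (\<Sum>i\<le>N. \<Sum>j\<le>Suc N. a i j)" by (rule sum.swap)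
  also have "\<dots> = (\<Sum>i\<le>N. \<Sum>j\<le>i. a i j) + (\<Sum>i\<le>N. \<Sum>j\<in>{i..N}. a j i)"
    by (simp add: 1 sum.distrib del: sum.atMost_Suc)
  also have "(\<Sum>i\<le>N. \<Sum>j\<in>{i..N}. a j i) = (\<Sum>j\<le>N. \<Sum>i\<le>j. a j i)"
  proof -
    have "(\<Sum>i\<le>N. \<Sum>j\<in>{i..N}. a j i) = (\<Sum>i\<le>N. \<Sum>j\<le>N. if i \<le> j then a j i else 0)"
      by (intro sum.cong refl sum.mono_neutral_cong_left) auto
    also have "\<dots> = (\<Sum>j\<le>N. \<Sum>i\<le>N. if i \<le> j then a j i else 0)" by (rule sum.swap)
    also have "\<dots> = (\<Sum>j\<le>N. \<Sum>i\<le>j. a j i)"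
      by (intro sum.cong refl sum.mono_neutral_cong_right) auto
    finally show ?thesis .
  qed
  finally show ?thesis by (simp add: d)
qed

context dl_module
begin

lemma double: "(x::'m) + x = 0"
proof -
  have "act (1 + 1) x = x + x" by (simp add: act_add_left act_one del: dl_double one_add_one)
  moreover have "act 0 x = 0" by (rule additive_zero[of "\<lambda>a. act a x"]) (rule act_add_left)
  ultimately show ?thesis by (simp only: dl_double)
qed

lemma act_zero [simp]: "act 0 x = 0" "act a 0 = 0"
  by (rule additive_zero[of "\<lambda>a. act a x"], rule act_add_left) (rule additive_zero[of "act a"], rule act_add_right)

lemma Ann_B_zero: "0 \<in> Ann_B act n"
  by (simp add: Ann_B_def)

lemma Ann_B_add: "x \<in> Ann_B act n \<Longrightarrow> y \<in> Ann_B act n \<Longrightarrow> x + y \<in> Ann_B act n"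
  by (simp add: Ann_B_def act_add_right)

lemma Hom_res_add: "f \<in> Hom_res act n \<Longrightarrow> f (y + z) = f y + f z"
  by (auto simp: Hom_res_def additive_def)

lemma Hom_res_vanish: "f \<in> Hom_res act n \<Longrightarrow> z \<in> res_rel (Suc n) \<Longrightarrow> f z = 0"
  by (auto simp: Hom_res_def)

lemma Hom_res_act: "f \<in> Hom_res act n \<Longrightarrow> f (T_act a z) = act a (f z)"
  by (auto simp: Hom_res_def)

lemma Hom_resI:
  assumes "\<And>y z. f (y + z) = f y + f z" "\<And>z. z \<in> U_rel (res_rel n) \<Longrightarrow> f z = 0" "\<And>a z. f (T_act a z) = act a (f z)"
  shows "f \<in> Hom_res act n"
  using assms by (simp add: Hom_res_def additive_def)

lemma Hom_res_plus: "f \<in> Hom_res act n \<Longrightarrow> g \<in> Hom_res act n \<Longrightarrow> f + g \<in> Hom_res act n"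
  by (rule Hom_resI) (simp_all add: Hom_res_add Hom_res_vanish Hom_res_act act_add_right algebra_simps)

lemma zero_in_Hom_res: "0 \<in> Hom_res act n"
  by (rule Hom_resI) simp_all

lemma Hom_res_d_in:
  assumes "f \<in> Hom_res act n"
  shows "Hom_res_d n f \<in> Hom_res act (Suc n)"
proof (rule Hom_resI)
  fix a y z
  show "Hom_res_d n f (y + z) = Hom_res_d n f y + Hom_res_d n f z"
    by (simp only: Hom_res_d_def face_add Hom_res_add[OF assms] sum.distrib)
  show "Hom_res_d n f (T_act a z) = act a (Hom_res_d n f z)"
    by (simp only: Hom_res_d_def face_T_act Hom_res_act[OF assms] additive_sum[of "act a", OF act_add_right])
next
  fix z assume "z \<in> U_rel (res_rel (Suc n))"
  then have "z \<in> res_rel (Suc (Suc n))" by simp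
  then show "Hom_res_d n f z = 0"
    unfolding Hom_res_d_def
    by (intro sum.neutral ballI Hom_res_vanish[OF assms] face_res_rel) simp_all
qed

lemma Hom_res_d_add: "Hom_res_d n (f + g) = Hom_res_d n f + (Hom_res_d n g :: T \<Rightarrow> 'm)"
  by (simp add: Hom_res_d_def fun_eq_iff sum.distrib)

lemma Hom_res_d_d: "Hom_res_d (Suc n) (Hom_res_d n f) = (0 :: T \<Rightarrow> 'm)"
proof
  fix z
  have "(\<Sum>j\<le>Suc (Suc n). \<Sum>i\<le>Suc n. f (face i (face j z))) = 0"
    by (rule simplicial_square_zero[OF double]) (simp only: face_face)
  then show "Hom_res_d (Suc n) (Hom_res_d n f) z = 0 z" by (simp only: Hom_res_d_def zero_fun_apply)
qed

end

section \<open>Cells of the resolution\<close>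

abbreviation cell_deg :: "nat list list \<Rightarrow> nat" where
  "cell_deg \<sigma> \<equiv> sum_list (map sum_list \<sigma>)"

text \<open>For an allowable sequence \<open>J\<close> and a class \<open>x\<close> of degree \<open>d\<close>, the element \<open>Q\<^sup>J \<otimes> x\<close> survives in \<open>U V\<close>
  exactly if the excess of \<open>J\<close> exceeds \<open>d\<close>; the empty sequence counts as having infinite excess.\<close>

fun good :: "nat list list \<Rightarrow> bool" where
  "good [] \<longleftrightarrow> True"
| "good (J # \<sigma>) \<longleftrightarrow> good \<sigma> \<and> allowable J \<and> (J = [] \<or> cell_deg \<sigma> + sum_list (tl J) < hd J)"

lemma good_allowable: "good \<sigma> \<Longrightarrow> list_all allowable \<sigma>"
  by (induction \<sigma>) auto

text \<open>The values of homomorphisms on the cells. A homomorphism out of the free object on a class of degree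
  \<open>d\<close> is the choice of an element annihilated by \<open>B(d+1)\<close>.\<close>

definition cochains :: "(dl \<Rightarrow> 'm \<Rightarrow> 'm::ab_group_add) \<Rightarrow> nat \<Rightarrow> (nat list list \<Rightarrow> 'm) set" where
  "cochains act n = {\<nu>. \<forall>\<sigma>. \<nu> \<sigma> \<in> Ann_B act (cell_deg \<sigma> + 1) \<and> (\<nu> \<sigma> \<noteq> 0 \<longrightarrow> good \<sigma> \<and> length \<sigma> = n)}"

fun ext :: "(nat list list \<Rightarrow> 'm::ab_group_add) \<Rightarrow> dl list \<Rightarrow> 'm" where
  "ext \<nu> [] = \<nu> []"
| "ext \<nu> (a # v) = lin (\<lambda>I. ext (\<lambda>\<sigma>. \<nu> (I # \<sigma>)) v) (nf a)"

text \<open>The composites of a cochain with all faces but the first. The last face applies the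
  augmentation to the last entry, so it only sees cells ending in the empty sequence.\<close>

fun inner_faces :: "(nat list list \<Rightarrow> 'm::ab_group_add) \<Rightarrow> nat list list \<Rightarrow> 'm" where
  "inner_faces \<nu> [] = 0"
| "inner_faces \<nu> [J] = (if J = [] then \<nu> [] else 0)"
| "inner_faces \<nu> (J # K # \<sigma>) = lin (\<lambda>I. \<nu> (I # \<sigma>)) (normal_form (J @ K)) + inner_faces (\<lambda>\<rho>. \<nu> (J # \<rho>)) (K # \<sigma>)"

definition to_cochain :: "(T \<Rightarrow> 'm::ab_group_add) \<Rightarrow> nat \<Rightarrow> nat list list \<Rightarrow> 'm" where
  "to_cochain f n \<sigma> = (if list_all allowable \<sigma> \<and> length \<sigma> = n then f (bas (1 # map Qs \<sigma>)) else 0)"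

definition of_cochain :: "(dl \<Rightarrow> 'm \<Rightarrow> 'm::ab_group_add) \<Rightarrow> (nat list list \<Rightarrow> 'm) \<Rightarrow> T \<Rightarrow> 'm" where
  "of_cochain act \<nu> = lin (\<lambda>v. case v of [] \<Rightarrow> 0 | a # w \<Rightarrow> act a (ext \<nu> w))"

lemma lin_zero: "(\<And>x. x \<in> supp z \<Longrightarrow> f x = 0) \<Longrightarrow> lin f z = 0"
  by (simp add: lin_def)

lemma ext_zero: "(\<And>\<sigma>. length \<sigma> = length v \<Longrightarrow> list_all allowable \<sigma> \<Longrightarrow> \<nu> \<sigma> = 0) \<Longrightarrow> ext \<nu> v = 0"
  by (induction v arbitrary: \<nu>) (auto intro!: lin_zero simp: nf_keys_allowable)

lemma ext_cong:
  "(\<And>\<sigma>. length \<sigma> = length v \<Longrightarrow> list_all allowable \<sigma> \<Longrightarrow> \<nu> \<sigma> = \<nu>' \<sigma>) \<Longrightarrow> ext \<nu> v = ext \<nu>' v"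
proof (induction v arbitrary: \<nu> \<nu>')
  case (Cons a v)
  have "ext (\<lambda>\<sigma>. \<nu> (I # \<sigma>)) v = ext (\<lambda>\<sigma>. \<nu>' (I # \<sigma>)) v" if "I \<in> supp (nf a)" for I
    by (rule Cons.IH, rule Cons.prems) (simp_all add: nf_keys_allowable[OF that])
  then show ?case unfolding ext.simps by (rule lin_cong)
qed simp

lemma ext_map_Qs: "list_all allowable \<sigma> \<Longrightarrow> ext \<nu> (map Qs \<sigma>) = \<nu> \<sigma>"
  by (induction \<sigma> arbitrary: \<nu>) (simp_all add: nf_Qs normal_form_allowable)

lemma lin_closed:
  assumes "0 \<in> A" "\<And>x y. x \<in> A \<Longrightarrow> y \<in> A \<Longrightarrow> x + y \<in> A" "\<And>I. I \<in> supp z \<Longrightarrow> g I \<in> A"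
  shows "lin g z \<in> A"
proof -
  have "finite K \<Longrightarrow> (\<And>I. I \<in> K \<Longrightarrow> g I \<in> A) \<Longrightarrow> sum g K \<in> A" for K
    by (induction K rule: finite_induct) (simp_all add: assms(1,2))
  then show ?thesis unfolding lin_def using assms(3) by simp
qed

lemma ext_homogeneous_closed:
  assumes A: "0 \<in> A" "\<And>x y. x \<in> A \<Longrightarrow> y \<in> A \<Longrightarrow> x + y \<in> A"
    and "homogeneous v ps" "\<And>\<sigma>. cell_deg \<sigma> = sum_list ps \<Longrightarrow> \<nu> \<sigma> \<in> A"
  shows "ext \<nu> v \<in> A"
  using assms(3,4)
proof (induction v arbitrary: \<nu> ps)
  case (Cons a v)
  then obtain q qs where ps: "ps = q # qs" "a \<in> dl_deg q" "homogeneous v qs"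
    by (auto simp: list_all2_Cons1)
  have "ext (\<lambda>\<sigma>. \<nu> (I # \<sigma>)) v \<in> A" if "I \<in> supp (nf a)" for I
    by (rule Cons.IH[OF ps(3)]) (use Cons.prems(2) dl_deg_keys[OF ps(2) that] ps(1) in simp)
  then show ?case by (simp add: lin_closed[OF A])
qed simp

lemma homogeneous_cell: "homogeneous (map Qs \<sigma>) (map sum_list \<sigma>)"
  by (simp add: list_all2_conv_all_nth dl_deg_Qs)

lemma T_deg_cell: "bas (map Qs \<sigma>) \<in> T_deg (cell_deg \<sigma>)"
  by (rule T_deg_bas[OF homogeneous_cell])

text \<open>An entry of too small excess begins with some \<open>Q\<^sup>i\<close> that acts on a class of degree at least \<open>i\<close>.\<close>

lemma cell_not_good_in_res_rel:
  "list_all allowable \<sigma> \<Longrightarrow> \<not> good \<sigma> \<Longrightarrow> bas (map Qs \<sigma>) \<in> res_rel (length \<sigma>)"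
proof (induction \<sigma>)
  case (Cons J \<sigma>)
  show ?case
  proof (cases "good \<sigma>")
    case False
    then show ?thesis using Cons U_rel_tens[of "bas (map Qs \<sigma>)" "res_rel (length \<sigma>)" "Qs J"] by simp
  next
    case True
    then have J: "J \<noteq> []" "hd J \<le> cell_deg \<sigma> + sum_list (tl J)" "allowable J" using Cons.prems by auto
    then obtain i K where JK: "J = i # K" by (cases J) auto
    from U_rel_low[OF T_deg_cell, of i "K # \<sigma>" 1] show ?thesis using J JK by (simp add: T_act_one)
  qed
qed simp

definition multilinear :: "(T \<Rightarrow> 'm::ab_group_add) \<Rightarrow> bool" where
  "multilinear h \<longleftrightarrow> (\<forall>y z. h (y + z) = h y + h z) \<and>
     (\<forall>u a b v. h (bas (u @ (a + b) # v)) = h (bas (u @ a # v)) + h (bas (u @ b # v)))"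

lemma multilinear_add: "multilinear h \<Longrightarrow> h (y + z) = h y + h z"
  by (simp add: multilinear_def)

lemma multilinear_tens: "multilinear h \<Longrightarrow> multilinear (\<lambda>z. h (tens a z))"
  unfolding multilinear_def by (auto simp: tens_add) (metis append_Cons)

lemma multilinear_head:
  assumes "multilinear h"
  shows "h (bas (a # v)) = lin (\<lambda>I. h (bas (Qs I # v))) (nf a)"
proof -
  have add: "h (bas ((a + b) # v)) = h (bas (a # v)) + h (bas (b # v))" for a b
    using assms[unfolded multilinear_def] by (metis append_Nil)
  show ?thesis
    using additive_lin[of "\<lambda>a. h (bas (a # v))", OF add, of Qs "nf a"] by (simp add: lin_Qs_nf)
qed

lemma multilinear_expand: "multilinear h \<Longrightarrow> h (bas v) = ext (\<lambda>\<sigma>. h (bas (map Qs \<sigma>))) v"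
proof (induction v arbitrary: h)
  case (Cons a v)
  show ?case
    by (subst multilinear_head[OF Cons.prems]) (use Cons.IH[OF multilinear_tens[OF Cons.prems]] in simp)
qed simp

lemma sum_faces_cell:
  "multilinear h \<Longrightarrow> (\<Sum>i<length \<sigma>. h (face i (bas (map Qs \<sigma>)))) = inner_faces (\<lambda>\<rho>. h (bas (map Qs \<rho>))) \<sigma>"
proof (induction \<sigma> arbitrary: h rule: list.induct)
  case (Cons J \<sigma>)
  have h0: "h 0 = 0" by (rule additive_zero) (rule multilinear_add[OF Cons.prems])
  show ?case
  proof (cases \<sigma>)
    case Nil
    then show ?thesis by (simp add: aug_Qs h0)
  next
    case C: (Cons K \<tau>)
    have "(\<Sum>i<length (J # \<sigma>). h (face i (bas (map Qs (J # \<sigma>)))))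
       = h (bas ((Qs J * Qs K) # map Qs \<tau>)) + (\<Sum>i<length \<sigma>. h (tens (Qs J) (face i (bas (map Qs \<sigma>)))))"
      unfolding list.size(4) add_0_right add_Suc_right plus_1_eq_Suc sum.lessThan_Suc_shift by (simp add: C del: sum.lessThan_Suc)
    also have "h (bas ((Qs J * Qs K) # map Qs \<tau>)) = lin (\<lambda>I. h (bas (map Qs (I # \<tau>)))) (normal_form (J @ K))"
      by (subst multilinear_head[OF Cons.prems]) (simp add: Qs_append[symmetric] nf_Qs)
    also have "(\<Sum>i<length \<sigma>. h (tens (Qs J) (face i (bas (map Qs \<sigma>))))) = inner_faces (\<lambda>\<rho>. h (bas (map Qs (J # \<rho>)))) \<sigma>"
      using Cons.IH[OF multilinear_tens[OF Cons.prems]] by simp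
    finally show ?thesis by (simp add: C)
  qed
qed simp

lemma inner_faces_cong:
  assumes "list_all allowable \<sigma>"
    "\<And>\<rho>. list_all allowable \<rho> \<Longrightarrow> Suc (length \<rho>) = length \<sigma> \<Longrightarrow> \<nu> \<rho> = \<nu>' \<rho>"
  shows "inner_faces \<nu> \<sigma> = inner_faces \<nu>' \<sigma>"
  using assms
proof (induction \<nu> \<sigma> arbitrary: \<nu>' rule: inner_faces.induct)
  case (3 \<nu> J K \<sigma>)
  have "lin (\<lambda>I. \<nu> (I # \<sigma>)) (normal_form (J @ K)) = lin (\<lambda>I. \<nu>' (I # \<sigma>)) (normal_form (J @ K))"
    by (rule lin_cong) (use 3 normal_form_keys(1) in auto)
  moreover have "inner_faces (\<lambda>\<rho>. \<nu> (J # \<rho>)) (K # \<sigma>) = inner_faces (\<lambda>\<rho>. \<nu>' (J # \<rho>)) (K # \<sigma>)"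
    by (rule 3(1)) (use 3 in auto)
  ultimately show ?case by simp
qed auto

context dl_module
begin

lemma multilinear_Hom_res:
  assumes "f \<in> Hom_res act n"
  shows "multilinear (\<lambda>z. f (tens 1 z))"
  unfolding multilinear_def
proof (intro conjI allI)
  note add = Hom_res_add[OF assms]
  fix y z u a b v
  show "f (tens 1 (y + z)) = f (tens 1 y) + f (tens 1 z)" by (simp add: tens_add add)
  have "f (tens 1 (bas (u @ (a + b) # v) - bas (u @ a # v) - bas (u @ b # v))) = 0"
    by (rule Hom_res_vanish[OF assms]) (simp only: funpow.simps o_apply, rule U_rel_tens[OF res_rel_add])
  then show "f (tens 1 (bas (u @ (a + b) # v))) = f (tens 1 (bas (u @ a # v))) + f (tens 1 (bas (u @ b # v)))"
    by (simp only: double_minus(2)[OF pm2_double] tens_add add double_eqI[OF double] add.assoc)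
qed

lemma Hom_res_bas:
  assumes "f \<in> Hom_res act n"
  shows "f (bas (a # v)) = act a (ext (to_cochain f n) v)"
proof -
  have "f (bas (a # v)) = act a (f (tens 1 (bas v)))"
    using Hom_res_act[OF assms, of a "bas (1 # v)"] by simp
  also have "f (tens 1 (bas v)) = ext (to_cochain f n) v"
  proof (cases "length v = n")
    case False
    then have "f (tens 1 (bas v)) = 0"
      by (intro Hom_res_vanish[OF assms]) (simp only: funpow.simps o_apply, rule U_rel_tens[OF res_rel_length])
    moreover have "ext (to_cochain f n) v = 0" by (rule ext_zero) (use False in \<open>simp add: to_cochain_def\<close>)
    ultimately show ?thesis by simp
  next
    case True
    have "f (tens 1 (bas v)) = ext (\<lambda>\<sigma>. f (tens 1 (bas (map Qs \<sigma>)))) v"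
      by (rule multilinear_expand[OF multilinear_Hom_res[OF assms]])
    also have "\<dots> = ext (to_cochain f n) v" by (rule ext_cong) (simp add: to_cochain_def True)
    finally show ?thesis .
  qed
  finally show ?thesis .
qed

lemma of_to_cochain:
  assumes "f \<in> Hom_res act n"
  shows "of_cochain act (to_cochain f n) = f"
proof
  fix z
  have "f (bas v) = (case v of [] \<Rightarrow> 0 | a # w \<Rightarrow> act a (ext (to_cochain f n) w))" for v
  proof (cases v)
    case Nil
    have "f (bas []) = 0" by (rule Hom_res_vanish[OF assms]) (simp add: U_rel_nil)
    then show ?thesis using Nil by simp
  qed (simp add: Hom_res_bas[OF assms])
  then show "of_cochain act (to_cochain f n) z = f z"
    unfolding of_cochain_def by (subst additive_eq_lin[of f, OF Hom_res_add[OF assms]]) simp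
qed

lemma to_cochain_in:
  assumes "f \<in> Hom_res act n"
  shows "to_cochain f n \<in> cochains act n"
  unfolding cochains_def mem_Collect_eq
proof (intro allI conjI impI)
  fix \<sigma>
  show "to_cochain f n \<sigma> \<in> Ann_B act (cell_deg \<sigma> + 1)"
    unfolding Ann_B_def mem_Collect_eq
  proof
    fix b assume "b \<in> ideal_B (cell_deg \<sigma> + 1)"
    with dl_double show "act b (to_cochain f n \<sigma>) = 0"
      unfolding ideal_B_def
    proof (induction rule: span2_induct)
      case (step x y)
      then obtain I where I: "x = Qs I" "I \<noteq> []" "excess I < int (cell_deg \<sigma> + 1)" by blast
      then obtain i K where IK: "I = i # K" by (cases I) auto
      have "act x (to_cochain f n \<sigma>) = 0"
      proof (cases "list_all allowable \<sigma> \<and> length \<sigma> = n")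
        case True
        from U_rel_low[OF T_deg_cell, of i "K # \<sigma>" 1 "res_rel n"] have "bas (x # map Qs \<sigma>) \<in> res_rel (Suc n)"
          using I IK by (simp add: T_act_one excess_def)
        then have "f (T_act x (bas (1 # map Qs \<sigma>))) = 0" by (simp only: T_act_bas mult_1_right Hom_res_vanish[OF assms])
        then show ?thesis using True by (simp add: Hom_res_act[OF assms] to_cochain_def del: T_act_bas)
      qed (auto simp: to_cochain_def)
      then show ?case using step(2) by (simp add: act_add_left)
    qed simp
  qed
next
  fix \<sigma> assume nz: "to_cochain f n \<sigma> \<noteq> 0"
  then have \<sigma>: "list_all allowable \<sigma>" "length \<sigma> = n" by (auto simp: to_cochain_def split: if_splits)
  show "length \<sigma> = n" by (rule \<sigma>(2))
  show "good \<sigma>"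
  proof (rule ccontr)
    assume "\<not> good \<sigma>"
    from cell_not_good_in_res_rel[OF \<sigma>(1) this] have "tens 1 (bas (map Qs \<sigma>)) \<in> res_rel (Suc n)"
      using \<sigma>(2) by (simp only: funpow.simps o_apply) (rule U_rel_tens)
    then have "f (tens 1 (bas (map Qs \<sigma>))) = 0" by (rule Hom_res_vanish[OF assms])
    then show False using nz \<sigma> by (simp add: to_cochain_def)
  qed
qed

text \<open>The multilinear extension respects the relations of the iterated free object. The essential case is a
  relation \<open>Q\<^sup>i y\<close> with \<open>i \<le> deg y\<close>: all allowable sequences in the normal form of the leftmost entry
  have small excess, so only cells that are not good occur.\<close>

lemma lin_ext_vanish:
  fixes \<nu> :: "nat list list \<Rightarrow> 'm"
  assumes "\<And>\<sigma>. \<nu> \<sigma> \<noteq> 0 \<Longrightarrow> good \<sigma> \<and> length \<sigma> = n" "z \<in> res_rel n"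
  shows "lin (ext \<nu>) z = 0"
  using assms
proof (induction n arbitrary: \<nu> z)
  case 0
  have "z \<in> span2 {bas v | v. v \<noteq> []}" using 0 by (simp add: F2_rel_def)
  then show ?case
  proof (rule additive_span2_zero[of "lin (ext \<nu>)", rotated 2])
    show "lin (ext \<nu>) (y + z) = lin (ext \<nu>) y + lin (ext \<nu>) z" for y z by (rule lin_add[OF double])
    fix x :: T assume "x \<in> {bas v | v. v \<noteq> []}"
    then obtain v where v: "x = bas v" "v \<noteq> []" by blast
    have "ext \<nu> v = 0" by (rule ext_zero) (use 0(1) v in fastforce)
    then show "lin (ext \<nu>) x = 0" by (simp add: v)
  qed
next
  case (Suc n)
  note add = lin_add[OF double, of "ext \<nu>"]
  have tens: "lin (ext \<nu>) (tens a z) = lin (\<lambda>I. lin (ext (\<lambda>\<sigma>. \<nu> (I # \<sigma>))) z) (nf a)" for a z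
  proof (induction z rule: pm2_induct)
    case (step v z)
    then show ?case by (simp add: tens_add add lin_add[OF double] lin_add_fun)
  qed (simp add: lin_def)
  from Suc.prems(2) have "z \<in> U_rel (res_rel n)" by simp
  then show ?case
  proof (induction rule: U_rel_induct)
    case zero then show ?case by simp
  next
    case (nil y)
    have "\<nu> [] = 0" using Suc.prems(1)[of "[]"] by auto
    then show ?case using nil by (simp add: add)
  next
    case (add a b v y)
    then show ?case
      by (simp add: lin_add[OF double] double_minus(2)[OF pm2_double] nf_add double add.assoc)
  next
    case (tens a z y)
    have "lin (ext (\<lambda>\<sigma>. \<nu> (I # \<sigma>))) z = 0" for I
      by (rule Suc.IH[OF _ tens(1)]) (use Suc.prems(1) in fastforce)
    then show ?case using tens by (simp add: lin_add[OF double] \<open>\<And>a z. lin (ext \<nu>) (tens a z) = _ a z\<close> lin_zero)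
  next
    case (low a i z p y)
    have "lin (ext \<nu>) (T_act a (T_act (Q i) z)) = 0"
      using low(1)
    proof (induction rule: T_deg_induct)
      case zero then show ?case by simp
    next
      case (step v ps y)
      have "lin (ext \<nu>) (T_act a (T_act (Q i) (bas v))) = 0"
      proof (cases v)
        case Nil
        then show ?thesis by simp
      next
        case (Cons b w)
        then obtain q qs where ps: "ps = q # qs" "b \<in> dl_deg q" "homogeneous w qs"
          using step(1) by (auto simp: list_all2_Cons1)
        have "ext (\<lambda>\<sigma>. \<nu> (I # \<sigma>)) w \<in> {0}" if I: "I \<in> supp (nf (a * (Q i * b)))" for I
        proof (rule ext_homogeneous_closed[OF _ _ ps(3)])
          fix \<sigma> assume d: "cell_deg \<sigma> = sum_list qs"
          have "i \<le> sum_list qs + q" using low(2) step(2) ps(1) by simp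
          from nf_low_excess[OF ps(2) this I] have "\<not> good (I # \<sigma>)" using d by auto
          then show "\<nu> (I # \<sigma>) \<in> {0}" using Suc.prems(1) by blast
        qed simp_all
        then show ?thesis by (simp add: Cons lin_zero)
      qed
      then show ?case using step(3) by (simp add: T_act_add lin_add[OF double])
    qed
    then show ?case using low by (simp add: lin_add[OF double])
  qed
qed

end

context dl_module
begin

lemma cochains_Ann: "\<nu> \<in> cochains act n \<Longrightarrow> \<nu> \<sigma> \<in> Ann_B act (cell_deg \<sigma> + 1)"
  by (simp add: cochains_def)

text \<open>The first entry of a list is acted out on \<open>M\<close>; there the relations hold because the values of the
  cochain are annihilated by the appropriate ideal.\<close>

lemma of_cochain_in:
  assumes \<nu>: "\<nu> \<in> cochains act n"
  shows "of_cochain act \<nu> \<in> Hom_res act n"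
proof (rule Hom_resI)
  let ?f = "of_cochain act \<nu>"
  show add: "?f (y + z) = ?f y + ?f z" for y z unfolding of_cochain_def by (rule lin_add[OF double])
  have 0: "?f 0 = 0" by (simp add: of_cochain_def)
  have bas: "?f (bas []) = 0" "?f (bas (a # w)) = act a (ext \<nu> w)" for a w by (simp_all add: of_cochain_def)
  show act: "?f (T_act a z) = act a (?f z)" for a z
  proof (induction z rule: T_induct)
    case (nil y)
    then show ?case by (simp add: T_act_add add act_add_right scale2_additive[of ?f, OF 0] bas)
  next
    case (step b w y)
    then show ?case by (simp add: T_act_add add act_add_right bas act_mult)
  qed (simp add: 0)
  have tens: "?f (tens a z) = act a (lin (ext \<nu>) z)" for a z
    by (induction z rule: pm2_induct) (simp_all add: 0 tens_add add bas lin_add[OF double] act_add_right)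
  fix z assume "z \<in> U_rel (res_rel n)"
  then show "?f z = 0"
  proof (induction rule: U_rel_induct)
    case zero then show ?case by (rule 0)
  next
    case (nil y)
    then show ?case by (simp add: add bas)
  next
    case (add a b v y)
    have "?f (bas ((a + b) # v) - bas (a # v) - bas (b # v)) = 0"
      using double[of "act a (ext \<nu> v) + act b (ext \<nu> v)"]
      by (simp add: double_minus(2)[OF pm2_double] \<open>\<And>y z. ?f (y + z) = ?f y + ?f z\<close> bas act_add_left add.assoc)
    then show ?case using add by (simp only: \<open>\<And>y z. ?f (y + z) = ?f y + ?f z\<close> add_0_right)
  next
    case (tens a z y)
    have "lin (ext \<nu>) z = 0" by (rule lin_ext_vanish[OF _ tens(1)]) (use \<nu> in \<open>auto simp: cochains_def\<close>)
    then show ?case using tens(2) by (simp add: add \<open>\<And>a z. ?f (tens a z) = act a (lin (ext \<nu>) z)\<close>)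
  next
    case (low a i z p y)
    have "?f (T_act (Q i) z) = 0"
      using low(1)
    proof (induction rule: T_deg_induct)
      case zero then show ?case by (simp add: 0)
    next
      case (step v ps y)
      have "?f (T_act (Q i) (bas v)) = 0"
      proof (cases v)
        case Nil
        then show ?thesis by (simp add: 0)
      next
        case (Cons b w)
        then obtain q qs where ps: "ps = q # qs" "b \<in> dl_deg q" "homogeneous w qs"
          using step(1) by (auto simp: list_all2_Cons1)
        have "ext \<nu> w \<in> Ann_B act (sum_list qs + 1)"
          by (rule ext_homogeneous_closed[OF Ann_B_zero Ann_B_add ps(3)]) (simp_all, metis Suc_eq_plus1 cochains_Ann[OF \<nu>])
        moreover have "Q i * b \<in> ideal_B (sum_list qs + 1)"
          by (rule Q_mult_ideal_B[OF ps(2)]) (use low(2) step(2) ps(1) in simp)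
        ultimately show ?thesis by (simp add: Cons bas Ann_B_def)
      qed
      then show ?case using step(3) by (simp add: T_act_add add)
    qed
    then show ?case using low(3) by (simp add: add act)
  qed
qed

lemma to_of_cochain:
  assumes "\<nu> \<in> cochains act n"
  shows "to_cochain (of_cochain act \<nu>) n = \<nu>"
proof
  fix \<sigma>
  have "list_all allowable \<sigma> \<and> length \<sigma> = n" if "\<nu> \<sigma> \<noteq> 0"
    using assms that good_allowable by (auto simp: cochains_def)
  then show "to_cochain (of_cochain act \<nu>) n \<sigma> = \<nu> \<sigma>"
    by (auto simp: to_cochain_def of_cochain_def ext_map_Qs act_one)
qed

definition coboundary :: "(nat list list \<Rightarrow> 'm) \<Rightarrow> nat list list \<Rightarrow> 'm" where
  "coboundary \<nu> \<sigma> = act (Qs (hd \<sigma>)) (\<nu> (tl \<sigma>)) + inner_faces \<nu> \<sigma>"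

text \<open>Transported to cells, the differential consists of the action of the first entry and of the
  remaining faces.\<close>

lemma to_cochain_d:
  assumes f: "f \<in> Hom_res act n" and \<sigma>: "list_all allowable \<sigma>" "length \<sigma> = Suc n"
  shows "to_cochain (Hom_res_d n f) (Suc n) \<sigma> = coboundary (to_cochain f n) \<sigma>"
proof -
  obtain J \<rho> where J: "\<sigma> = J # \<rho>" using \<sigma>(2) by (cases \<sigma>) auto
  have "to_cochain (Hom_res_d n f) (Suc n) \<sigma> = (\<Sum>i<Suc (Suc n). f (face i (bas (1 # map Qs \<sigma>))))"
    using \<sigma> by (simp add: to_cochain_def Hom_res_d_def lessThan_Suc_atMost del: sum.lessThan_Suc sum.atMost_Suc)
  also have "\<dots> = f (face 0 (bas (1 # map Qs \<sigma>))) + (\<Sum>i<length \<sigma>. f (face (Suc i) (bas (1 # map Qs \<sigma>))))"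
    unfolding \<sigma>(2) by (rule sum.lessThan_Suc_shift)
  also have "f (face 0 (bas (1 # map Qs \<sigma>))) = act (Qs J) (to_cochain f n \<rho>)"
    using Hom_res_act[OF f, of "Qs J" "bas (1 # map Qs \<rho>)"] \<sigma> J by (simp add: to_cochain_def)
  also have "(\<Sum>i<length \<sigma>. f (face (Suc i) (bas (1 # map Qs \<sigma>)))) = (\<Sum>i<length \<sigma>. f (tens 1 (face i (bas (map Qs \<sigma>)))))"
    by simp
  also have "\<dots> = inner_faces (\<lambda>\<rho>. f (tens 1 (bas (map Qs \<rho>)))) \<sigma>"
    by (rule sum_faces_cell[OF multilinear_Hom_res[OF f]])
  also have "\<dots> = inner_faces (to_cochain f n) \<sigma>"
    by (rule inner_faces_cong[OF \<sigma>(1)]) (simp add: to_cochain_def \<sigma>(2))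
  finally show ?thesis by (simp add: coboundary_def J)
qed

lemma to_cochain_plus: "to_cochain (f + g) n = to_cochain f n + (to_cochain g n :: _ \<Rightarrow> 'm)"
  by (rule ext) (simp add: to_cochain_def)

lemma inner_faces_plus: "inner_faces (\<lambda>\<rho>. \<nu> \<rho> + \<mu> \<rho>) \<sigma> = inner_faces \<nu> \<sigma> + (inner_faces \<mu> \<sigma> :: 'm)"
proof (induction \<nu> \<sigma> arbitrary: \<mu> rule: inner_faces.induct)
  case (3 \<nu> J K \<sigma>)
  show ?case using 3[of "\<lambda>\<rho>. \<mu> (J # \<rho>)"] by (simp add: lin_add_fun add.assoc add.left_commute)
qed simp_all

lemma coboundary_plus: "coboundary (\<lambda>\<rho>. \<nu> \<rho> + \<mu> \<rho>) \<sigma> = coboundary \<nu> \<sigma> + coboundary \<mu> \<sigma>"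
  by (simp add: coboundary_def inner_faces_plus act_add_right algebra_simps)

end


section \<open>A matching on the cells\<close>

text \<open>The cells are read from the left while they consist of single letters forming a critical word. An
  upper cell is one where this stops in front of an entry that can be merged with the letter before
  it, or at a run of empty sequences of even length. Removing one empty sequence is the merge in the
  latter case: the boundary contains it once for each of the odd number of faces touching the run.\<close>

fun upper :: "nat list list \<Rightarrow> bool" where
  "upper [] \<longleftrightarrow> False"
| "upper ([] # \<sigma>) \<longleftrightarrow> \<sigma> \<noteq> [] \<and> hd \<sigma> = [] \<and> \<not> upper \<sigma>"
| "upper [[i]] \<longleftrightarrow> False"
| "upper ([i] # K # \<tau>) \<longleftrightarrow> (K \<noteq> [] \<and> i \<le> 2 * hd K) \<or> upper (K # \<tau>)"
| "upper ((i # j # J) # \<sigma>) \<longleftrightarrow> False"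

text \<open>Here the reading stops at an entry with more than one letter, whose first letter can be split off,
  or at a run of empty sequences of odd length. Cells where it does not stop at all are the critical
  words; they are neither upper nor lower.\<close>

fun lower :: "nat list list \<Rightarrow> bool" where
  "lower [] \<longleftrightarrow> False"
| "lower ([] # \<sigma>) \<longleftrightarrow> \<not> upper ([] # \<sigma>)"
| "lower [[i]] \<longleftrightarrow> False"
| "lower ([i] # K # \<tau>) \<longleftrightarrow> \<not> (K \<noteq> [] \<and> i \<le> 2 * hd K) \<and> lower (K # \<tau>)"
| "lower ((i # j # J) # \<sigma>) \<longleftrightarrow> True"

fun merge :: "nat list list \<Rightarrow> nat list list" where
  "merge ([] # \<sigma>) = \<sigma>"
| "merge ([i] # K # \<tau>) = (if K \<noteq> [] \<and> i \<le> 2 * hd K then (i # K) # \<tau> else [i] # merge (K # \<tau>))"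
| "merge \<sigma> = \<sigma>"

fun split_cell :: "nat list list \<Rightarrow> nat list list" where
  "split_cell ([] # \<sigma>) = [] # [] # \<sigma>"
| "split_cell ([i] # K # \<tau>) = [i] # split_cell (K # \<tau>)"
| "split_cell ((i # j # J) # \<sigma>) = [i] # (j # J) # \<sigma>"
| "split_cell \<sigma> = \<sigma>"

lemma lower_not_upper: "lower \<sigma> \<Longrightarrow> \<not> upper \<sigma>"
  by (induction \<sigma> rule: lower.induct) auto

lemma upper_letter: "upper \<rho> \<Longrightarrow> upper ([i] # \<rho>)"
  by (cases \<rho>) auto

lemma allowable_Cons: "allowable (i # J) \<longleftrightarrow> (J = [] \<or> i \<le> 2 * hd J) \<and> allowable J"
  by (cases J) auto

lemma upper_merge_head:
  "upper \<sigma> \<Longrightarrow> \<exists>J \<rho>. merge \<sigma> = J # \<rho> \<and> (J = [] \<longleftrightarrow> hd \<sigma> = []) \<and> (J \<noteq> [] \<longrightarrow> hd J = hd (hd \<sigma>))"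
  by (induction \<sigma> rule: upper.induct) (auto simp: neq_Nil_conv)

lemma merge_cell:
  "upper \<sigma> \<Longrightarrow> concat (merge \<sigma>) = concat \<sigma> \<and> cell_deg (merge \<sigma>) = cell_deg \<sigma> \<and> length \<sigma> = Suc (length (merge \<sigma>))
    \<and> lower (merge \<sigma>) \<and> split_cell (merge \<sigma>) = \<sigma>"
proof (induction \<sigma> rule: upper.induct)
  case (2 \<sigma>)
  then obtain \<sigma>' where "\<sigma> = [] # \<sigma>'" by (cases \<sigma>) auto
  then show ?case using 2(2) by simp
next
  case (4 i K \<tau>)
  show ?case
  proof (cases "K \<noteq> [] \<and> i \<le> 2 * hd K")
    case True
    then obtain k L where "K = k # L" by (cases K) auto
    then show ?thesis using True by auto
  next
    case False
    then have u: "upper (K # \<tau>)" using 4(2) by auto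
    obtain J \<rho> where J: "merge (K # \<tau>) = J # \<rho>" "(J = [] \<longleftrightarrow> K = [])" "J \<noteq> [] \<Longrightarrow> hd J = hd K"
      using upper_merge_head[OF u] by auto
    have m: "merge ([i] # K # \<tau>) = [i] # J # \<rho>" using False by (simp add: J(1))
    have IH: "concat (J # \<rho>) = concat (K # \<tau>)" "cell_deg (J # \<rho>) = cell_deg (K # \<tau>)" "length (K # \<tau>) = Suc (length (J # \<rho>))"
      "lower (J # \<rho>)" "split_cell (J # \<rho>) = K # \<tau>" using 4(1)[OF u] J(1) by simp_all
    show ?thesis unfolding m using IH J(2,3) False by auto
  qed
qed auto

text \<open>Merging and splitting preserve goodness because an allowable sequence \<open>i # J\<close> with non-empty \<open>J\<close> satisfies
  \<open>i \<le> 2 * hd J\<close>, so that its excess is at most that of \<open>J\<close>.\<close>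

lemma merge_good: "upper \<sigma> \<Longrightarrow> good \<sigma> \<Longrightarrow> good (merge \<sigma>)"
proof (induction \<sigma> rule: upper.induct)
  case (4 i K \<tau>)
  show ?case
  proof (cases "K \<noteq> [] \<and> i \<le> 2 * hd K")
    case True
    then show ?thesis using 4 by (auto simp: allowable_Cons)
  next
    case False
    then have u: "upper (K # \<tau>)" using 4(2) by auto
    then have "good (merge (K # \<tau>))" using 4 by simp
    moreover have "cell_deg (merge (K # \<tau>)) = cell_deg (K # \<tau>)" using merge_cell[OF u] by simp
    ultimately show ?thesis using False u 4(3) by auto
  qed
qed auto

lemma lower_split_head:
  "lower \<sigma> \<Longrightarrow> \<exists>J \<rho>. split_cell \<sigma> = J # \<rho> \<and> (J = [] \<longleftrightarrow> hd \<sigma> = []) \<and> (J \<noteq> [] \<longrightarrow> hd J = hd (hd \<sigma>))"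
  by (induction \<sigma> rule: lower.induct) auto

lemma split_cell_cell:
  "lower \<sigma> \<Longrightarrow> good \<sigma> \<Longrightarrow> upper (split_cell \<sigma>) \<and> merge (split_cell \<sigma>) = \<sigma> \<and> good (split_cell \<sigma>)
     \<and> cell_deg (split_cell \<sigma>) = cell_deg \<sigma> \<and> length (split_cell \<sigma>) = Suc (length \<sigma>) \<and> concat (split_cell \<sigma>) = concat \<sigma>"
proof (induction \<sigma> rule: lower.induct)
  case (4 i K \<tau>)
  then have l: "lower (K # \<tau>)" "\<not> (K \<noteq> [] \<and> i \<le> 2 * hd K)" by auto
  obtain J \<rho> where J: "split_cell (K # \<tau>) = J # \<rho>" "(J = [] \<longleftrightarrow> K = [])" "J \<noteq> [] \<Longrightarrow> hd J = hd K"
    using lower_split_head[OF l(1)] by auto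
  have s: "split_cell ([i] # K # \<tau>) = [i] # J # \<rho>" by (simp add: J(1))
  have IH: "upper (J # \<rho>)" "merge (J # \<rho>) = K # \<tau>" "good (J # \<rho>)" "cell_deg (J # \<rho>) = cell_deg (K # \<tau>)"
    "length (J # \<rho>) = Suc (length (K # \<tau>))" "concat (J # \<rho>) = concat (K # \<tau>)"
    using 4(1)[OF l(1)] 4(3) J(1) by simp_all
  show ?case unfolding s using IH J(2,3) l(2) 4(3) by auto
qed auto

lemma inner_faces_zero: "(\<And>\<rho>. \<nu> \<rho> = 0) \<Longrightarrow> inner_faces \<nu> \<sigma> = 0"
  by (induction \<nu> \<sigma> rule: inner_faces.induct) (simp_all add: lin_zero)

lemma inner_faces_nonempty:
  assumes "J \<noteq> []" "\<And>I \<rho>. I \<noteq> [] \<Longrightarrow> \<nu> (I # \<rho>) = 0"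
  shows "inner_faces \<nu> (J # \<sigma>) = 0"
proof (cases \<sigma>)
  case (Cons K \<tau>)
  have "\<nu> (I # \<tau>) = 0" if "I \<in> supp (normal_form (J @ K))" for I
    using assms normal_form_keys(2)[OF that] by (cases I) auto
  then show ?thesis using Cons assms by (simp add: lin_zero inner_faces_zero)
qed (use assms in simp)

text \<open>Apart from the face to the left of the run, an even number of faces shorten an even run by one, and they
  cancel. All other faces leave the run as it is and hence end in upper cells.\<close>

lemma inner_faces_empty_run:
  assumes d: "\<And>x::'m::ab_group_add. x + x = 0"
  shows "upper ([] # \<sigma>) \<Longrightarrow> list_all allowable \<sigma> \<Longrightarrow> (\<And>\<rho>. upper \<rho> \<Longrightarrow> \<nu> \<rho> = (0::'m)) \<Longrightarrow> inner_faces \<nu> ([] # \<sigma>) = 0"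
proof (induction "length \<sigma>" arbitrary: \<sigma> \<nu> rule: less_induct)
  case less
  obtain \<tau> where \<sigma>: "\<sigma> = [] # \<tau>" using less.prems(1) by (cases \<sigma>) auto
  show ?case
  proof (cases \<tau>)
    case Nil
    then show ?thesis by (simp add: \<sigma> normal_form_allowable d)
  next
    case (Cons K \<tau>')
    have K: "allowable K" using less.prems(2) \<sigma> Cons by simp
    have eq: "inner_faces \<nu> ([] # \<sigma>) = \<nu> ([] # K # \<tau>') + (\<nu> ([] # K # \<tau>') + inner_faces (\<lambda>\<rho>. \<nu> ([] # [] # \<rho>)) (K # \<tau>'))"
      using K by (simp add: \<sigma> Cons normal_form_allowable)
    have "inner_faces (\<lambda>\<rho>. \<nu> ([] # [] # \<rho>)) (K # \<tau>') = 0"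
    proof (cases "K = []")
      case False
      show ?thesis by (rule inner_faces_nonempty[OF False]) (rule less.prems(3), simp)
    next
      case True
      show ?thesis unfolding True
      proof (rule less.hyps)
        show "upper ([] # \<tau>')" using less.prems(1) \<sigma> Cons True by simp
        fix \<rho> assume "upper \<rho>"
        then have "upper ([] # [] # \<rho>)" by simp
        then show "\<nu> ([] # [] # \<rho>) = 0" by (rule less.prems(3))
      qed (use less.prems(2) \<sigma> Cons in simp_all)
    qed
    then show ?thesis unfolding eq using d by (simp add: add.assoc[symmetric])
  qed
qed

text \<open>Faces to the right of the entry to be merged do not change the reading of the cell and give upper
  cells; faces to the left of it multiply two letters of a critical word, which rewrites to words of
  smaller weight, and likewise for any other product that is not allowable.\<close>

lemma inner_faces_upper:
  assumes d: "\<And>x::'m::ab_group_add. x + x = 0"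
  shows "upper \<sigma> \<Longrightarrow> list_all allowable \<sigma> \<Longrightarrow> (\<And>\<rho>. upper \<rho> \<Longrightarrow> \<nu> \<rho> = (0::'m)) \<Longrightarrow>
    (\<And>\<rho>. length (concat \<rho>) = length (concat \<sigma>) \<Longrightarrow> wl (concat \<rho>) < wl (concat \<sigma>) \<Longrightarrow> \<nu> \<rho> = 0) \<Longrightarrow>
    inner_faces \<nu> \<sigma> = (if hd \<sigma> = [] then 0 else \<nu> (merge \<sigma>))"
proof (induction \<sigma> arbitrary: \<nu> rule: upper.induct)
  case (2 \<sigma>)
  then show ?case using inner_faces_empty_run[OF d, of \<sigma> \<nu>] by simp
next
  case (4 i K \<tau>)
  let ?\<mu> = "\<lambda>\<rho>. \<nu> ([i] # \<rho>)"
  have K: "allowable K" "list_all allowable \<tau>" using 4(3) by simp_all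
  have up: "?\<mu> \<rho> = 0" if "upper \<rho>" for \<rho> by (rule 4(4)) (rule upper_letter[OF that])
  have smaller: "?\<mu> \<rho> = 0" if "length (concat \<rho>) = length (concat (K # \<tau>))" "wl (concat \<rho>) < wl (concat (K # \<tau>))" for \<rho>
    by (rule 4(5)) (use that in simp_all)
  show ?case
  proof (cases "K \<noteq> [] \<and> i \<le> 2 * hd K")
    case True
    have "inner_faces ?\<mu> (K # \<tau>) = 0"
    proof (cases \<tau>)
      case (Cons L \<tau>')
      have "?\<mu> (I # \<tau>') = 0" if I: "I \<in> supp (normal_form (K @ L))" for I
      proof (cases "allowable (K @ L)")
        case allow: True
        then have "I = K @ L" using I by (simp add: normal_form_allowable)
        then show ?thesis using True by (intro 4(4)) simp
      next
        case False
        have "wl (I @ concat \<tau>') < wl ((K @ L) @ concat \<tau>')"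
          by (rule wl_append_right_less) (use normal_form_keys[OF I] False in simp_all)
        then show ?thesis using normal_form_keys(2)[OF I] Cons by (intro smaller) simp_all
      qed
      moreover have "\<nu> ([i] # K # \<rho>) = 0" for \<rho> using True by (intro 4(4)) simp
      ultimately show ?thesis by (simp add: Cons lin_zero inner_faces_zero)
    qed (use True in simp)
    moreover have "normal_form (i # K) = bas (i # K)" using True K by (intro normal_form_allowable) (simp add: allowable_Cons)
    ultimately show ?thesis using True by simp
  next
    case False
    then have u: "upper (K # \<tau>)" using 4(2) by auto
    have IH: "inner_faces ?\<mu> (K # \<tau>) = (if K = [] then 0 else ?\<mu> (merge (K # \<tau>)))"
      using 4(1)[OF u _ up smaller] 4(3) by simp
    show ?thesis
    proof (cases "K = []")
      case True
      then show ?thesis using IH by (simp add: normal_form_allowable)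
    next
      case ne: False
      have "\<nu> (I # \<tau>) = 0" if I: "I \<in> supp (normal_form (i # K))" for I
      proof -
        have na: "\<not> allowable (i # K)" using False ne by (simp add: allowable_Cons)
        have "wl (I @ concat \<tau>) < wl ((i # K) @ concat \<tau>)"
          by (rule wl_append_right_less) (use normal_form_keys[OF I] na in simp_all)
        then show ?thesis using normal_form_keys(2)[OF I] by (intro 4(5)) simp_all
      qed
      then show ?thesis using IH ne False by (simp add: lin_zero)
    qed
  qed
qed simp_all

context dl_module
begin

lemma coboundary_upper:
  assumes "upper \<sigma>" "list_all allowable \<sigma>" "\<And>\<rho>. upper \<rho> \<Longrightarrow> \<nu> \<rho> = 0"
    "\<And>\<rho>. wl (concat \<rho>) < wl (concat \<sigma>) \<Longrightarrow> \<nu> \<rho> = 0"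
  shows "coboundary \<nu> \<sigma> = \<nu> (merge \<sigma>)"
proof -
  have inner: "inner_faces \<nu> \<sigma> = (if hd \<sigma> = [] then 0 else \<nu> (merge \<sigma>))"
    by (rule inner_faces_upper[OF double assms(1,2)]) (use assms(3,4) in auto)
  obtain J \<tau> where \<sigma>: "\<sigma> = J # \<tau>" using assms(1) by (cases \<sigma>) auto
  show ?thesis
  proof (cases J)
    case Nil
    then show ?thesis using inner \<sigma> by (simp add: coboundary_def act_one)
  next
    case (Cons i K)
    then have "K = []" using assms(1) \<sigma> by (cases K) auto
    then have "\<nu> \<tau> = 0" using \<sigma> Cons by (intro assms(4)) simp
    then show ?thesis using inner \<sigma> Cons by (simp add: coboundary_def)
  qed
qed

text \<open>Solves \<open>coboundary \<gamma> = \<nu>\<close> on the upper cells by recursion on the weight of the underlying word: stage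
  \<open>k\<close> has determined \<open>\<gamma>\<close> on the lower cells of weight less than \<open>k\<close> and is zero elsewhere.\<close>

primrec matching_approx :: "(nat list list \<Rightarrow> 'm) \<Rightarrow> nat \<Rightarrow> nat \<Rightarrow> nat list list \<Rightarrow> 'm" where
  "matching_approx \<nu> n 0 = (\<lambda>\<tau>. 0)"
| "matching_approx \<nu> n (Suc k) = (\<lambda>\<tau>. if wl (concat \<tau>) < k then matching_approx \<nu> n k \<tau>
     else if wl (concat \<tau>) = k \<and> good \<tau> \<and> lower \<tau> \<and> length \<tau> = n
     then \<nu> (split_cell \<tau>) + coboundary (matching_approx \<nu> n k) (split_cell \<tau>) else 0)"

definition matching_solution :: "(nat list list \<Rightarrow> 'm) \<Rightarrow> nat \<Rightarrow> nat list list \<Rightarrow> 'm" where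
  "matching_solution \<nu> n \<tau> = matching_approx \<nu> n (Suc (wl (concat \<tau>))) \<tau>"

lemma matching_approx_eq:
  "matching_approx \<nu> n k = (\<lambda>\<tau>. if wl (concat \<tau>) < k then matching_solution \<nu> n \<tau> else 0)"
proof (induction k)
  case (Suc k)
  show ?case
  proof
    fix \<tau>
    show "matching_approx \<nu> n (Suc k) \<tau> = (if wl (concat \<tau>) < Suc k then matching_solution \<nu> n \<tau> else 0)"
    proof (cases "wl (concat \<tau>) = k")
      case True
      then show ?thesis by (simp only: matching_solution_def) simp
    next
      case False
      then show ?thesis using Suc by simp
    qed
  qed
qed simp

lemma matching_approx_in:
  assumes "\<nu> \<in> cochains act (Suc n)"
  shows "matching_approx \<nu> n k \<in> cochains act n"
proof (induction k)
  case 0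
  then show ?case by (simp add: cochains_def Ann_B_zero)
next
  case (Suc k)
  have "\<nu> (split_cell \<tau>) + coboundary (matching_approx \<nu> n k) (split_cell \<tau>) \<in> Ann_B act (cell_deg \<tau> + 1)"
    if \<tau>: "good \<tau>" "lower \<tau>" "length \<tau> = n" for \<tau>
  proof (rule Ann_B_add)
    note s = split_cell_cell[OF \<tau>(2,1)]
    show "\<nu> (split_cell \<tau>) \<in> Ann_B act (cell_deg \<tau> + 1)" using assms s unfolding cochains_def by (metis (mono_tags, lifting) mem_Collect_eq)
    let ?f = "of_cochain act (matching_approx \<nu> n k)"
    have "to_cochain (Hom_res_d n ?f) (Suc n) \<in> cochains act (Suc n)"
      by (rule to_cochain_in[OF Hom_res_d_in[OF of_cochain_in[OF Suc]]])
    moreover have "to_cochain (Hom_res_d n ?f) (Suc n) (split_cell \<tau>) = coboundary (matching_approx \<nu> n k) (split_cell \<tau>)"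
      using to_cochain_d[OF of_cochain_in[OF Suc], of "split_cell \<tau>"] s \<tau>(3) good_allowable to_of_cochain[OF Suc] by auto
    ultimately show "coboundary (matching_approx \<nu> n k) (split_cell \<tau>) \<in> Ann_B act (cell_deg \<tau> + 1)"
      using s unfolding cochains_def by (metis (mono_tags, lifting) mem_Collect_eq)
  qed
  then show ?case using Suc by (auto simp: cochains_def Ann_B_zero)
qed

lemma matching_solution_in:
  assumes "\<nu> \<in> cochains act (Suc n)"
  shows "matching_solution \<nu> n \<in> cochains act n"
  using matching_approx_in[OF assms] unfolding cochains_def matching_solution_def by blast

lemma matching_solution_eq:
  "matching_solution \<nu> n \<tau> = (if good \<tau> \<and> lower \<tau> \<and> length \<tau> = n
    then \<nu> (split_cell \<tau>) + coboundary (matching_approx \<nu> n (wl (concat \<tau>))) (split_cell \<tau>) else 0)"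
  by (simp add: matching_solution_def)

lemma coboundary_matching_solution:
  assumes "good \<sigma>" "upper \<sigma>" "length \<sigma> = Suc n"
  shows "coboundary (matching_solution \<nu> n) \<sigma> = \<nu> \<sigma>"
proof -
  let ?g = "matching_solution \<nu> n" and ?k = "wl (concat \<sigma>)"
  let ?r = "\<lambda>\<rho>. if wl (concat \<rho>) < ?k then 0 else ?g \<rho>"
  note m = merge_cell[OF assms(2)]
  have g0: "?g \<rho> = 0" if "upper \<rho>" for \<rho> using lower_not_upper[of \<rho>] that by (auto simp: matching_solution_eq)
  have "coboundary ?g \<sigma> = coboundary (\<lambda>\<rho>. matching_approx \<nu> n ?k \<rho> + ?r \<rho>) \<sigma>"
    by (rule arg_cong[where f = "\<lambda>\<nu>. coboundary \<nu> \<sigma>"]) (auto simp: matching_approx_eq)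
  also have "\<dots> = coboundary (matching_approx \<nu> n ?k) \<sigma> + coboundary ?r \<sigma>" by (rule coboundary_plus)
  also have "coboundary ?r \<sigma> = ?r (merge \<sigma>)"
    by (rule coboundary_upper[OF assms(2) good_allowable[OF assms(1)]]) (simp_all add: g0)
  also have "\<dots> = ?g (merge \<sigma>)" using m by simp
  also have "\<dots> = \<nu> \<sigma> + coboundary (matching_approx \<nu> n ?k) \<sigma>"
    using m merge_good[OF assms(2,1)] assms(3) by (simp add: matching_solution_eq)
  finally show ?thesis using double[of "coboundary (matching_approx \<nu> n ?k) \<sigma>"] by (simp add: add.left_commute add.commute)
qed

text \<open>The value on a lower cell is the value of the coboundary on its partner, up to cells of smaller
  weight.\<close>

lemma cocycle_vanishes:
  assumes \<nu>: "\<nu> \<in> cochains act n" and low: "\<And>\<sigma>. \<nu> \<sigma> \<noteq> 0 \<Longrightarrow> lower \<sigma>"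
    and cocycle: "\<And>\<sigma>. good \<sigma> \<Longrightarrow> length \<sigma> = Suc n \<Longrightarrow> coboundary \<nu> \<sigma> = 0"
  shows "\<nu> \<tau> = 0"
proof (induction "wl (concat \<tau>)" arbitrary: \<tau> rule: less_induct)
  case less
  show ?case
  proof (rule ccontr)
    assume nz: "\<nu> \<tau> \<noteq> 0"
    then have \<tau>: "good \<tau>" "length \<tau> = n" "lower \<tau>" using \<nu> low by (auto simp: cochains_def)
    note s = split_cell_cell[OF \<tau>(3,1)]
    have "coboundary \<nu> (split_cell \<tau>) = \<nu> (merge (split_cell \<tau>))"
    proof (rule coboundary_upper)
      show "list_all allowable (split_cell \<tau>)" using s good_allowable by blast
      show "\<nu> \<rho> = 0" if "upper \<rho>" for \<rho> using low lower_not_upper that by blast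
      show "\<nu> \<rho> = 0" if "wl (concat \<rho>) < wl (concat (split_cell \<tau>))" for \<rho> using less.hyps that s by simp
    qed (use s in blast)
    moreover have "coboundary \<nu> (split_cell \<tau>) = 0" using cocycle s \<tau>(2) by simp
    ultimately show False using s nz by simp
  qed
qed

end

section \<open>Restriction to the Koszul complex\<close>

abbreviation letter_cell :: "nat list \<Rightarrow> nat list list" where
  "letter_cell I \<equiv> map (\<lambda>i. [i]) I"

lemma cell_deg_letter_cell: "cell_deg (letter_cell I) = sum_list I"
  by (induction I) auto

lemma concat_letter_cell: "concat (letter_cell I) = I"
  by (induction I) auto

lemma good_letter_cell: "good (letter_cell I) \<longleftrightarrow> \<not> low_excess 0 I"
  by (induction I) (simp_all add: cell_deg_letter_cell not_le conj_commute del: map_map)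

lemma allowable_letter_cell: "list_all allowable (letter_cell I)"
  by (induction I) auto

lemma map_Qs_letter_cell: "map Qs (letter_cell I) = map Q I"
  by (induction I) auto

lemma not_lower_letter_cell: "\<not> lower (letter_cell I)"
  by (induction I rule: critical.induct) auto

lemma upper_letter_cell: "\<not> upper (letter_cell I) \<longleftrightarrow> critical I"
  by (induction I rule: critical.induct) auto

lemma critical_cell: "\<not> upper \<sigma> \<Longrightarrow> \<not> lower \<sigma> \<Longrightarrow> \<sigma> = letter_cell (concat \<sigma>) \<and> critical (concat \<sigma>)"
proof (induction \<sigma> rule: upper.induct)
  case (4 i K \<tau>)
  then have IH: "K # \<tau> = letter_cell (concat (K # \<tau>))" "critical (concat (K # \<tau>))" by auto
  from IH(1) obtain L where "K # \<tau> = letter_cell L" by metis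
  then obtain k where K: "K = [k]" by (cases L) auto
  have "2 * k < i" using 4(2) K by auto
  then show ?case using IH K by auto
qed auto

lemma sum_words_Cons: "(\<Sum>I\<in>words (Suc s) d. H I) = (\<Sum>r\<le>d. \<Sum>J\<in>words s (d - r). H (r # J))"
proof -
  have "(\<Sum>r\<le>d. \<Sum>J\<in>words s (d - r). H (r # J)) = (\<Sum>(r, J)\<in>Sigma {..d} (\<lambda>r. words s (d - r)). H (r # J))"
    by (rule sum.Sigma) auto
  also have "\<dots> = (\<Sum>I\<in>words (Suc s) d. H I)"
    by (rule sum.reindex_bij_witness[where i = "\<lambda>I. (hd I, tl I)" and j = "\<lambda>(r, J). r # J"])
      (auto simp: words_def length_Suc_conv)
  finally show ?thesis by simp
qed

context dl_module
begin

definition restrict :: "nat \<Rightarrow> (T \<Rightarrow> 'm) \<Rightarrow> nat \<Rightarrow> ('m, kd) tensor" where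
  "restrict n f = (\<lambda>d. \<Sum>I\<in>words n d. ten (f (bas (1 # map Q I))) (betas I))"

lemma restrict_eq: "restrict n f = (\<lambda>d. \<Sum>I\<in>words n d. ten (to_cochain f n (letter_cell I)) (betas I))"
  unfolding restrict_def
  by (intro ext sum.cong refl) (simp add: to_cochain_def allowable_letter_cell map_Qs_letter_cell words_def del: map_map)

lemma restrict_plus: "restrict n (f + g) = restrict n f + restrict n g"
  by (rule ext) (simp add: restrict_def ten_add_left sum.distrib)

text \<open>Splitting off the first two letters, the face that multiplies them contributes zero by
  \<open>canonical_element_zero\<close>, and the others do by induction.\<close>

lemma inner_faces_letter_sum:
  "(\<Sum>I\<in>words s d. ten (inner_faces \<nu> (letter_cell I)) (w * betas I)) = (0 :: ('m, kd) tensor)"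
proof (induction s arbitrary: d \<nu> w)
  case 0
  show ?case by (rule sum.neutral) (auto simp: words_def)
next
  case (Suc s)
  show ?case
  proof (cases s)
    case 0
    show ?thesis by (rule sum.neutral) (auto simp: words_def 0 length_Suc_conv)
  next
    case (Suc r)
    let ?A = "\<lambda>I. ten (lin (\<lambda>J. \<nu> (J # letter_cell (drop 2 I))) (normal_form (take 2 I))) (w * betas I)"
    let ?B = "\<lambda>I. ten (inner_faces (\<lambda>\<rho>. \<nu> ([hd I] # \<rho>)) (letter_cell (tl I))) (w * betas I)"
    have "(\<Sum>I\<in>words (Suc s) d. ten (inner_faces \<nu> (letter_cell I)) (w * betas I)) = (\<Sum>I\<in>words (Suc s) d. ?A I + ?B I)"
    proof (rule sum.cong[OF refl])
      fix I assume "I \<in> words (Suc s) d"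
      then obtain a b J where "I = a # b # J" using Suc by (auto simp: words_def length_Suc_conv)
      then show "ten (inner_faces \<nu> (letter_cell I)) (w * betas I) = ?A I + ?B I" by (simp add: ten_add_left)
    qed
    also have "\<dots> = (\<Sum>I\<in>words (Suc s) d. ?A I) + (\<Sum>I\<in>words (Suc s) d. ?B I)" by (rule sum.distrib)
    also have "(\<Sum>I\<in>words (Suc s) d. ?B I) = 0"
      unfolding sum_words_Cons by (rule sum.neutral) (simp add: Suc.IH mult.assoc[symmetric])
    also have "(\<Sum>I\<in>words (Suc s) d. ?A I) = 0"
    proof -
      have "(\<Sum>I\<in>words (Suc s) d. ?A I) = (\<Sum>(x, y)\<in>frames (Suc s) d 0. \<Sum>q\<le>d - sum_list x - sum_list y.
        ?A (x @ (d - sum_list x - sum_list y - q) # q # y))"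
        by (rule sum_words_frames) (simp add: Suc)
      also have "\<dots> = 0"
      proof (rule sum.neutral, clarify)
        fix x y :: "nat list" assume "(x, y) \<in> frames (Suc s) d 0"
        then have x: "x = []" by (simp add: frames_def)
        define n where "n = d - sum_list y"
        let ?F = "lin (\<lambda>J. \<nu> (J # letter_cell y))"
        have "(\<Sum>q\<le>n. ten (?F (normal_form [n - q, q])) (w * (Sq (Suc (n - q)) * Sq (Suc q)) * betas y)) = 0"
        proof (rule canonical_element_zero[where B = "\<lambda>x v. ten (?F x) (w * v * betas y)"
              and X = "\<lambda>q. normal_form [n - q, q]" and Y = "\<lambda>q. Sq (Suc (n - q)) * Sq (Suc q)"])
          show "normal_form [n - b, b] = (\<Sum>q\<in>allow_snd n. scale2 (adem n b q) (normal_form [n - q, q]))" if "b \<in> bad_snd n" for b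
            using normal_form_reduct[OF that, of "[]" "[]"] by (simp add: reduct_def)
        qed (simp_all add: tensor_double ten_add_left ten_add_right lin_add[OF double] distrib_left distrib_right Sq_adem)
        then show "(\<Sum>q\<le>d - sum_list x - sum_list y. ?A (x @ (d - sum_list x - sum_list y - q) # q # y)) = 0"
          by (simp add: x n_def mult.assoc numeral_2_eq_2)
      qed
      finally show ?thesis .
    qed
    finally show ?thesis by simp
  qed
qed

lemma additive_act: "additive (act a)"
  by (rule additive.intro) (rule act_add_right)

lemma additive_mult_kd: "additive (\<lambda>w. (v :: kd) * w)"
  by (rule additive.intro) (simp add: distrib_left)

lemma tensor_map_sum:
  fixes v :: kd
  shows "tensor_map (act a) (\<lambda>w. v * w) (sum g A) = (\<Sum>i\<in>A. tensor_map (act a) (\<lambda>w. v * w) (g i))"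
  by (rule additive_sum) (rule tensor_map_add[OF additive_act additive_mult_kd])

lemma restrict_d:
  assumes f: "f \<in> Hom_res act n"
  shows "restrict (Suc n) (Hom_res_d n f) = koszul_d act (restrict n f)"
proof
  fix e
  let ?\<nu> = "to_cochain f n"
  have "restrict (Suc n) (Hom_res_d n f) e = (\<Sum>I\<in>words (Suc n) e. ten (coboundary ?\<nu> (letter_cell I)) (betas I))"
    unfolding restrict_eq
    by (intro sum.cong refl arg_cong2[where f = ten] to_cochain_d[OF f] allowable_letter_cell) (simp add: words_def)
  also have "\<dots> = (\<Sum>I\<in>words (Suc n) e. ten (act (Q (hd I)) (?\<nu> (letter_cell (tl I)))) (betas I))
      + (\<Sum>I\<in>words (Suc n) e. ten (inner_faces ?\<nu> (letter_cell I)) (1 * betas I))"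
    unfolding sum.distrib[symmetric]
  proof (rule sum.cong[OF refl])
    fix I assume "I \<in> words (Suc n) e"
    then obtain i J where "I = i # J" by (auto simp: words_def length_Suc_conv)
    then show "ten (coboundary ?\<nu> (letter_cell I)) (betas I) = ten (act (Q (hd I)) (?\<nu> (letter_cell (tl I)))) (betas I)
       + ten (inner_faces ?\<nu> (letter_cell I)) (1 * betas I)"
      by (simp add: coboundary_def ten_add_left)
  qed
  also have "\<dots> = (\<Sum>r\<le>e. \<Sum>J\<in>words n (e - r). ten (act (Q r) (?\<nu> (letter_cell J))) (Sq (Suc r) * betas J))"
    by (simp only: inner_faces_letter_sum add_0_right sum_words_Cons list.sel betas_simps)
  also have "\<dots> = koszul_d act (restrict n f) e"
    unfolding koszul_d_def restrict_eq tensor_map_sum tensor_map_ten[OF additive_act additive_mult_kd] Suc_eq_plus1 ..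
  finally show "restrict (Suc n) (Hom_res_d n f) e = koszul_d act (restrict n f) e" .
qed

text \<open>A word outside \<open>L(0)\<close> is a cell that is not good, so the homomorphism vanishes on it.\<close>

lemma restrict_in_koszul:
  assumes f: "f \<in> Hom_res act n"
  shows "restrict n f \<in> koszul act n"
  unfolding koszul_def mem_Collect_eq restrict_eq
proof (intro allI span2_sum[OF tensor_double])
  fix d I assume I: "I \<in> words n d"
  note c = to_cochain_in[OF f]
  show "ten (to_cochain f n (letter_cell I)) (betas I) \<in> span2 {ten x w | x w. x \<in> Ann_B act (d + 1) \<and> w \<in> L0 n d}"
  proof (cases "low_excess 0 I")
    case True
    then have "to_cochain f n (letter_cell I) = 0" using c good_letter_cell by (auto simp: cochains_def)
    then show ?thesis by (simp add: span2_zero[OF tensor_double])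
  next
    case False
    have "betas I \<in> L0 n d" unfolding L0_eq by (rule span2_base[OF kd_double]) (use I False in auto)
    moreover have "to_cochain f n (letter_cell I) \<in> Ann_B act (d + 1)"
      using cochains_Ann[OF c, of "letter_cell I"] I by (simp add: cell_deg_letter_cell words_def del: map_map)
    ultimately show ?thesis by (intro span2_base[OF tensor_double]) blast
  qed
qed

text \<open>Every element of the Koszul complex is a combination of critical words. Prescribing the coefficients
  as the values on these words, and zero on all other cells, defines a homomorphism.\<close>

lemma restrict_surjective:
  assumes "t \<in> koszul act n"
  obtains f where "f \<in> Hom_res act n" "restrict n f = t"
proof -
  have "\<exists>x. (\<forall>c. x c \<in> Ann_B act (d + 1)) \<and> t d = (\<Sum>c\<in>critical_words n d. ten (x c) (betas c))" for d
  proof -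
    have "t d \<in> span2 {ten x w | x w. x \<in> Ann_B act (d + 1) \<and> w \<in> L0 n d}" using assms by (simp add: koszul_def)
    from L0_tensor_decompose[OF Ann_B_zero Ann_B_add this] show ?thesis by metis
  qed
  then obtain x where x: "\<And>d c. x d c \<in> Ann_B act (d + 1)" "\<And>d. t d = (\<Sum>c\<in>critical_words n d. ten (x d c) (betas c))"
    by metis
  define \<nu> where "\<nu> \<sigma> = (if \<sigma> = letter_cell (concat \<sigma>) \<and> concat \<sigma> \<in> critical_words n (sum_list (concat \<sigma>))
    then x (sum_list (concat \<sigma>)) (concat \<sigma>) else 0)" for \<sigma>
  have \<nu>_letter: "\<nu> (letter_cell I) = (if I \<in> critical_words n (sum_list I) then x (sum_list I) I else 0)" for I
    unfolding \<nu>_def by (simp only: concat_letter_cell) simp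
  have \<nu>: "\<nu> \<in> cochains act n"
    unfolding cochains_def mem_Collect_eq
  proof (intro allI conjI impI)
    fix \<sigma>
    show "\<nu> \<sigma> \<in> Ann_B act (cell_deg \<sigma> + 1)"
    proof (cases "\<sigma> = letter_cell (concat \<sigma>)")
      case True
      then obtain I where "\<sigma> = letter_cell I" by metis
      then show ?thesis using x(1)[of "sum_list I" I] by (simp add: \<nu>_letter cell_deg_letter_cell Ann_B_zero del: map_map)
    qed (simp add: \<nu>_def Ann_B_zero)
  next
    fix \<sigma> assume "\<nu> \<sigma> \<noteq> 0"
    then obtain I where I: "\<sigma> = letter_cell I" "\<nu> (letter_cell I) \<noteq> 0" unfolding \<nu>_def by metis
    then have "I \<in> critical_words n (sum_list I)" by (simp add: \<nu>_letter del: map_map split: if_splits)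
    then show "good \<sigma>" "length \<sigma> = n" unfolding I(1) good_letter_cell by (auto simp: critical_words_def words_def)
  qed
  have "restrict n (of_cochain act \<nu>) = t"
  proof
    fix d
    have "restrict n (of_cochain act \<nu>) d = (\<Sum>I\<in>words n d. ten (\<nu> (letter_cell I)) (betas I))"
      unfolding restrict_eq to_of_cochain[OF \<nu>] ..
    also have "\<dots> = (\<Sum>I\<in>critical_words n d. ten (x d I) (betas I))"
    proof (rule sum.mono_neutral_cong_right[OF finite_words])
      show "critical_words n d \<subseteq> words n d" by (auto simp: critical_words_def)
      show "\<forall>I\<in>words n d - critical_words n d. ten (\<nu> (letter_cell I)) (betas I) = 0"
        by (simp add: \<nu>_letter words_def del: map_map)
      fix I assume "I \<in> critical_words n d"
      moreover from this have "sum_list I = d" by (simp add: critical_words_def words_def)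
      ultimately show "ten (\<nu> (letter_cell I)) (betas I) = ten (x d I) (betas I)" by (simp add: \<nu>_letter del: map_map)
    qed
    finally show "restrict n (of_cochain act \<nu>) d = t d" by (simp add: x(2))
  qed
  then show thesis by (rule that[OF of_cochain_in[OF \<nu>]])
qed

text \<open>Words of letters that are not critical are upper cells or not good. So the restriction of such a
  homomorphism is the combination of the critical words with its values on them as coefficients, and
  by independence it vanishes on the critical cells too.\<close>

lemma restrict_kernel_upper:
  assumes f: "f \<in> Hom_res act n" and d: "Hom_res_d n f = 0" and r: "restrict n f = 0"
    and up: "\<And>\<sigma>. upper \<sigma> \<Longrightarrow> to_cochain f n \<sigma> = 0"
  shows "f = 0"
proof -
  let ?\<nu> = "to_cochain f n"
  note c = to_cochain_in[OF f]
  have crit: "?\<nu> (letter_cell I) = 0" if I: "critical I" for I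
  proof (rule ccontr)
    assume nz: "?\<nu> (letter_cell I) \<noteq> 0"
    define d where "d = sum_list I"
    have Iw: "I \<in> critical_words n d" using c nz I good_letter_cell[of I]
      by (auto simp: cochains_def critical_words_def words_def d_def)
    have "0 = (\<Sum>J\<in>words n d. ten (?\<nu> (letter_cell J)) (betas J))"
      using fun_cong[OF r, of d] by (simp add: restrict_eq)
    also have "\<dots> = (\<Sum>J\<in>critical_words n d. ten (?\<nu> (letter_cell J)) (betas J))"
    proof (rule sum.mono_neutral_right[OF finite_words])
      show "critical_words n d \<subseteq> words n d" by (auto simp: critical_words_def)
      show "\<forall>J\<in>words n d - critical_words n d. ten (?\<nu> (letter_cell J)) (betas J) = 0"
      proof
        fix J assume J: "J \<in> words n d - critical_words n d"
        have "?\<nu> (letter_cell J) = 0"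
        proof (cases "critical J")
          case True
          then have "\<not> good (letter_cell J)" using J good_letter_cell by (auto simp: critical_words_def)
          then show ?thesis using c by (auto simp: cochains_def)
        qed (use up upper_letter_cell in blast)
        then show "ten (?\<nu> (letter_cell J)) (betas J) = 0" by simp
      qed
    qed
    finally have "(\<Sum>J\<in>critical_words n d. ten (?\<nu> (letter_cell J)) (betas J)) = 0" by simp
    from critical_independent[OF double finite_critical_words _ this Iw] nz show False
      by (auto simp: critical_words_def words_def)
  qed
  have "?\<nu> \<tau> = 0" for \<tau>
  proof (rule cocycle_vanishes[OF c])
    fix \<sigma> assume nz: "?\<nu> \<sigma> \<noteq> 0"
    show "lower \<sigma>"
    proof (rule ccontr)
      assume "\<not> lower \<sigma>"
      moreover have "\<not> upper \<sigma>" using up nz by blast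
      ultimately show False using critical_cell[of \<sigma>] crit nz by metis
    qed
  next
    fix \<sigma> assume "good \<sigma>" "length \<sigma> = Suc n"
    then have "coboundary ?\<nu> \<sigma> = to_cochain (Hom_res_d n f) (Suc n) \<sigma>" using to_cochain_d[OF f] good_allowable by metis
    then show "coboundary ?\<nu> \<sigma> = 0" by (simp add: d to_cochain_def)
  qed
  then have "?\<nu> = (\<lambda>_. 0)" by (rule ext)
  then have "f = of_cochain act (\<lambda>_. 0)" using of_to_cochain[OF f] by simp
  moreover have "ext (\<lambda>_. 0 :: 'm) w = 0" for w by (rule ext_zero) simp
  then have "of_cochain act (\<lambda>_. 0) = 0"
    by (intro ext) (simp add: of_cochain_def lin_def sum.neutral split: list.splits)
  ultimately show ?thesis by simp
qed

lemma restrict_kernel_exact_0: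
  assumes "f \<in> Hom_res act 0" "Hom_res_d 0 f = 0" "restrict 0 f = 0"
  shows "f = 0"
proof (rule restrict_kernel_upper[OF assms])
  fix \<sigma> assume "upper \<sigma>"
  then show "to_cochain f 0 \<sigma> = 0" by (cases \<sigma>) (auto simp: to_cochain_def)
qed

text \<open>The solution \<open>g\<close> of the equation on upper cells is supported on lower cells, and words of letters
  never are lower cells; so correcting by the differential of \<open>g\<close> does not change the restriction.\<close>

lemma restrict_kernel_exact_Suc:
  assumes f: "f \<in> Hom_res act (Suc n)" "Hom_res_d (Suc n) f = 0" "restrict (Suc n) f = 0"
  obtains g where "g \<in> Hom_res act n" "restrict n g = 0" "Hom_res_d n g = f"
proof -
  let ?\<nu> = "to_cochain f (Suc n)"
  let ?\<gamma> = "matching_solution ?\<nu> n"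
  have \<gamma>: "?\<gamma> \<in> cochains act n" by (rule matching_solution_in[OF to_cochain_in[OF f(1)]])
  define g where "g = of_cochain act ?\<gamma>"
  have g: "g \<in> Hom_res act n" "to_cochain g n = ?\<gamma>"
    unfolding g_def by (rule of_cochain_in[OF \<gamma>], rule to_of_cochain[OF \<gamma>])
  have rg: "restrict n g = 0"
    by (rule ext) (auto simp: restrict_eq g(2) matching_solution_eq not_lower_letter_cell intro!: sum.neutral)
  have "f + Hom_res_d n g = 0"
  proof (rule restrict_kernel_upper)
    show "f + Hom_res_d n g \<in> Hom_res act (Suc n)" by (rule Hom_res_plus[OF f(1) Hom_res_d_in[OF g(1)]])
    show "Hom_res_d (Suc n) (f + Hom_res_d n g) = 0" by (simp only: Hom_res_d_add Hom_res_d_d f(2) add_0_right)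
    have "koszul_d act 0 = 0"
      using restrict_d[OF zero_in_Hom_res[of 0]] by (auto simp: restrict_def koszul_d_def fun_eq_iff Hom_res_d_def)
    then show "restrict (Suc n) (f + Hom_res_d n g) = 0" by (simp only: restrict_plus restrict_d[OF g(1)] rg f(3) add_0_right)
    fix \<sigma> assume up: "upper \<sigma>"
    show "to_cochain (f + Hom_res_d n g) (Suc n) \<sigma> = 0"
    proof (rule ccontr)
      assume nz: "to_cochain (f + Hom_res_d n g) (Suc n) \<sigma> \<noteq> 0"
      have "to_cochain (f + Hom_res_d n g) (Suc n) \<in> cochains act (Suc n)"
        by (rule to_cochain_in[OF Hom_res_plus[OF f(1) Hom_res_d_in[OF g(1)]]])
      then have \<sigma>: "good \<sigma>" "length \<sigma> = Suc n" using nz by (auto simp: cochains_def)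
      have "to_cochain (Hom_res_d n g) (Suc n) \<sigma> = coboundary ?\<gamma> \<sigma>"
        using to_cochain_d[OF g(1) good_allowable[OF \<sigma>(1)] \<sigma>(2)] g(2) by simp
      also have "\<dots> = ?\<nu> \<sigma>" by (rule coboundary_matching_solution[OF \<sigma>(1) up \<sigma>(2)])
      finally show False using nz double by (simp add: to_cochain_plus)
    qed
  qed
  then have "f z = Hom_res_d n g z" for z
    using double_eqI[OF double] by (metis plus_fun_apply zero_fun_apply)
  then have "Hom_res_d n g = f" by (intro ext) simp
  then show thesis by (rule that[OF g(1) rg])
qed

end


section \<open>The comparison of cohomology groups\<close>

lemma additive_group_simps [simp]:
  "carrier (additive_group S) = S" "x \<otimes>\<^bsub>additive_group S\<^esub> y = x + y" "\<one>\<^bsub>additive_group S\<^esub> = 0"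
  by (simp_all add: additive_group_def)

lemma comm_group_additive_group:
  assumes "0 \<in> S" "\<And>x y. x \<in> S \<Longrightarrow> y \<in> S \<Longrightarrow> x + y \<in> (S :: 'a::ab_group_add set)" "\<And>x. x \<in> S \<Longrightarrow> x + x = 0"
  shows "comm_group (additive_group S)"
proof (rule comm_groupI)
  fix x assume "x \<in> carrier (additive_group S)"
  then show "\<exists>y\<in>carrier (additive_group S). y \<otimes>\<^bsub>additive_group S\<^esub> x = \<one>\<^bsub>additive_group S\<^esub>"
    using assms(3) by (intro bexI[of _ x]) simp_all
qed (use assms in \<open>auto simp: algebra_simps\<close>)

lemma additive_quotient_iso:
  fixes Z B :: "'a::ab_group_add set" and Z' B' :: "'b::ab_group_add set"
  assumes Z: "0 \<in> Z" "\<And>x y. x \<in> Z \<Longrightarrow> y \<in> Z \<Longrightarrow> x + y \<in> Z" "\<And>x. x \<in> Z \<Longrightarrow> x + x = 0"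
    and Z': "0 \<in> Z'" "\<And>x y. x \<in> Z' \<Longrightarrow> y \<in> Z' \<Longrightarrow> x + y \<in> Z'" "\<And>x. x \<in> Z' \<Longrightarrow> x + x = 0"
    and B': "0 \<in> B'" "\<And>x y. x \<in> B' \<Longrightarrow> y \<in> B' \<Longrightarrow> x + y \<in> B'" "B' \<subseteq> Z'"
    and \<phi>: "\<And>x y. \<phi> (x + y) = \<phi> x + \<phi> y" "\<And>x. x \<in> Z \<Longrightarrow> \<phi> x \<in> Z'"
    and ker: "\<And>x. x \<in> Z \<Longrightarrow> \<phi> x \<in> B' \<longleftrightarrow> x \<in> B" "B \<subseteq> Z"
    and surj: "\<And>z. z \<in> Z' \<Longrightarrow> \<exists>x\<in>Z. \<phi> x = z"
  shows "additive_group Z Mod B \<cong> additive_group Z' Mod B'"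
proof -
  let ?G = "additive_group Z" and ?H = "additive_group Z'"
  interpret G: comm_group ?G by (rule comm_group_additive_group[OF Z])
  interpret H: comm_group ?H by (rule comm_group_additive_group[OF Z'])
  have sub: "subgroup B' ?H"
  proof (rule H.subgroupI)
    fix x assume x: "x \<in> B'"
    have "inv\<^bsub>?H\<^esub> x = x" using x B'(3) Z'(3) by (intro H.inv_equality) auto
    then show "inv\<^bsub>?H\<^esub> x \<in> B'" using x by simp
  qed (use B' in auto)
  interpret N: normal B' ?H by (rule H.subgroup_imp_normal[OF sub])
  have hom: "(\<lambda>x. B' #>\<^bsub>?H\<^esub> \<phi> x) \<in> hom ?G (?H Mod B')"
  proof (rule homI)
    fix x y assume "x \<in> carrier ?G" "y \<in> carrier ?G"
    then have "\<phi> x \<in> carrier ?H" "\<phi> y \<in> carrier ?H" using \<phi>(2) by simp_all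
    from hom_mult[OF N.r_coset_hom_Mod this]
    show "B' #>\<^bsub>?H\<^esub> \<phi> (x \<otimes>\<^bsub>?G\<^esub> y) = (B' #>\<^bsub>?H\<^esub> \<phi> x) \<otimes>\<^bsub>?H Mod B'\<^esub> (B' #>\<^bsub>?H\<^esub> \<phi> y)" by (simp add: \<phi>(1))
  next
    fix x assume "x \<in> carrier ?G"
    then show "B' #>\<^bsub>?H\<^esub> \<phi> x \<in> carrier (?H Mod B')"
      using \<phi>(2) by (auto simp: FactGroup_def RCOSETS_def)
  qed
  interpret h: group_hom ?G "?H Mod B'" "\<lambda>x. B' #>\<^bsub>?H\<^esub> \<phi> x"
    by (rule group_hom.intro[OF G.is_group N.factorgroup_is_group]) (simp add: group_hom_axioms_def hom)
  have kernel: "kernel ?G (?H Mod B') (\<lambda>x. B' #>\<^bsub>?H\<^esub> \<phi> x) = B"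
  proof -
    have "B' #>\<^bsub>?H\<^esub> y = B' \<longleftrightarrow> y \<in> B'" if "y \<in> Z'" for y
      using H.coset_join1[OF _ _ sub, of y] H.coset_join2[OF _ sub, of y] that B'(3) by auto
    then show ?thesis using ker \<phi>(2) by (auto simp: kernel_def FactGroup_def)
  qed
  have "(\<lambda>x. B' #>\<^bsub>?H\<^esub> \<phi> x) ` carrier ?G = carrier (?H Mod B')"
  proof
    show "carrier (?H Mod B') \<subseteq> (\<lambda>x. B' #>\<^bsub>?H\<^esub> \<phi> x) ` carrier ?G"
    proof
      fix X assume "X \<in> carrier (?H Mod B')"
      then obtain z where "z \<in> Z'" "X = B' #>\<^bsub>?H\<^esub> z" by (auto simp: FactGroup_def RCOSETS_def)
      then show "X \<in> (\<lambda>x. B' #>\<^bsub>?H\<^esub> \<phi> x) ` carrier ?G" using surj[of z] by auto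
    qed
  qed auto
  from h.FactGroup_iso[OF this] show ?thesis by (simp only: kernel)
qed

context dl_module
begin

lemma koszul_zero: "0 \<in> koszul act n"
  by (simp add: koszul_def span2_zero[OF tensor_double])

lemma koszul_plus: "t \<in> koszul act n \<Longrightarrow> u \<in> koszul act n \<Longrightarrow> t + u \<in> koszul act n"
  by (simp add: koszul_def span2_add[OF tensor_double])

lemma koszul_d_plus: "koszul_d act (t + u) = koszul_d act t + koszul_d act u"
  by (rule ext) (simp add: koszul_d_def tensor_map_add[OF additive_act additive_mult_kd] sum.distrib)

lemma koszul_d_zero: "koszul_d act 0 = 0"
  by (rule additive_zero[of "koszul_d act", OF koszul_d_plus])

lemma koszul_d_in:
  assumes "t \<in> koszul act n"
  shows "koszul_d act t \<in> koszul act (Suc n)"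
proof -
  obtain f where f: "f \<in> Hom_res act n" "restrict n f = t" by (rule restrict_surjective[OF assms])
  then show ?thesis using restrict_in_koszul[OF Hom_res_d_in[OF f(1)]] restrict_d[OF f(1)] by simp
qed

lemma koszul_d_d:
  assumes "t \<in> koszul act n"
  shows "koszul_d act (koszul_d act t) = 0"
proof -
  obtain f where f: "f \<in> Hom_res act n" "restrict n f = t" by (rule restrict_surjective[OF assms])
  have "restrict (Suc (Suc n)) (Hom_res_d (Suc n) (Hom_res_d n f)) = koszul_d act (koszul_d act t)"
    using restrict_d[OF f(1)] restrict_d[OF Hom_res_d_in[OF f(1)]] f(2) by simp
  then show ?thesis by (simp add: Hom_res_d_d) (simp add: restrict_def fun_eq_iff)
qed

lemma koszul_subset_completed: "koszul act n \<subseteq> completed_tensor n"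
proof
  fix t assume t: "t \<in> koszul act n"
  show "t \<in> completed_tensor n"
    unfolding completed_tensor_def mem_Collect_eq
  proof
    fix d
    have "t d \<in> span2 {ten x w | x w. x \<in> Ann_B act (d + 1) \<and> w \<in> L0 n d}" using t by (simp add: koszul_def)
    then show "t d \<in> span2 {ten x w | x w. w \<in> kd_part n d}"
      by (rule span2_mono[OF tensor_double, rotated]) (rule span2_base[OF tensor_double], use L0_subset_kd_part in blast)
  qed
qed

text \<open>The usual diagram chase for a surjective chain map with acyclic kernel.\<close>

theorem Ext_iso_koszul: "Ext_U act n \<cong> cohomology (koszul act) (\<lambda>_. koszul_d act) n"
  unfolding Ext_U_def cohomology_def
proof (rule additive_quotient_iso[where \<phi> = "restrict n"])
  let ?Z = "{f \<in> Hom_res act n. Hom_res_d n f = 0}" and ?Z' = "{t \<in> koszul act n. koszul_d act t = 0}"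
  let ?B = "case n of 0 \<Rightarrow> {0} | Suc m \<Rightarrow> Hom_res_d m ` Hom_res act m"
  let ?B' = "case n of 0 \<Rightarrow> {0} | Suc m \<Rightarrow> koszul_d act ` koszul act m"
  have d0: "Hom_res_d k (0 :: T \<Rightarrow> 'm) = 0" for k by (rule additive_zero[of "Hom_res_d k", OF Hom_res_d_add])
  have r0: "restrict k 0 = 0" for k by (rule additive_zero[of "restrict k", OF restrict_plus])
  show "0 \<in> ?Z" by (simp add: zero_in_Hom_res d0)
  show "x + y \<in> ?Z" if "x \<in> ?Z" "y \<in> ?Z" for x y using that by (simp add: Hom_res_plus Hom_res_d_add)
  show "x + x = 0" if "x \<in> ?Z" for x by (rule ext) (simp add: double)
  show "0 \<in> ?Z'" by (simp add: koszul_zero koszul_d_zero)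
  show "x + y \<in> ?Z'" if "x \<in> ?Z'" "y \<in> ?Z'" for x y using that by (simp add: koszul_plus koszul_d_plus)
  show "x + x = 0" if "x \<in> ?Z'" for x by (rule ext) (simp add: tensor_double)
  show "0 \<in> ?B'" using koszul_zero koszul_d_zero by (cases n) (auto intro: rev_image_eqI)
  show "x + y \<in> ?B'" if "x \<in> ?B'" "y \<in> ?B'" for x y
    using that koszul_plus by (cases n) (auto simp: koszul_d_plus[symmetric])
  show "?B' \<subseteq> ?Z'" using koszul_d_in koszul_d_d by (cases n) (auto simp: koszul_zero koszul_d_zero)
  show "restrict n (x + y) = restrict n x + restrict n y" for x y by (rule restrict_plus)
  show "restrict n x \<in> ?Z'" if "x \<in> ?Z" for x
    using that restrict_in_koszul[of x n] restrict_d[of x n] r0 by auto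
  show "?B \<subseteq> ?Z" using Hom_res_d_in by (cases n) (auto simp: zero_in_Hom_res d0 Hom_res_d_d)
  show "restrict n x \<in> ?B' \<longleftrightarrow> x \<in> ?B" if "x \<in> ?Z" for x
  proof (cases n)
    case 0
    then show ?thesis using that restrict_kernel_exact_0[of x] r0 by auto
  next
    case (Suc m)
    show ?thesis
    proof
      assume "x \<in> ?B"
      then show "restrict n x \<in> ?B'" using restrict_d restrict_in_koszul by (auto simp: Suc)
    next
      assume "restrict n x \<in> ?B'"
      then obtain t where t: "t \<in> koszul act m" "restrict n x = koszul_d act t" by (auto simp: Suc)
      obtain g where g: "g \<in> Hom_res act m" "restrict m g = t" by (rule restrict_surjective[OF t(1)])
      let ?y = "x + Hom_res_d m g"
      have "?y \<in> Hom_res act (Suc m)" using that Suc Hom_res_plus Hom_res_d_in[OF g(1)] by auto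
      moreover have "Hom_res_d (Suc m) ?y = 0" using that Suc by (simp add: Hom_res_d_add Hom_res_d_d)
      moreover have "restrict (Suc m) ?y = 0"
        using t(2) Suc restrict_d[OF g(1)] g(2) by (simp add: restrict_plus) (simp add: fun_eq_iff tensor_double)
      ultimately obtain g' where g': "g' \<in> Hom_res act m" "Hom_res_d m g' = ?y" by (rule restrict_kernel_exact_Suc)
      have "x = Hom_res_d m (g' + g)"
      proof
        fix z
        have "x z + (Hom_res_d m g z + Hom_res_d m g z) = Hom_res_d m g' z + Hom_res_d m g z"
          using fun_cong[OF g'(2), of z] by (simp add: add.assoc)
        then show "x z = Hom_res_d m (g' + g) z" by (simp add: Hom_res_d_add double)
      qed
      then show "x \<in> ?B" using Hom_res_plus[OF g'(1) g(1)] by (simp add: Suc)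
    qed
  qed
  show "\<exists>x\<in>?Z. restrict n x = z" if z: "z \<in> ?Z'" for z
  proof -
    obtain f where f: "f \<in> Hom_res act n" "restrict n f = z" using z by (auto intro: restrict_surjective)
    have "restrict (Suc n) (Hom_res_d n f) = 0" using restrict_d[OF f(1)] f(2) z by simp
    then obtain g where g: "g \<in> Hom_res act n" "restrict n g = 0" "Hom_res_d n g = Hom_res_d n f"
      using restrict_kernel_exact_Suc[OF Hom_res_d_in[OF f(1)] Hom_res_d_d] by blast
    have "Hom_res_d n (f + g) = 0" by (rule ext) (simp add: Hom_res_d_add g(3) double)
    then show ?thesis using Hom_res_plus[OF f(1) g(1)] f(2) g(2) by (intro bexI[of _ "f + g"]) (simp_all add: restrict_plus)
  qed
qed

end

theorem theorem2p13:
  fixes act :: "dl \<Rightarrow> 'm::ab_group_add \<Rightarrow> 'm" and M :: "nat \<Rightarrow> 'm set"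
  assumes "U_module act M"
  shows "(\<forall>s. koszul act s \<subseteq> completed_tensor s)
    \<and> (\<forall>s. \<forall>t \<in> koszul act s. koszul_d act t \<in> koszul act (Suc s))
    \<and> (\<forall>s. \<forall>t \<in> koszul act s. koszul_d act (koszul_d act t) = 0)
    \<and> (\<forall>s. Ext_U act s \<cong> cohomology (koszul act) (\<lambda>_. koszul_d act) s)"
proof -
  interpret U_module act M by (rule assms)
  show ?thesis using koszul_subset_completed koszul_d_in koszul_d_d Ext_iso_koszul by blast
qed

end
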